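(* Any purely periodic convex translation surface is a torus branched covering.
   Context: A translation surface is a triple $(\mathcal{S},\Sigma,\omega)$, where $\mathcal{S}$ is a compact connected topological surface, $\Sigma$ is a finite subset of $\mathcal{S}$ (its elements are called singularities) and $\omega=(U_i,\phi_i)_{i\in I}$ is an atlas of $\mathcal{S}\setminus\Sigma$, consistent with the topology of $\mathcal{S}$, whose transition maps are translations of $\mathbb{R}^2$. This atlas gives $\mathcal{S}\setminus\Sigma$ a flat Riemannian structure (hence notions of length, direction, area measure, geodesic), and $\mathcal{S}$ is assumed to be the completion of $\mathcal{S}\setminus\Sigma$ for this metric. For $\theta\in\mathbb{S}^1$, the directional flow $\phi_\theta$ moves points at unit speed along straight lines of direction $\theta$ (direction being read in the charts); it is defined for almost every point for all times (trajectories hitting a singularity are not continued). A periodic orbit in the direction $\theta$ is a closed orbit of $\phi_\theta$ in $\mathcal{S}\setminus\Sigma$. $\mathcal{S}$ is purely periodic if for every $\theta\in\mathbb{S}^1$, the existence of a periodic orbit in the direction $\theta$ implies that the directional flow $\phi_\theta$ is periodic, i.e. there exists $T>0$ such that $\phi_\theta^T=\mathrm{Id}_{\mathcal{S}}$ almost everywhere. Let $P$ be a simply connected polygon of $\mathbb{R}^2$ whose edges are grouped in pairs such that two edges in the same pair have the same length and direction but opposite orientation (for the orientation of the boundary of $P$ induced by the canonical orientation of $\mathbb{R}^2$). A geometrical side of $P$ may be subdivided into more than one edge (so angles equal to $\pi$ at vertices are allowed). $P$ is a pattern of $\mathcal{S}$ if $\mathcal{S}$ can be obtained from $P$ by identifying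 the edges in each pair by translation (the singularities of $\mathcal{S}$ are therefore located at some vertices of $P$). A translation surface is convex if it admits a pattern that is convex. A branched translation covering between two translation surfaces is a map $\pi:(\mathcal{S},\Sigma)\to(\mathcal{S}',\Sigma')$ that is a topological branched covering and locally preserves the translation structure (i.e. is a translation in the charts, away from the finitely many singular/branch points). A torus branched covering is a translation surface $\mathcal{S}$ such that there exists a branched translation covering from $\mathcal{S}$ to a flat torus $\mathbb{R}^2/\Lambda$, $\Lambda$ a lattice of $\mathbb{R}^2$ (the torus possibly carrying a finite set $\Sigma'$ of marked points). *)

theory Defs
  imports "HOL-Analysis.Analysis"
begin

section \<open>Translation surfaces\<close>

definition topological_surface :: "'a topology \<Rightarrow> bool" where
  "topological_surface X \<longleftrightarrow>
     Hausdorff_space X \<and> second_countable X \<and>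
     (\<forall>x \<in> topspace X. \<exists>U V. openin X U \<and> x \<in> U \<and> open (V :: (real ^ 2) set) \<and>
        subtopology X U homeomorphic_space top_of_set V)"

text \<open>The atlas is a set of charts \<open>(U, \<phi>)\<close>; the values of \<open>\<phi>\<close> outside \<open>U\<close> are never used.\<close>

record 'a tsurf =
  surf :: "'a topology"
  sing :: "'a set"
  atlas :: "('a set \<times> ('a \<Rightarrow> real ^ 2)) set"

definition regular_part :: "'a tsurf \<Rightarrow> 'a set" where
  "regular_part M = topspace (surf M) - sing M"

text \<open>As usual for \<open>(G,X)\<close>-structures, a transition map between charts whose overlap is
  disconnected may be a different translation on different components of the overlap.\<close>

definition translation_atlas :: "'a tsurf \<Rightarrow> bool" where
  "translation_atlas M \<longleftrightarrow>
     (\<Union>(U, \<phi>) \<in> atlas M. U) = regular_part M \<and>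
     (\<forall>(U, \<phi>) \<in> atlas M. openin (surf M) U \<and> open (\<phi> ` U) \<and>
        homeomorphic_map (subtopology (surf M) U) (top_of_set (\<phi> ` U)) \<phi>) \<and>
     (\<forall>(U, \<phi>) \<in> atlas M. \<forall>(V, \<psi>) \<in> atlas M. \<forall>x \<in> U \<inter> V.
        \<exists>W v. openin (surf M) W \<and> x \<in> W \<and> W \<subseteq> U \<inter> V \<and> (\<forall>y \<in> W. \<psi> y = \<phi> y + v))"

text \<open>Velocity of a path \<open>[0,1] \<rightarrow> S \<setminus> \<Sigma>\<close>; it does not depend on the chart, because the
  transition maps are locally translations.\<close>

definition has_velocity :: "'a tsurf \<Rightarrow> (real \<Rightarrow> 'a) \<Rightarrow> real ^ 2 \<Rightarrow> real \<Rightarrow> bool" where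
  "has_velocity M \<gamma> v t \<longleftrightarrow>
     (\<exists>(U, \<phi>) \<in> atlas M. \<gamma> t \<in> U \<and> ((\<phi> \<circ> \<gamma>) has_vector_derivative v) (at t within {0..1}))"

text \<open>\<open>\<gamma>\<close> is a piecewise \<open>C\<^sup>1\<close> path of length \<open>l\<close> for the flat Riemannian structure.\<close>

definition has_flat_length :: "'a tsurf \<Rightarrow> (real \<Rightarrow> 'a) \<Rightarrow> real \<Rightarrow> bool" where
  "has_flat_length M \<gamma> l \<longleftrightarrow>
     pathin (subtopology (surf M) (regular_part M)) \<gamma> \<and>
     (\<exists>F v. finite F \<and> continuous_on ({0..1} - F) v \<and>
        (\<forall>t \<in> {0..1} - F. has_velocity M \<gamma> (v t) t) \<and>
        ((\<lambda>t. norm (v t)) has_integral l) {0..1})"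

definition flat_dist :: "'a tsurf \<Rightarrow> 'a \<Rightarrow> 'a \<Rightarrow> real" where
  "flat_dist M x y = Inf {l. \<exists>\<gamma>. has_flat_length M \<gamma> l \<and> \<gamma> 0 = x \<and> \<gamma> 1 = y}"

definition is_flat_completion :: "'a tsurf \<Rightarrow> bool" where
  "is_flat_completion M \<longleftrightarrow>
     (\<exists>d. Metric_space (topspace (surf M)) d \<and>
        Metric_space.mtopology (topspace (surf M)) d = surf M \<and>
        Metric_space.mcomplete (topspace (surf M)) d \<and>
        (\<forall>x \<in> regular_part M. \<forall>y \<in> regular_part M. d x y = flat_dist M x y) \<and>
        surf M closure_of regular_part M = topspace (surf M))"

definition translation_surface :: "'a tsurf \<Rightarrow> bool" where
  "translation_surface M \<longleftrightarrow>
     topological_surface (surf M) \<and> compact_space (surf M) \<and> connected_space (surf M) \<and>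
     finite (sing M) \<and> sing M \<subseteq> topspace (surf M) \<and>
     translation_atlas M \<and> is_flat_completion M"


section \<open>Directional flow\<close>

definition flow_line :: "'a tsurf \<Rightarrow> real ^ 2 \<Rightarrow> real \<Rightarrow> (real \<Rightarrow> 'a) \<Rightarrow> bool" where
  "flow_line M \<theta> T \<gamma> \<longleftrightarrow>
     (\<forall>t \<in> {0..T}. \<gamma> t \<in> regular_part M \<and>
        (\<forall>(U, \<phi>) \<in> atlas M. \<gamma> t \<in> U \<longrightarrow>
           (\<exists>e>0. \<forall>s \<in> {0..T}. \<bar>s - t\<bar> < e \<longrightarrow>
              \<gamma> s \<in> U \<and> \<phi> (\<gamma> s) = \<phi> (\<gamma> t) + (s - t) *\<^sub>R \<theta>)))"

text \<open>The partially defined flow as a relation: \<open>flows M \<theta> T x y\<close> says that the trajectory of \<open>x\<close>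
  in direction \<open>\<theta>\<close> is defined up to time \<open>T\<close>, that is, meets no singularity, and that
  \<open>\<phi>\<^sub>\<theta>\<^sup>T(x) = y\<close>.\<close>

definition flows :: "'a tsurf \<Rightarrow> real ^ 2 \<Rightarrow> real \<Rightarrow> 'a \<Rightarrow> 'a \<Rightarrow> bool" where
  "flows M \<theta> T x y \<longleftrightarrow> (\<exists>\<gamma>. flow_line M \<theta> T \<gamma> \<and> \<gamma> 0 = x \<and> \<gamma> T = y)"

definition has_periodic_orbit :: "'a tsurf \<Rightarrow> real ^ 2 \<Rightarrow> bool" where
  "has_periodic_orbit M \<theta> \<longleftrightarrow> (\<exists>T>0. \<exists>x. flows M \<theta> T x x)"

text \<open>The area measure is Lebesgue measure in the charts and the finite set of singularities has
  area zero, so a set is null if and only if its image in every chart is Lebesgue-null.\<close>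

definition AE_surface :: "'a tsurf \<Rightarrow> ('a \<Rightarrow> bool) \<Rightarrow> bool" where
  "AE_surface M P \<longleftrightarrow> (\<forall>(U, \<phi>) \<in> atlas M. negligible (\<phi> ` {x \<in> U. \<not> P x}))"

definition periodic_flow :: "'a tsurf \<Rightarrow> real ^ 2 \<Rightarrow> bool" where
  "periodic_flow M \<theta> \<longleftrightarrow> (\<exists>T>0. AE_surface M (\<lambda>x. flows M \<theta> T x x))"

definition purely_periodic :: "'a tsurf \<Rightarrow> bool" where
  "purely_periodic M \<longleftrightarrow> (\<forall>\<theta> \<in> sphere 0 1. has_periodic_orbit M \<theta> \<longrightarrow> periodic_flow M \<theta>)"


section \<open>Polygons and patterns\<close>

text \<open>A polygon is given by the cyclic list of its vertices, at which angles equal to \<open>\<pi>\<close> are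
  allowed.\<close>

definition vertex :: "(real ^ 2) list \<Rightarrow> nat \<Rightarrow> real ^ 2" where
  "vertex vs i = vs ! (i mod length vs)"

definition edge :: "(real ^ 2) list \<Rightarrow> nat \<Rightarrow> (real ^ 2) set" where
  "edge vs i = closed_segment (vertex vs i) (vertex vs (Suc i))"

definition is_polygon :: "(real ^ 2) list \<Rightarrow> bool" where
  "is_polygon vs \<longleftrightarrow> 3 \<le> length vs \<and> distinct vs \<and>
     (\<forall>i < length vs. \<forall>j < length vs. i \<noteq> j \<longrightarrow>
        edge vs i \<inter> edge vs j = {vertex vs i, vertex vs (Suc i)} \<inter> {vertex vs j, vertex vs (Suc j)})"

definition polygon_boundary :: "(real ^ 2) list \<Rightarrow> (real ^ 2) set" where
  "polygon_boundary vs = (\<Union>i < length vs. edge vs i)"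

definition polygon_region :: "(real ^ 2) list \<Rightarrow> (real ^ 2) set" where
  "polygon_region vs = polygon_boundary vs \<union> inside (polygon_boundary vs)"

text \<open>Edges are oriented along the list. Whether this is the positive or the negative orientation
  of the boundary is immaterial, since only opposition of orientations matters.\<close>

definition edge_pairing :: "(real ^ 2) list \<Rightarrow> (nat \<Rightarrow> nat) \<Rightarrow> bool" where
  "edge_pairing vs \<sigma> \<longleftrightarrow>
     (\<forall>i < length vs. \<sigma> i < length vs \<and> \<sigma> i \<noteq> i \<and> \<sigma> (\<sigma> i) = i \<and>
        vertex vs (Suc (\<sigma> i)) - vertex vs (\<sigma> i) = - (vertex vs (Suc i) - vertex vs i))"

text \<open>The translation from edge \<open>i\<close> to edge \<open>\<sigma> i\<close> maps the initial vertex of the former to the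
  final vertex of the latter.\<close>

definition glued :: "(real ^ 2) list \<Rightarrow> (nat \<Rightarrow> nat) \<Rightarrow> real ^ 2 \<Rightarrow> real ^ 2 \<Rightarrow> bool" where
  "glued vs \<sigma> x y \<longleftrightarrow>
     (\<exists>i < length vs. x \<in> edge vs i \<and> y = x + (vertex vs (Suc (\<sigma> i)) - vertex vs i))"

text \<open>The map \<open>q\<close> exhibits the surface, with its topology and its translation structure, as
  the polygon with paired edges identified.\<close>

definition is_pattern :: "'a tsurf \<Rightarrow> (real ^ 2) list \<Rightarrow> (nat \<Rightarrow> nat) \<Rightarrow> bool" where
  "is_pattern M vs \<sigma> \<longleftrightarrow> is_polygon vs \<and> edge_pairing vs \<sigma> \<and>
     (\<exists>q. quotient_map (top_of_set (polygon_region vs)) (surf M) q \<and>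
        (\<forall>x \<in> polygon_region vs. \<forall>y \<in> polygon_region vs.
           q x = q y \<longleftrightarrow> equivclp (glued vs \<sigma>) x y) \<and>
        sing M \<subseteq> q ` set vs \<and>
        (\<forall>p \<in> polygon_region vs. \<forall>(U, \<phi>) \<in> atlas M. q p \<in> U \<longrightarrow>
           (\<exists>e>0. \<forall>z \<in> polygon_region vs \<inter> ball p e.
              q z \<in> U \<and> \<phi> (q z) = \<phi> (q p) + (z - p))))"

definition convex_translation_surface :: "'a tsurf \<Rightarrow> bool" where
  "convex_translation_surface M \<longleftrightarrow>
     translation_surface M \<and> (\<exists>vs \<sigma>. is_pattern M vs \<sigma> \<and> convex (polygon_region vs))"


section \<open>Branched translation coverings\<close>

text \<open>The analogue of \<^const>\<open>covering_space\<close> for abstract topologies.\<close>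

definition covering_map :: "'a topology \<Rightarrow> 'b topology \<Rightarrow> ('a \<Rightarrow> 'b) \<Rightarrow> bool" where
  "covering_map X Y p \<longleftrightarrow>
     continuous_map X Y p \<and> p ` topspace X = topspace Y \<and>
     (\<forall>y \<in> topspace Y. \<exists>V. openin Y V \<and> y \<in> V \<and>
        (\<exists>\<U>. \<Union>\<U> = {x \<in> topspace X. p x \<in> V} \<and> (\<forall>U \<in> \<U>. openin X U) \<and> pairwise disjnt \<U> \<and>
           (\<forall>U \<in> \<U>. homeomorphic_map (subtopology X U) (subtopology Y V) p)))"

text \<open>Between compact surfaces: a covering outside a finite set \<open>B\<close> of branch values with finite
  preimage. The local form \<open>z \<mapsto> z\<^sup>k\<close> at the points over \<open>B\<close> is then automatic.\<close>

definition branched_covering_map :: "'a topology \<Rightarrow> 'b topology \<Rightarrow> ('a \<Rightarrow> 'b) \<Rightarrow> bool" where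
  "branched_covering_map X Y p \<longleftrightarrow>
     continuous_map X Y p \<and> p ` topspace X = topspace Y \<and>
     (\<exists>B. finite B \<and> B \<subseteq> topspace Y \<and> finite {x \<in> topspace X. p x \<in> B} \<and>
        covering_map (subtopology X {x \<in> topspace X. p x \<notin> B}) (subtopology Y (topspace Y - B)) p)"

definition branched_translation_covering :: "'a tsurf \<Rightarrow> 'b tsurf \<Rightarrow> ('a \<Rightarrow> 'b) \<Rightarrow> bool" where
  "branched_translation_covering M N p \<longleftrightarrow>
     branched_covering_map (surf M) (surf N) p \<and> p ` sing M \<subseteq> sing N \<and>
     (\<forall>(U, \<phi>) \<in> atlas M. \<forall>(V, \<psi>) \<in> atlas N. \<forall>x \<in> U. p x \<in> V \<longrightarrow>
        (\<exists>W v. openin (surf M) W \<and> x \<in> W \<and> W \<subseteq> U \<and>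
           (\<forall>y \<in> W. p y \<in> V \<and> \<psi> (p y) = \<phi> y + v)))"


section \<open>Flat tori\<close>

definition is_lattice :: "(real ^ 2) set \<Rightarrow> bool" where
  "is_lattice \<Lambda> \<longleftrightarrow>
     (\<exists>a b. a \<noteq> b \<and> independent {a, b} \<and> \<Lambda> = {of_int m *\<^sub>R a + of_int n *\<^sub>R b | m n. True})"

definition coset :: "(real ^ 2) set \<Rightarrow> real ^ 2 \<Rightarrow> (real ^ 2) set" where
  "coset \<Lambda> x = (\<lambda>l. x + l) ` \<Lambda>"

definition torus_topology :: "(real ^ 2) set \<Rightarrow> (real ^ 2) set topology" where
  "torus_topology \<Lambda> = topology (\<lambda>U. U \<subseteq> range (coset \<Lambda>) \<and> open (coset \<Lambda> -` U))"

lemma openin_torus_topology: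
  "openin (torus_topology \<Lambda>) U \<longleftrightarrow> U \<subseteq> range (coset \<Lambda>) \<and> open (coset \<Lambda> -` U)"
proof -
  have "istopology (\<lambda>U. U \<subseteq> range (coset \<Lambda>) \<and> open (coset \<Lambda> -` U))"
    unfolding istopology_def by (auto simp: vimage_Union)
  then show ?thesis
    by (simp add: torus_topology_def topology_inverse')
qed

lemma topspace_torus_topology [simp]: "topspace (torus_topology \<Lambda>) = range (coset \<Lambda>)"
proof
  show "topspace (torus_topology \<Lambda>) \<subseteq> range (coset \<Lambda>)"
    using openin_topspace openin_torus_topology by blast
  have "coset \<Lambda> -` range (coset \<Lambda>) = UNIV"
    by auto
  then have "openin (torus_topology \<Lambda>) (range (coset \<Lambda>))"
    by (simp add: openin_torus_topology)
  then show "range (coset \<Lambda>) \<subseteq> topspace (torus_topology \<Lambda>)"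
    by (rule openin_subset)
qed

lemma quotient_map_coset: "quotient_map euclidean (torus_topology \<Lambda>) (coset \<Lambda>)"
  by (auto simp: quotient_map_def openin_torus_topology vimage_def)

text \<open>The torus \<open>\<real>\<^sup>2/\<Lambda>\<close> with marked points \<open>F\<close>; its charts are the local inverses of the
  projection over open sets avoiding \<open>F\<close>.\<close>

definition flat_torus :: "(real ^ 2) set \<Rightarrow> (real ^ 2) set set \<Rightarrow> (real ^ 2) set tsurf" where
  "flat_torus \<Lambda> F =
     \<lparr>surf = torus_topology \<Lambda>, sing = F,
      atlas = {(coset \<Lambda> ` B, inv_into B (coset \<Lambda>)) | B.
                 open B \<and> inj_on (coset \<Lambda>) B \<and> coset \<Lambda> ` B \<inter> F = {}}\<rparr>"

definition torus_branched_covering :: "'a tsurf \<Rightarrow> bool" where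
  "torus_branched_covering M \<longleftrightarrow> translation_surface M \<and>
     (\<exists>\<Lambda> F p. is_lattice \<Lambda> \<and> finite F \<and> F \<subseteq> range (coset \<Lambda>) \<and>
        branched_translation_covering M (flat_torus \<Lambda> F) p)"

end

theory Submission
  imports Defs
begin

text \<open>Let \<open>\<tau> i\<close> be the translation that glues edge \<open>i\<close> of the convex pattern to its partner. By
  convexity the segment from a point \<open>x\<close> of edge \<open>i\<close> to \<open>x + \<tau> i\<close> stays in the polygon and closes up to
  a periodic orbit. So the flow in the direction \<open>\<theta>\<close> of \<open>\<tau> i\<close> is periodic, with a period \<open>T\<close> such that
  \<open>T \<theta> = m \<tau> i\<close> for some integer \<open>m > 0\<close>.

  Let \<open>f\<close> be any additive function \<open>\<real>\<^sup>2 \<Rightarrow> \<real>\<close>, possibly discontinuous. Interpolate the values of \<open>f\<close>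
  at the vertices affinely along the edges and extend the result to a Lipschitz function \<open>h\<close>. Then
  \<open>h - f\<close> is invariant under the gluings, and \<open>h\<close> and \<open>f\<close> combine to a Lipschitz cocycle along the
  flow, whose value over a period is \<open>f (m \<tau> i)\<close>. Since the flow preserves area, averaging over the
  polygon shows that \<open>f (\<tau> i)\<close>, times the area, is the derivative of \<open>D u = \<integral> (h (x + u) - h x) dx\<close> at
  \<open>u = 0\<close> in the direction \<open>\<tau> i\<close>. Derivatives of \<open>D\<close> are \<open>\<real>\<close>-linear in the direction, so every
  additive function agrees with an \<open>\<real>\<close>-linear one on the vectors \<open>\<tau> i\<close>. Hence these vectors span a
  two-dimensional space over \<open>\<rat>\<close> and lie in a lattice \<open>\<Lambda>\<close>, and the polygon maps to \<open>\<real>\<^sup>2 / \<Lambda>\<close>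
  compatibly with the gluings. The induced map of the surface is a proper local homeomorphism away
  from the images of the vertices.\<close>

text \<open>A function \<open>f\<close> that detects rational independence is wildly discontinuous
  and cannot be integrated. It enters the averages only through its values on the countable set
  \<open>holonomy\<close>, where every function is measurable: up to a constant vector, the flow
  sampled at multiples of T/N displaces points by elements of this set. What is integrated otherwise
  is \<open>h\<close>, which absorbs \<open>f\<close> on the edges.

  Formally the derivative of \<open>D\<close> at u is the flux of \<open>h\<close> times u through
  the boundary of the polygon, which is linear in u for any \<open>f\<close>. The proof neither
  computes this flux nor shows that it exists. It considers the directions in which \<open>D\<close>
  is o(\<epsilon>) and shows that they form a real subspace, since \<open>D\<close> fails to be
  additive only through a thin layer along the boundary. This suffices: if \<open>f\<close> vanishes
  on two independent vectors among the \<open>\<tau> i\<close>, both are such directions, hence all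
  are, and \<open>f\<close> vanishes on every \<open>\<tau> j\<close>. If some
  \<open>\<tau> j\<close> were outside the rational span of the two, a Hamel basis would provide
  such an \<open>f\<close> with value 1 on it.\<close>

lemma lipschitz_extension_indexed:
  fixes c :: "'i \<Rightarrow> 'a::metric_space" and g :: "'i \<Rightarrow> real"
  assumes lip: "\<And>a b. a \<in> A \<Longrightarrow> b \<in> A \<Longrightarrow> \<bar>g a - g b\<bar> \<le> L * dist (c a) (c b)"
    and "A \<noteq> {}" and "0 \<le> L"
  obtains h where "L-lipschitz_on UNIV h" and "\<And>a. a \<in> A \<Longrightarrow> h (c a) = g a"
proof -
  \<comment> \<open>McShane's formula: the lower envelope of the cones of slope L over the data. The
    Lipschitz hypothesis already forces equal values at indices with equal \<open>c a\<close>, so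
    indexing by \<open>A\<close> spares the data from being a function of position.\<close>
  define h where "h x = (INF a\<in>A. g a + L * dist x (c a))" for x
  have lower: "g b - L * dist x (c b) \<le> g a + L * dist x (c a)" if "a \<in> A" "b \<in> A" for a b x
  proof -
    have "g b - g a \<le> L * dist (c a) (c b)" using lip[OF that] by linarith
    also have "\<dots> \<le> L * (dist x (c a) + dist x (c b))"
      using assms(3) by (intro mult_left_mono dist_triangle3) auto
    finally show ?thesis by (simp add: algebra_simps)
  qed
  have bdd: "bdd_below ((\<lambda>a. g a + L * dist x (c a)) ` A)" for x
    using lower assms(2) by (meson bdd_belowI2 equals0I)
  have le: "h x \<le> h y + L * dist x y" for x y
  proof -
    have "h x - L * dist x y \<le> h y"
      unfolding h_def[of y]
    proof (rule cINF_greatest[OF assms(2)])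
      fix a assume a: "a \<in> A"
      have "h x \<le> g a + L * dist x (c a)"
        unfolding h_def by (rule cINF_lower[OF bdd a])
      also have "\<dots> \<le> g a + L * (dist x y + dist y (c a))"
        using assms(3) by (intro add_left_mono mult_left_mono dist_triangle) auto
      finally show "h x - L * dist x y \<le> g a + L * dist y (c a)" by (simp add: algebra_simps)
    qed
    then show ?thesis by linarith
  qed
  show thesis
  proof
    show "L-lipschitz_on UNIV h"
    proof (rule lipschitz_onI[OF _ assms(3)])
      fix x y show "dist (h x) (h y) \<le> L * dist x y"
        using le[of x y] le[of y x] by (simp add: dist_real_def dist_commute abs_le_iff)
    qed
    fix a assume a: "a \<in> A"
    have "h (c a) \<le> g a"
      unfolding h_def using cINF_lower[OF bdd a, of "c a"] by simp
    moreover have "g a \<le> h (c a)"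
      unfolding h_def by (rule cINF_greatest[OF assms(2)]) (use lower[OF _ a, of _ "c a"] in simp)
    ultimately show "h (c a) = g a" by simp
  qed
qed

text \<open>The summand 1 keeps the divisor in thresholds \<open>r / (norm v + 1)\<close> positive
  when v is zero.\<close>

lemma norm_scaleR_less:
  fixes v :: "'a::real_normed_vector"
  assumes "\<bar>c\<bar> * (norm v + 1) < r" shows "norm (c *\<^sub>R v) < r"
  using assms by (simp add: distrib_left)

section \<open>Straight-line flow on a translation atlas\<close>

locale translation_space =
  fixes M :: "'a tsurf"
  assumes atl: "translation_atlas M" and haus: "Hausdorff_space (surf M)"
begin

lemma regular_chart:
  assumes "y \<in> regular_part M"
  obtains U \<phi> where "(U, \<phi>) \<in> atlas M" "y \<in> U"
  using atl assms unfolding translation_atlas_def by blast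

lemma chart_regular: "(U, \<phi>) \<in> atlas M \<Longrightarrow> y \<in> U \<Longrightarrow> y \<in> regular_part M"
  using atl unfolding translation_atlas_def by blast

lemma chart_openin: "(U, \<phi>) \<in> atlas M \<Longrightarrow> openin (surf M) U"
  using atl unfolding translation_atlas_def by blast

lemma chart_open_image: "(U, \<phi>) \<in> atlas M \<Longrightarrow> open (\<phi> ` U)"
  using atl unfolding translation_atlas_def by blast

lemma chart_homeo:
  "(U, \<phi>) \<in> atlas M \<Longrightarrow> homeomorphic_map (subtopology (surf M) U) (top_of_set (\<phi> ` U)) \<phi>"
  using atl unfolding translation_atlas_def by blast

lemma chart_subset: "(U, \<phi>) \<in> atlas M \<Longrightarrow> U \<subseteq> topspace (surf M)"
  using chart_openin openin_subset by blast

lemma chart_inj: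
  assumes "(U, \<phi>) \<in> atlas M" shows "inj_on \<phi> U"
  using homeomorphic_imp_injective_map[OF chart_homeo[OF assms]] chart_subset[OF assms]
  by (simp add: Int_absorb1)

lemma chart_image_open:
  assumes "(U, \<phi>) \<in> atlas M" "openin (surf M) W" "W \<subseteq> U"
  shows "open (\<phi> ` W)"
proof -
  have "openin (subtopology (surf M) U) W"
    using assms by (simp add: openin_subtopology) blast
  then have "openin (top_of_set (\<phi> ` U)) (\<phi> ` W)"
    using homeomorphic_imp_open_map[OF chart_homeo[OF assms(1)]] by (simp add: open_map_def)
  then show ?thesis
    using chart_open_image[OF assms(1)] openin_open_trans by blast
qed

lemma chart_vimage_openin:
  assumes "(U, \<phi>) \<in> atlas M" "open V"
  shows "openin (surf M) {y \<in> U. \<phi> y \<in> V}"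
proof -
  have "continuous_map (subtopology (surf M) U) (top_of_set (\<phi> ` U)) \<phi>"
    by (rule homeomorphic_imp_continuous_map[OF chart_homeo[OF assms(1)]])
  then have "continuous_map (subtopology (surf M) U) euclidean \<phi>"
    by (simp add: continuous_map_in_subtopology)
  then have "openin (subtopology (surf M) U) {y \<in> topspace (subtopology (surf M) U). \<phi> y \<in> V}"
    using assms(2) by (simp add: continuous_map)
  moreover have "topspace (subtopology (surf M) U) = U"
    using chart_subset[OF assms(1)] by (simp add: Int_absorb1)
  ultimately show ?thesis
    using chart_openin[OF assms(1)] openin_trans_full by fastforce
qed

text \<open>Differences replace the translation vector of the transition map, so that successive
  chart changes compose by rewriting.\<close>

lemma chart_compat:
  assumes "(U, \<phi>) \<in> atlas M" "(V, \<psi>) \<in> atlas M" "x \<in> U" "x \<in> V"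
  obtains W where "openin (surf M) W" "x \<in> W" "W \<subseteq> U \<inter> V" "\<And>y. y \<in> W \<Longrightarrow> \<psi> y - \<psi> x = \<phi> y - \<phi> x"
proof -
  obtain W v where W: "openin (surf M) W" "x \<in> W" "W \<subseteq> U \<inter> V" "\<forall>y \<in> W. \<psi> y = \<phi> y + v"
  proof -
    have "\<forall>(U, \<phi>) \<in> atlas M. \<forall>(V, \<psi>) \<in> atlas M. \<forall>x \<in> U \<inter> V.
        \<exists>W v. openin (surf M) W \<and> x \<in> W \<and> W \<subseteq> U \<inter> V \<and> (\<forall>y \<in> W. \<psi> y = \<phi> y + v)"
      using atl unfolding translation_atlas_def by simp
    from bspec[OF this assms(1)] have "\<forall>(V, \<psi>) \<in> atlas M. \<forall>x \<in> U \<inter> V.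
        \<exists>W v. openin (surf M) W \<and> x \<in> W \<and> W \<subseteq> U \<inter> V \<and> (\<forall>y \<in> W. \<psi> y = \<phi> y + v)" by simp
    from bspec[OF this assms(2)] have "\<forall>x \<in> U \<inter> V.
        \<exists>W v. openin (surf M) W \<and> x \<in> W \<and> W \<subseteq> U \<inter> V \<and> (\<forall>y \<in> W. \<psi> y = \<phi> y + v)" by simp
    from bspec[OF this, of x] show ?thesis using assms(3,4) that by blast
  qed
  then show thesis by (intro that[OF W(1-3)]) (simp add: algebra_simps)
qed

lemma chart_nbhd:
  assumes "(U, \<phi>) \<in> atlas M" "openin (surf M) W" "x \<in> U" "x \<in> W"
  obtains r where "r > 0" "ball (\<phi> x) r \<subseteq> \<phi> ` (W \<inter> U)"
    "\<And>y. y \<in> U \<Longrightarrow> dist (\<phi> y) (\<phi> x) < r \<Longrightarrow> y \<in> W"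
proof -
  have "open (\<phi> ` (W \<inter> U))"
    using assms by (intro chart_image_open[OF assms(1)]) (auto intro: openin_Int chart_openin)
  moreover have "\<phi> x \<in> \<phi> ` (W \<inter> U)" using assms by blast
  ultimately obtain r where r: "r > 0" "ball (\<phi> x) r \<subseteq> \<phi> ` (W \<inter> U)"
    unfolding open_contains_ball by blast
  show thesis
  proof (rule that[OF r])
    fix y assume y: "y \<in> U" "dist (\<phi> y) (\<phi> x) < r"
    then have "\<phi> y \<in> \<phi> ` (W \<inter> U)" using r by (auto simp: dist_commute)
    then show "y \<in> W" using y chart_inj[OF assms(1)] by (auto dest: inj_onD)
  qed
qed

text \<open>\<open>flow_line\<close> asks for straightness in every chart at each time. One chart
  per time suffices, because any other chart differs from it by a translation on a neighbourhood
  that the line does not leave at once.\<close>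

lemma flow_lineI:
  assumes "\<And>t. t \<in> {0..T} \<Longrightarrow> \<exists>(U, \<phi>) \<in> atlas M. \<gamma> t \<in> U \<and> (\<exists>e>0. \<forall>s \<in> {0..T}. \<bar>s - t\<bar> < e \<longrightarrow>
              \<gamma> s \<in> U \<and> \<phi> (\<gamma> s) = \<phi> (\<gamma> t) + (s - t) *\<^sub>R \<theta>)"
  shows "flow_line M \<theta> T \<gamma>"
  unfolding flow_line_def
proof (intro ballI conjI)
  fix t assume t: "t \<in> {0..T}"
  obtain U \<phi> e where U: "(U, \<phi>) \<in> atlas M" "\<gamma> t \<in> U" and e: "e > 0"
     "\<And>s. s \<in> {0..T} \<Longrightarrow> \<bar>s - t\<bar> < e \<Longrightarrow> \<gamma> s \<in> U \<and> \<phi> (\<gamma> s) = \<phi> (\<gamma> t) + (s - t) *\<^sub>R \<theta>"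
    using assms[OF t] by blast
  show "\<gamma> t \<in> regular_part M" using chart_regular[OF U] .
  have "\<exists>e>0. \<forall>s\<in>{0..T}. \<bar>s - t\<bar> < e \<longrightarrow> \<gamma> s \<in> V \<and> \<psi> (\<gamma> s) = \<psi> (\<gamma> t) + (s - t) *\<^sub>R \<theta>"
    if V: "(V, \<psi>) \<in> atlas M" and tV: "\<gamma> t \<in> V" for V \<psi>
  proof -
    obtain W where W: "openin (surf M) W" "\<gamma> t \<in> W" "W \<subseteq> U \<inter> V"
      "\<And>y. y \<in> W \<Longrightarrow> \<psi> y - \<psi> (\<gamma> t) = \<phi> y - \<phi> (\<gamma> t)"
      using chart_compat[OF U(1) V U(2) tV] by blast
    obtain r where r: "r > 0" "\<And>y. y \<in> U \<Longrightarrow> dist (\<phi> y) (\<phi> (\<gamma> t)) < r \<Longrightarrow> y \<in> W"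
      using chart_nbhd[OF U(1) W(1) U(2) W(2)] by metis
    define d where "d = min e (r / (norm \<theta> + 1))"
    have "d > 0" using e r by (simp add: d_def add_nonneg_pos)
    moreover have "\<gamma> s \<in> V \<and> \<psi> (\<gamma> s) = \<psi> (\<gamma> t) + (s - t) *\<^sub>R \<theta>" if s: "s \<in> {0..T}" "\<bar>s - t\<bar> < d"
      for s
    proof -
      have se: "\<gamma> s \<in> U" "\<phi> (\<gamma> s) = \<phi> (\<gamma> t) + (s - t) *\<^sub>R \<theta>" using e(2)[OF s(1)] s(2)
        by (auto simp: d_def)
      have "\<bar>s - t\<bar> * (norm \<theta> + 1) < r"
        using s(2) by (simp add: d_def pos_less_divide_eq add_nonneg_pos)
      then have "dist (\<phi> (\<gamma> s)) (\<phi> (\<gamma> t)) < r"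
        using norm_scaleR_less[of "s - t" \<theta> r] by (simp add: dist_norm se(2))
      then have "\<gamma> s \<in> W" using r se by blast
      then show ?thesis using W(3) W(4)[of "\<gamma> s"] se(2) by (auto simp: algebra_simps)
    qed
    ultimately show "\<exists>e>0. \<forall>s\<in>{0..T}. \<bar>s - t\<bar> < e \<longrightarrow> \<gamma> s \<in> V \<and> \<psi> (\<gamma> s) = \<psi> (\<gamma> t) + (s - t) *\<^sub>R \<theta>"
      by blast
  qed
  then show "case p of (V, \<psi>) \<Rightarrow> \<gamma> t \<in> V \<longrightarrow> (\<exists>e>0. \<forall>s\<in>{0..T}. \<bar>s - t\<bar> < e \<longrightarrow> \<gamma> s \<in> V \<and> \<psi> (\<gamma> s) =
    \<psi> (\<gamma> t) + (s - t) *\<^sub>R \<theta>)"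
    if "p \<in> atlas M" for p
    using that by (cases p) simp
qed

lemma flow_lineD:
  assumes "flow_line M \<theta> T \<gamma>" "t \<in> {0..T}" "(U, \<phi>) \<in> atlas M" "\<gamma> t \<in> U"
  obtains e where "e > 0" "\<And>s. s \<in> {0..T} \<Longrightarrow> \<bar>s - t\<bar> < e \<Longrightarrow> \<gamma> s \<in> U"
     "\<And>s. s \<in> {0..T} \<Longrightarrow> \<bar>s - t\<bar> < e \<Longrightarrow> \<phi> (\<gamma> s) = \<phi> (\<gamma> t) + (s - t) *\<^sub>R \<theta>"
proof -
  have "\<forall>(U, \<phi>) \<in> atlas M. \<gamma> t \<in> U \<longrightarrow>
           (\<exists>e>0. \<forall>s \<in> {0..T}. \<bar>s - t\<bar> < e \<longrightarrow>
              \<gamma> s \<in> U \<and> \<phi> (\<gamma> s) = \<phi> (\<gamma> t) + (s - t) *\<^sub>R \<theta>)"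
    using assms(1,2) unfolding flow_line_def by blast
  from bspec[OF this assms(3)] obtain e where "e > 0" "\<forall>s \<in> {0..T}. \<bar>s - t\<bar> < e \<longrightarrow>
              \<gamma> s \<in> U \<and> \<phi> (\<gamma> s) = \<phi> (\<gamma> t) + (s - t) *\<^sub>R \<theta>" using assms(4) by auto
  then show thesis using that by blast
qed

lemma flow_line_regular: "flow_line M \<theta> T \<gamma> \<Longrightarrow> t \<in> {0..T} \<Longrightarrow> \<gamma> t \<in> regular_part M"
  unfolding flow_line_def by blast

lemma flow_line_cont:
  assumes "flow_line M \<theta> T \<gamma>" "t \<in> {0..T}" "openin (surf M) W" "\<gamma> t \<in> W"
  obtains e where "e > 0" "\<And>s. s \<in> {0..T} \<Longrightarrow> \<bar>s - t\<bar> < e \<Longrightarrow> \<gamma> s \<in> W"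
proof -
  obtain U \<phi> where U: "(U, \<phi>) \<in> atlas M" "\<gamma> t \<in> U"
    using regular_chart flow_line_regular[OF assms(1,2)] by metis
  obtain e where e: "e > 0" "\<And>s. s \<in> {0..T} \<Longrightarrow> \<bar>s - t\<bar> < e \<Longrightarrow> \<gamma> s \<in> U"
     "\<And>s. s \<in> {0..T} \<Longrightarrow> \<bar>s - t\<bar> < e \<Longrightarrow> \<phi> (\<gamma> s) = \<phi> (\<gamma> t) + (s - t) *\<^sub>R \<theta>"
    using flow_lineD[OF assms(1,2) U] by metis
  obtain r where r: "r > 0" "\<And>y. y \<in> U \<Longrightarrow> dist (\<phi> y) (\<phi> (\<gamma> t)) < r \<Longrightarrow> y \<in> W"
    using chart_nbhd[OF U(1) assms(3) U(2) assms(4)] by metis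
  have pos: "norm \<theta> + 1 > 0" by (simp add: add_nonneg_pos)
  show thesis
  proof (rule that)
    show "min e (r / (norm \<theta> + 1)) > 0" using e r pos by simp
    fix s assume s: "s \<in> {0..T}" "\<bar>s - t\<bar> < min e (r / (norm \<theta> + 1))"
    have "\<bar>s - t\<bar> * (norm \<theta> + 1) < r" using s(2) pos by (simp add: pos_less_divide_eq)
    then have "dist (\<phi> (\<gamma> s)) (\<phi> (\<gamma> t)) < r"
      using e(3)[of s] s norm_scaleR_less[of "s - t" \<theta> r] by (simp add: dist_norm)
    then show "\<gamma> s \<in> W" using r(2) e(2)[of s] s by simp
  qed
qed

lemma flow_line_shift:
  assumes "flow_line M \<theta> T \<gamma>" "0 \<le> a" "a \<le> b" "b \<le> T"
  shows "flow_line M \<theta> (b - a) (\<lambda>s. \<gamma> (a + s))"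
proof (rule flow_lineI)
  fix t assume t: "t \<in> {0..b - a}"
  then have at: "a + t \<in> {0..T}" using assms by auto
  then obtain U \<phi> where U: "(U, \<phi>) \<in> atlas M" "\<gamma> (a + t) \<in> U"
    using regular_chart flow_line_regular[OF assms(1)] by metis
  obtain e where e: "e > 0" "\<And>s. s \<in> {0..T} \<Longrightarrow> \<bar>s - (a + t)\<bar> < e \<Longrightarrow> \<gamma> s \<in> U"
     "\<And>s. s \<in> {0..T} \<Longrightarrow> \<bar>s - (a + t)\<bar> < e \<Longrightarrow> \<phi> (\<gamma> s) = \<phi> (\<gamma> (a + t)) + (s - (a + t)) *\<^sub>R \<theta>"
    using flow_lineD[OF assms(1) at U] by metis
  show "\<exists>(U, \<phi>)\<in>atlas M. \<gamma> (a + t) \<in> U \<and> (\<exists>e>0. \<forall>s\<in>{0..b - a}. \<bar>s - t\<bar> < e \<longrightarrow>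
          \<gamma> (a + s) \<in> U \<and> \<phi> (\<gamma> (a + s)) = \<phi> (\<gamma> (a + t)) + (s - t) *\<^sub>R \<theta>)"
  proof (rule bexI[OF _ U(1)], clarify, intro conjI exI[of _ e] ballI impI)
    fix s assume "s \<in> {0..b - a}" "\<bar>s - t\<bar> < e"
    then show "\<gamma> (a + s) \<in> U" "\<phi> (\<gamma> (a + s)) = \<phi> (\<gamma> (a + t)) + (s - t) *\<^sub>R \<theta>"
      using e(2,3)[of "a + s"] assms by auto
  qed (use U e in auto)
qed

lemma flows_segment:
  assumes "flow_line M \<theta> T \<gamma>" "0 \<le> a" "a \<le> b" "b \<le> T"
  shows "flows M \<theta> (b - a) (\<gamma> a) (\<gamma> b)"
  unfolding flows_def using flow_line_shift[OF assms] by (intro exI[of _ "\<lambda>s. \<gamma> (a + s)"]) auto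

lemma flow_line_concat:
  assumes 1: "flow_line M \<theta> S \<alpha>" and 2: "flow_line M \<theta> T \<beta>" and m: "\<alpha> S = \<beta> 0" and "0 \<le> S" "0 \<le> T"
  shows "flow_line M \<theta> (S + T) (\<lambda>t. if t \<le> S then \<alpha> t else \<beta> (t - S))" (is "flow_line _ _ _ ?g")
proof (rule flow_lineI)
  fix t assume t: "t \<in> {0..S + T}"
  consider "t < S" | "t = S" | "t > S" by linarith
  then show "\<exists>(U, \<phi>)\<in>atlas M. ?g t \<in> U \<and> (\<exists>e>0. \<forall>s\<in>{0..S + T}. \<bar>s - t\<bar> < e \<longrightarrow>
          ?g s \<in> U \<and> \<phi> (?g s) = \<phi> (?g t) + (s - t) *\<^sub>R \<theta>)"
  proof cases
    case 1
    then have t': "t \<in> {0..S}" using t by auto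
    then obtain U \<phi> where U: "(U, \<phi>) \<in> atlas M" "\<alpha> t \<in> U"
      using regular_chart flow_line_regular[OF assms(1)] by metis
    obtain e where e: "e > 0" "\<And>s. s \<in> {0..S} \<Longrightarrow> \<bar>s - t\<bar> < e \<Longrightarrow> \<alpha> s \<in> U"
     "\<And>s. s \<in> {0..S} \<Longrightarrow> \<bar>s - t\<bar> < e \<Longrightarrow> \<phi> (\<alpha> s) = \<phi> (\<alpha> t) + (s - t) *\<^sub>R \<theta>"
      using flow_lineD[OF assms(1) t' U] by metis
    show ?thesis
      by (rule bexI[OF _ U(1)], clarify, intro conjI exI[of _ "min e (S - t)"])
        (use U e 1 in auto)
  next
    case 2
    have t': "t \<in> {0..S}" "0 \<in> {0..T}" using 2 t assms by auto
    then obtain U \<phi> where U: "(U, \<phi>) \<in> atlas M" "\<alpha> t \<in> U"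
      using regular_chart flow_line_regular[OF assms(1)] by metis
    have U': "\<beta> 0 \<in> U" using U m 2 by simp
    obtain e where e: "e > 0" "\<And>s. s \<in> {0..S} \<Longrightarrow> \<bar>s - t\<bar> < e \<Longrightarrow> \<alpha> s \<in> U"
     "\<And>s. s \<in> {0..S} \<Longrightarrow> \<bar>s - t\<bar> < e \<Longrightarrow> \<phi> (\<alpha> s) = \<phi> (\<alpha> t) + (s - t) *\<^sub>R \<theta>"
      using flow_lineD[OF assms(1) t'(1) U] by metis
    obtain e' where e': "e' > 0" "\<And>s. s \<in> {0..T} \<Longrightarrow> \<bar>s - 0\<bar> < e' \<Longrightarrow> \<beta> s \<in> U"
     "\<And>s. s \<in> {0..T} \<Longrightarrow> \<bar>s - 0\<bar> < e' \<Longrightarrow> \<phi> (\<beta> s) = \<phi> (\<beta> 0) + (s - 0) *\<^sub>R \<theta>"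
      using flow_lineD[OF assms(2) t'(2) U(1) U'] by metis
    have "?g s \<in> U \<and> \<phi> (?g s) = \<phi> (?g t) + (s - t) *\<^sub>R \<theta>"
      if s: "s \<in> {0..S + T}" "\<bar>s - t\<bar> < min e e'" for s
      using e(2,3)[of s] e'(2,3)[of "s - S"] s 2 m by (cases "s \<le> S") auto
    then show ?thesis
      by (intro bexI[OF _ U(1)], clarify, intro conjI exI[of _ "min e e'"]) (use U e(1) e'(1) 2 in auto)
  next
    case 3
    then have t': "t - S \<in> {0..T}" using t by auto
    then obtain U \<phi> where U: "(U, \<phi>) \<in> atlas M" "\<beta> (t - S) \<in> U"
      using regular_chart flow_line_regular[OF assms(2)] by metis
    obtain e where e: "e > 0" "\<And>s. s \<in> {0..T} \<Longrightarrow> \<bar>s - (t - S)\<bar> < e \<Longrightarrow> \<beta> s \<in> U"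
     "\<And>s. s \<in> {0..T} \<Longrightarrow> \<bar>s - (t - S)\<bar> < e \<Longrightarrow> \<phi> (\<beta> s) = \<phi> (\<beta> (t - S)) + (s - (t - S)) *\<^sub>R \<theta>"
      using flow_lineD[OF assms(2) t' U] by metis
    have "?g s \<in> U \<and> \<phi> (?g s) = \<phi> (?g t) + (s - t) *\<^sub>R \<theta>"
      if s: "s \<in> {0..S + T}" "\<bar>s - t\<bar> < min e (t - S)" for s
      using e(2,3)[of "s - S"] s 3 by auto
    then show ?thesis
      by (intro bexI[OF _ U(1)], clarify, intro conjI exI[of _ "min e (t -
        S)"]) (use U e(1) 3 in auto)
  qed
qed

lemma flows_trans:
  assumes "flows M \<theta> S x y" "flows M \<theta> T y z" "0 \<le> S" "0 \<le> T"
  shows "flows M \<theta> (S + T) x z"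
proof -
  obtain \<alpha> \<beta> where "flow_line M \<theta> S \<alpha>" "\<alpha> 0 = x" "\<alpha> S = y" "flow_line M \<theta> T \<beta>" "\<beta> 0 = y" "\<beta> T = z"
    using assms unfolding flows_def by blast
  then show ?thesis
    unfolding flows_def using flow_line_concat[of \<theta> S \<alpha> T \<beta>] assms
    by (intro exI[of _ "\<lambda>t. if t \<le> S then \<alpha> t else \<beta> (t - S)"]) auto
qed

text \<open>Where two flow lines meet they coincide nearby, both being the same straight line in one
  chart; where they differ they differ nearby, the surface being Hausdorff. So agreement is locally
  constant in time. This gives both determinism and injectivity of the flow.\<close>

lemma flow_line_agree:
  assumes 1: "flow_line M \<theta> T \<alpha>" and 2: "flow_line M \<theta> T \<beta>" and "0 \<le> T"
  shows "\<alpha> 0 = \<beta> 0 \<longleftrightarrow> \<alpha> T = \<beta> T"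
proof -
  define P where "P a b \<longleftrightarrow> (0 \<le> a \<and> b \<le> T \<longrightarrow> (\<alpha> a = \<beta> a \<longleftrightarrow> \<alpha> b = \<beta> b))" for a b
  have "P 0 T"
  proof (rule Bolzano[OF \<open>0 \<le> T\<close>])
    show "P a c" if "P a b" "P b c" "a \<le> b" "b \<le> c" for a b c
      using that unfolding P_def by auto
    fix t assume "0 \<le> t" "t \<le> T"
    then have t: "t \<in> {0..T}" by auto
    have "\<exists>d>0. \<forall>s\<in>{0..T}. \<bar>s - t\<bar> < d \<longrightarrow> (\<alpha> s = \<beta> s \<longleftrightarrow> \<alpha> t = \<beta> t)"
    proof (cases "\<alpha> t = \<beta> t")
      case True
      obtain U \<phi> where U: "(U, \<phi>) \<in> atlas M" "\<alpha> t \<in> U" using regular_chart flow_line_regular[OF 1 t]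
        by metis
      obtain e where e: "e > 0" "\<And>s. s \<in> {0..T} \<Longrightarrow> \<bar>s - t\<bar> < e \<Longrightarrow> \<alpha> s \<in> U"
         "\<And>s. s \<in> {0..T} \<Longrightarrow> \<bar>s - t\<bar> < e \<Longrightarrow> \<phi> (\<alpha> s) = \<phi> (\<alpha> t) + (s - t) *\<^sub>R \<theta>"
        using flow_lineD[OF 1 t U] by metis
      have U': "\<beta> t \<in> U" using U True by simp
      obtain e' where e': "e' > 0" "\<And>s. s \<in> {0..T} \<Longrightarrow> \<bar>s - t\<bar> < e' \<Longrightarrow> \<beta> s \<in> U"
         "\<And>s. s \<in> {0..T} \<Longrightarrow> \<bar>s - t\<bar> < e' \<Longrightarrow> \<phi> (\<beta> s) = \<phi> (\<beta> t) + (s - t) *\<^sub>R \<theta>"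
        using flow_lineD[OF 2 t U(1) U'] by metis
      have "\<alpha> s = \<beta> s" if s: "s \<in> {0..T}" "\<bar>s - t\<bar> < min e e'" for s
        using e(2,3)[of s] e'(2,3)[of s] s True inj_onD[OF chart_inj[OF U(1)], of "\<alpha> s" "\<beta> s"]
          by simp
      then show ?thesis using e e' True by (intro exI[of _ "min e e'"]) auto
    next
      case False
      have "\<alpha> t \<in> topspace (surf M)" "\<beta> t \<in> topspace (surf M)"
        using flow_line_regular[OF 1 t] flow_line_regular[OF 2 t] by (auto simp: regular_part_def)
      then obtain A B
        where AB: "openin (surf M) A" "openin (surf M) B" "\<alpha> t \<in> A" "\<beta> t \<in> B" "disjnt A B"
        using haus False unfolding Hausdorff_space_def by metis
      obtain e where e: "e > 0" "\<And>s. s \<in> {0..T} \<Longrightarrow> \<bar>s - t\<bar> < e \<Longrightarrow> \<alpha> s \<in> A"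
        using flow_line_cont[OF 1 t AB(1,3)] by metis
      obtain e' where e': "e' > 0" "\<And>s. s \<in> {0..T} \<Longrightarrow> \<bar>s - t\<bar> < e' \<Longrightarrow> \<beta> s \<in> B"
        using flow_line_cont[OF 2 t AB(2,4)] by metis
      have "\<alpha> s \<noteq> \<beta> s" if s: "s \<in> {0..T}" "\<bar>s - t\<bar> < min e e'" for s
        using e(2)[of s] e'(2)[of s] s AB(5) by (auto simp: disjnt_iff)
      then show ?thesis using e e' False by (intro exI[of _ "min e e'"]) auto
    qed
    then obtain d where d: "d > 0" "\<And>s. s \<in> {0..T} \<Longrightarrow> \<bar>s - t\<bar> < d \<Longrightarrow> (\<alpha> s = \<beta> s \<longleftrightarrow> \<alpha> t = \<beta> t)" by blast
    show "\<exists>d>0. \<forall>a b. a \<le> t \<and> t \<le> b \<and> b - a < d \<longrightarrow> P a b"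
    proof (intro exI[of _ d] conjI d(1) allI impI)
      fix a b assume "a \<le> t \<and> t \<le> b \<and> b - a < d"
      then show "P a b" unfolding P_def using d(2)[of a] d(2)[of b] by auto
    qed
  qed
  then show ?thesis using assms(3) unfolding P_def by auto
qed

lemma flows_functional: "flows M \<theta> T x y \<Longrightarrow> flows M \<theta> T x z \<Longrightarrow> 0 \<le> T \<Longrightarrow> y = z"
  unfolding flows_def using flow_line_agree by metis

lemma flows_injective: "flows M \<theta> T x z \<Longrightarrow> flows M \<theta> T y z \<Longrightarrow> 0 \<le> T \<Longrightarrow> x = y"
  unfolding flows_def using flow_line_agree by metis

lemma flows_chart_segment:
  assumes U: "(U, \<phi>) \<in> atlas M" and x: "x \<in> U" and seg: "\<And>s. s \<in> {0..T} \<Longrightarrow> \<phi> x + s *\<^sub>R \<theta> \<in> \<phi> ` U"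
    and "0 \<le> T"
  shows "\<exists>y\<in>U. flows M \<theta> T x y \<and> \<phi> y = \<phi> x + T *\<^sub>R \<theta>"
proof -
  define \<gamma> where "\<gamma> s = inv_into U \<phi> (\<phi> x + s *\<^sub>R \<theta>)" for s
  have g: "\<gamma> s \<in> U" "\<phi> (\<gamma> s) = \<phi> x + s *\<^sub>R \<theta>" if "s \<in> {0..T}" for s
    using seg[OF that] unfolding \<gamma>_def by (auto intro: inv_into_into f_inv_into_f)
  have "flow_line M \<theta> T \<gamma>"
  proof (rule flow_lineI)
    fix t assume t: "t \<in> {0..T}"
    have "\<forall>s\<in>{0..T}. \<bar>s - t\<bar> < 1 \<longrightarrow> \<gamma> s \<in> U \<and> \<phi> (\<gamma> s) = \<phi> (\<gamma> t) + (s - t) *\<^sub>R \<theta>"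
      using g t by (auto simp: algebra_simps)
    then show "\<exists>(U, \<phi>)\<in>atlas M. \<gamma> t \<in> U \<and> (\<exists>e>0. \<forall>s\<in>{0..T}. \<bar>s - t\<bar> < e \<longrightarrow> \<gamma> s \<in> U \<and> \<phi> (\<gamma> s) =
      \<phi> (\<gamma> t) + (s - t) *\<^sub>R \<theta>)"
      using g[OF t] by (intro bexI[OF _ U]) (auto intro!: exI[of _ 1])
  qed
  moreover have "\<gamma> 0 = x" unfolding \<gamma>_def using x chart_inj[OF U] by simp
  ultimately show ?thesis using g[of T] \<open>0 \<le> T\<close> unfolding flows_def by auto
qed

text \<open>Trajectories near a given one stay parallel to it: within one chart the flow is a
  translation, and finitely many such pieces cover the time interval.\<close>

lemma flow_box:
  assumes fl: "flow_line M \<theta> T \<gamma>" and "0 \<le> T"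
    and U: "(U, \<phi>) \<in> atlas M" "\<gamma> 0 \<in> U" and V: "(V, \<psi>) \<in> atlas M" "\<gamma> T \<in> V"
  obtains \<delta> where "\<delta> > 0" "\<And>z. z \<in> U \<Longrightarrow> dist (\<phi> z) (\<phi> (\<gamma> 0)) < \<delta> \<Longrightarrow>
     \<exists>z'\<in>V. flows M \<theta> T z z' \<and> \<psi> z' - \<psi> (\<gamma> T) = \<phi> z - \<phi> (\<gamma> 0)"
proof -
  define box where "box a b U \<phi> V \<psi> \<longleftrightarrow> (\<exists>\<delta>>0. \<forall>z\<in>U. dist (\<phi> z) (\<phi> (\<gamma> a)) < \<delta> \<longrightarrow>
    (\<exists>z'\<in>V. flows M \<theta> (b - a) z z' \<and> \<psi> z' - \<psi> (\<gamma> b) = \<phi> z - \<phi> (\<gamma> a)))"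
    for a b U V and \<phi> \<psi> :: "'a \<Rightarrow> real^2"
  define P where "P a b \<longleftrightarrow> (0 \<le> a \<and> a \<le> b \<and> b \<le> T \<longrightarrow> (\<forall>(U,\<phi>)\<in>atlas M. \<forall>(V,\<psi>)\<in>atlas M.
    \<gamma> a \<in> U \<longrightarrow> \<gamma> b \<in> V \<longrightarrow> box a b U \<phi> V \<psi>))" for a b
  have "P 0 T"
  proof (rule Bolzano[OF \<open>0 \<le> T\<close>])
    fix a b c assume ab: "P a b" and bc: "P b c" and le: "a \<le> b" "b \<le> c"
    show "P a c" unfolding P_def
    proof (clarify)
      fix U \<phi> V \<psi> assume H: "0 \<le> a" "a \<le> c" "c \<le> T" and U: "(U,\<phi>) \<in> atlas M" "\<gamma> a \<in> U"
        and V: "(V,\<psi>) \<in> atlas M" "\<gamma> c \<in> V"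
      have "b \<in> {0..T}" using H le by auto
      then obtain C \<kappa> where C: "(C,\<kappa>) \<in> atlas M" "\<gamma> b \<in> C"
        using regular_chart flow_line_regular[OF fl] by metis
      have "box a b U \<phi> C \<kappa>" using ab H le U C unfolding P_def by fastforce
      then obtain d where d: "d > 0" "\<And>z. z\<in>U \<Longrightarrow> dist (\<phi> z) (\<phi> (\<gamma> a)) < d \<Longrightarrow>
         (\<exists>z'\<in>C. flows M \<theta> (b - a) z z' \<and> \<kappa> z' - \<kappa> (\<gamma> b) = \<phi> z - \<phi> (\<gamma> a))" unfolding box_def by blast
      have "box b c C \<kappa> V \<psi>" using bc H le V C unfolding P_def by fastforce
      then obtain d' where d': "d' > 0" "\<And>z. z\<in>C \<Longrightarrow> dist (\<kappa> z) (\<kappa> (\<gamma> b)) < d' \<Longrightarrow>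
         (\<exists>z'\<in>V. flows M \<theta> (c - b) z z' \<and> \<psi> z' - \<psi> (\<gamma> c) = \<kappa> z - \<kappa> (\<gamma> b))" unfolding box_def by blast
      have "\<exists>z''\<in>V. flows M \<theta> (c - a) z z'' \<and> \<psi> z'' - \<psi> (\<gamma> c) = \<phi> z - \<phi> (\<gamma> a)"
        if z: "z \<in> U" "dist (\<phi> z) (\<phi> (\<gamma> a)) < min d d'" for z
      proof -
        obtain z' where z': "z' \<in> C" "flows M \<theta> (b - a) z z'" "\<kappa> z' - \<kappa> (\<gamma> b) = \<phi> z - \<phi> (\<gamma> a)"
          using d(2)[of z] z by auto
        moreover have "dist (\<kappa> z') (\<kappa> (\<gamma> b)) < d'" using z z'(3) by (simp add: dist_norm)
        ultimately obtain z''
          where z'': "z'' \<in> V" "flows M \<theta> (c - b) z' z''" "\<psi> z'' - \<psi> (\<gamma> c) = \<kappa> z' - \<kappa> (\<gamma> b)"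
          using d'(2)[of z'] by auto
        have "flows M \<theta> (c - a) z z''" using flows_trans[OF z'(2) z''(2)] le by simp
        then show ?thesis using z' z'' by auto
      qed
      then show "box a c U \<phi> V \<psi>" unfolding box_def using d d' by (intro exI[of _ "min d d'"]) auto
    qed
  next
    fix t assume "0 \<le> t" "t \<le> T"
    then have t: "t \<in> {0..T}" by auto
    obtain C \<kappa> where C: "(C,\<kappa>) \<in> atlas M" "\<gamma> t \<in> C" using regular_chart flow_line_regular[OF fl t]
      by metis
    obtain e where e: "e > 0" "\<And>s. s \<in> {0..T} \<Longrightarrow> \<bar>s - t\<bar> < e \<Longrightarrow> \<gamma> s \<in> C"
       "\<And>s. s \<in> {0..T} \<Longrightarrow> \<bar>s - t\<bar> < e \<Longrightarrow> \<kappa> (\<gamma> s) = \<kappa> (\<gamma> t) + (s - t) *\<^sub>R \<theta>"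
      using flow_lineD[OF fl t C] by metis
    obtain r where r: "r > 0" "ball (\<kappa> (\<gamma> t)) r \<subseteq> \<kappa> ` C"
      using chart_open_image[OF C(1)] C(2) unfolding open_contains_ball by blast
    have pos: "norm \<theta> + 1 > 0" by (simp add: add_nonneg_pos)
    \<comment> \<open>Half of the radius r is kept for the displacement of the starting point, the
      other half for the motion along \<theta>.\<close>
    define d where "d = min e (r / (2 * (norm \<theta> + 1)))"
    show "\<exists>d>0. \<forall>a b. a \<le> t \<and> t \<le> b \<and> b - a < d \<longrightarrow> P a b"
    proof (intro exI[of _ d] conjI allI impI)
      show "d > 0" using e r pos by (simp add: d_def)
      fix a b assume ab: "a \<le> t \<and> t \<le> b \<and> b - a < d"
      show "P a b" unfolding P_def
      proof clarify
        fix U \<phi> V \<psi> assume H: "0 \<le> a" "a \<le> b" "b \<le> T" and U: "(U,\<phi>) \<in> atlas M" "\<gamma> a \<in> U"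
          and V: "(V,\<psi>) \<in> atlas M" "\<gamma> b \<in> V"
        have in_C: "\<gamma> a \<in> C" "\<gamma> b \<in> C" using e(2)[of a] e(2)[of b] ab H by (auto simp: d_def)
        obtain W where W: "openin (surf M) W" "\<gamma> a \<in> W" "W \<subseteq> U \<inter> C"
          "\<And>y. y \<in> W \<Longrightarrow> \<kappa> y - \<kappa> (\<gamma> a) = \<phi> y - \<phi> (\<gamma> a)"
          using chart_compat[OF U(1) C(1) U(2) in_C(1)] by blast
        obtain W' where W': "openin (surf M) W'" "\<gamma> b \<in> W'" "W' \<subseteq> C \<inter> V"
          "\<And>y. y \<in> W' \<Longrightarrow> \<psi> y - \<psi> (\<gamma> b) = \<kappa> y - \<kappa> (\<gamma> b)"
          using chart_compat[OF C(1) V(1) in_C(2) V(2)] by blast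
        obtain \<rho> where \<rho>: "\<rho> > 0" "\<And>y. y \<in> U \<Longrightarrow> dist (\<phi> y) (\<phi> (\<gamma> a)) < \<rho> \<Longrightarrow> y \<in> W"
          using chart_nbhd[OF U(1) W(1) U(2) W(2)] by metis
        obtain \<rho>' where \<rho>': "\<rho>' > 0" "\<And>y. y \<in> C \<Longrightarrow> dist (\<kappa> y) (\<kappa> (\<gamma> b)) < \<rho>' \<Longrightarrow> y \<in> W'"
          using chart_nbhd[OF C(1) W'(1) in_C(2) W'(2)] by metis
        have "\<exists>z'\<in>V. flows M \<theta> (b - a) z z' \<and> \<psi> z' - \<psi> (\<gamma> b) = \<phi> z - \<phi> (\<gamma> a)"
          if z: "z \<in> U" "dist (\<phi> z) (\<phi> (\<gamma> a)) < min (r/2) (min \<rho> \<rho>')" for z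
        proof -
          have zW: "z \<in> W" using \<rho>(2) z by auto
          have zC: "z \<in> C" and zd: "\<kappa> z - \<kappa> (\<gamma> a) = \<phi> z - \<phi> (\<gamma> a)" using W(3) W(4)[OF zW] zW by auto
          have seg: "\<kappa> z + s *\<^sub>R \<theta> \<in> \<kappa> ` C" if s: "s \<in> {0..b-a}" for s
          proof -
            have as: "\<kappa> (\<gamma> a) = \<kappa> (\<gamma> t) + (a - t) *\<^sub>R \<theta>" using e(3)[of a] ab H by (auto simp: d_def)
            have "\<bar>a + s - t\<bar> < r / (2 * (norm \<theta> + 1))" using s ab by (auto simp: d_def)
            then have "\<bar>a + s - t\<bar> * (norm \<theta> + 1) < r / 2" using pos by (simp add: field_simps)
            then have "norm ((a + s - t) *\<^sub>R \<theta>) < r/2" by (rule norm_scaleR_less)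
            moreover have "norm (\<kappa> z - \<kappa> (\<gamma> a)) < r/2" using z(2) zd by (simp add: dist_norm)
            moreover have "\<kappa> z + s *\<^sub>R \<theta> - \<kappa> (\<gamma> t) = (\<kappa> z - \<kappa> (\<gamma> a)) + (a + s - t) *\<^sub>R \<theta>"
              using as by (simp add: algebra_simps)
            ultimately have "norm (\<kappa> z + s *\<^sub>R \<theta> - \<kappa> (\<gamma> t)) < r"
              by (metis add_strict_mono field_sum_of_halves norm_triangle_lt)
            then show ?thesis using r(2) by (auto simp: dist_norm norm_minus_commute)
          qed
          obtain z' where z': "z' \<in> C" "flows M \<theta> (b - a) z z'" "\<kappa> z' = \<kappa> z + (b - a) *\<^sub>R \<theta>"
            using flows_chart_segment[OF C(1) zC, of "b - a" \<theta>] seg H(2) by auto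
          have "\<kappa> (\<gamma> b) = \<kappa> (\<gamma> a) + (b - a) *\<^sub>R \<theta>"
          proof -
            have "\<kappa> (\<gamma> a) = \<kappa> (\<gamma> t) + (a - t) *\<^sub>R \<theta>" "\<kappa> (\<gamma> b) = \<kappa> (\<gamma> t) + (b - t) *\<^sub>R \<theta>"
              using e(3)[of a] e(3)[of b] ab H by (auto simp: d_def)
            then show ?thesis by (simp add: scaleR_left_diff_distrib)
          qed
          then have z'd: "\<kappa> z' - \<kappa> (\<gamma> b) = \<phi> z - \<phi> (\<gamma> a)" using z'(3) zd by simp
          then have "z' \<in> W'" using \<rho>'(2)[OF z'(1)] z(2) by (simp add: dist_norm)
          then show ?thesis using W'(3,4) z' z'd by auto
        qed
        then show "box a b U \<phi> V \<psi>"
          unfolding box_def using r \<rho> \<rho>' by (intro exI[of _ "min (r/2) (min \<rho> \<rho>')"]) auto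
      qed
    qed
  qed
  then have "box 0 T U \<phi> V \<psi>" using assms(2) U V unfolding P_def by fastforce
  then show thesis using that unfolding box_def by auto
qed

end

section \<open>Convex patterns\<close>

locale convex_pattern = translation_space M for M :: "'a tsurf" +
  fixes vs :: "(real^2) list" and \<sigma> :: "nat \<Rightarrow> nat" and q :: "real^2 \<Rightarrow> 'a"
  assumes polygon: "is_polygon vs" and pairing: "edge_pairing vs \<sigma>"
    and quot: "quotient_map (top_of_set (polygon_region vs)) (surf M) q"
    and fibre: "\<And>x y. x \<in> polygon_region vs \<Longrightarrow> y \<in> polygon_region vs \<Longrightarrow>
           q x = q y \<longleftrightarrow> equivclp (glued vs \<sigma>) x y"
    and sing_vertices: "sing M \<subseteq> q ` set vs"
    and chart_local: "\<And>p U \<phi>. p \<in> polygon_region vs \<Longrightarrow> (U, \<phi>) \<in> atlas M \<Longrightarrow> q p \<in> U \<Longrightarrow>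
           \<exists>e>0. \<forall>z \<in> polygon_region vs \<inter> ball p e. q z \<in> U \<and> \<phi> (q z) = \<phi> (q p) + (z - p)"
    and convex_region: "convex (polygon_region vs)"
begin

abbreviation "n \<equiv> length vs"
abbreviation "v \<equiv> vertex vs"
abbreviation "R \<equiv> polygon_region vs"
abbreviation "E \<equiv> polygon_boundary vs"
abbreviation "I \<equiv> inside E"
abbreviation "\<tau> i \<equiv> v (Suc (\<sigma> i)) - v i"

lemma n_ge_3: "3 \<le> n" and distinct_vs: "distinct vs"
  using polygon by (auto simp: is_polygon_def)

lemma n_pos: "0 < n"
  using n_ge_3 by (simp del: length_greater_0_conv)

lemma vertex_in: "v i \<in> set vs"
  using n_ge_3 unfolding vertex_def by (intro nth_mem mod_less_divisor) auto

lemma set_vs: "set vs = v ` {..<n}"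
  by (auto simp: set_conv_nth vertex_def)

lemma vertex_eq_iff: "v i = v j \<longleftrightarrow> i mod n = j mod n"
proof -
  have "i mod n < n" "j mod n < n" using n_ge_3 by (auto intro: mod_less_divisor)
  then show ?thesis using distinct_vs unfolding vertex_def by (simp add: nth_eq_iff_index_eq)
qed

lemma edge_inter: "i < n \<Longrightarrow> j < n \<Longrightarrow> i \<noteq> j \<Longrightarrow>
    edge vs i \<inter> edge vs j = {v i, v (Suc i)} \<inter> {v j, v (Suc j)}"
  using polygon unfolding is_polygon_def by blast

lemma sigma: "i < n \<Longrightarrow> \<sigma> i < n" "i < n \<Longrightarrow> \<sigma> i \<noteq> i" "i < n \<Longrightarrow> \<sigma> (\<sigma> i) = i"
    "i < n \<Longrightarrow> v (Suc (\<sigma> i)) - v (\<sigma> i) = - (v (Suc i) - v i)"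
  using pairing unfolding edge_pairing_def by blast+

lemma edge_subset_region: "i < n \<Longrightarrow> edge vs i \<subseteq> R"
  unfolding polygon_region_def polygon_boundary_def by blast

lemma closed_boundary: "compact E"
  unfolding polygon_boundary_def edge_def by (intro compact_UN) auto

lemma inside_subset: "I \<subseteq> R"
  unfolding polygon_region_def by auto

lemma inside_boundary_disjoint: "I \<inter> E = {}"
  using inside_no_overlap[of E] by blast

lemma open_inside_boundary: "open I"
  by (intro open_inside compact_imp_closed closed_boundary)

lemma compact_region: "compact R"
proof -
  have "bounded I" using closed_boundary compact_imp_bounded bounded_inside by blast
  then have "bounded R" unfolding polygon_region_def using closed_boundary compact_imp_bounded
    by auto
  moreover have "R = - outside E" unfolding polygon_region_def
    using union_with_inside by blast
  ultimately show ?thesis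
    using open_outside[OF compact_imp_closed[OF closed_boundary]]
    by (simp add: compact_eq_bounded_closed closed_Compl)
qed

lemma edge_eq: "edge vs i = (\<lambda>s. v i + s *\<^sub>R (v (Suc i) - v i)) ` {0..1}"
  unfolding edge_def closed_segment_def by (auto simp: algebra_simps image_iff)

lemma edge_translate:
  assumes "i < n" "x \<in> edge vs i" shows "x + \<tau> i \<in> edge vs (\<sigma> i)"
proof -
  obtain s where s: "s \<in> {0..1}" "x = v i + s *\<^sub>R (v (Suc i) - v i)" using assms edge_eq by auto
  have *: "v (Suc i) = v i + v (\<sigma> i) - v (Suc (\<sigma> i))" using sigma(4)[OF assms(1)]
    by (simp add: algebra_simps)
  \<comment> \<open>The pairing reverses orientation, so parameter s becomes parameter 1 - s on the
    partner edge.\<close>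
  have "x + \<tau> i = v (\<sigma> i) + (1 - s) *\<^sub>R (v (Suc (\<sigma> i)) - v (\<sigma> i))"
    unfolding s(2) * by (simp add: algebra_simps)
  then show ?thesis using s(1) by (auto simp: edge_eq)
qed

lemma tau_sigma: "i < n \<Longrightarrow> \<tau> (\<sigma> i) = - \<tau> i"
  using sigma(3)[of i] sigma(4)[of i] by (simp add: algebra_simps)

lemma gluedE:
  assumes "glued vs \<sigma> x y"
  obtains i where "i < n" "x \<in> edge vs i" "y = x + \<tau> i"
  using assms unfolding glued_def by blast

lemma glued_sym: assumes "glued vs \<sigma> x y" shows "glued vs \<sigma> y x"
proof -
  obtain i where i: "i < n" "x \<in> edge vs i" "y = x + \<tau> i" using assms by (rule gluedE)
  have "x = y + \<tau> (\<sigma> i)" using i by (simp add: tau_sigma)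
  moreover have "y \<in> edge vs (\<sigma> i)" using edge_translate[OF i(1,2)] i(3) by simp
  ultimately show ?thesis unfolding glued_def using sigma(1)[OF i(1)]
    by (intro exI[of _ "\<sigma> i"]) simp
qed

lemma glued_region: "glued vs \<sigma> x y \<Longrightarrow> x \<in> R \<and> y \<in> R"
proof -
  have "a \<in> R" if "glued vs \<sigma> a b" for a b
    using that edge_subset_region by (auto elim!: gluedE)
  then show "glued vs \<sigma> x y \<Longrightarrow> x \<in> R \<and> y \<in> R" using glued_sym by metis
qed

lemma q_glued: "i < n \<Longrightarrow> x \<in> edge vs i \<Longrightarrow> q (x + \<tau> i) = q x"
proof -
  assume "i < n" "x \<in> edge vs i"
  then have g: "glued vs \<sigma> x (x + \<tau> i)" unfolding glued_def by blast
  then have "q x = q (x + \<tau> i)" using fibre[of x "x + \<tau> i"] glued_region[OF g]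
    by (simp add: r_into_equivclp)
  then show ?thesis by simp
qed

text \<open>\<open>glued\<close> is symmetric, because the partner edge glues back by the opposite
  translation. So forward steps alone exhaust the equivalence closure.\<close>

lemma fibre_induct [consumes 3, case_names refl step]:
  assumes "x \<in> R" "y \<in> R" "q x = q y"
    and "P x"
    and "\<And>y i. P y \<Longrightarrow> i < n \<Longrightarrow> y \<in> edge vs i \<Longrightarrow> q y = q x \<Longrightarrow> P (y + \<tau> i)"
  shows "P y"
proof -
  have "equivclp (glued vs \<sigma>) x y" using assms fibre by blast
  then have "P y \<and> q y = q x"
  proof (induction rule: equivclp_induct)
    case base then show ?case using assms(4) by simp
  next
    case (step y z)
    then have "glued vs \<sigma> y z" using glued_sym by blast
    then obtain i where "i < n" "y \<in> edge vs i" "z = y + \<tau> i" by (rule gluedE)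
    then show ?case using step assms(5) q_glued by auto
  qed
  then show ?thesis by simp
qed

lemma q_onto: "q ` R = topspace (surf M)"
  using quotient_imp_surjective_map[OF quot] by simp

lemma q_topspace: "x \<in> R \<Longrightarrow> q x \<in> topspace (surf M)"
  using q_onto by blast

lemma q_continuous: "continuous_map (top_of_set R) (surf M) q"
  using quot quotient_imp_continuous_map by blast

text \<open>A gluing step starts on the boundary, so none leaves an inside point.\<close>

lemma fibre_inside:
  assumes "x \<in> R" "y \<in> R" "q x = q y" "x \<notin> E" shows "y = x"
proof -
  have "y = x \<and> y \<notin> E"
    using assms(1-3)
  proof (induction rule: fibre_induct)
    case refl then show ?case using assms by simp
  next
    case (step y i) then show ?case unfolding polygon_boundary_def by blast
  qed
  then show ?thesis by simp
qed

lemma vertex_edge: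
  assumes "i < n" "x \<in> edge vs i" "x \<in> set vs" shows "x = v i \<or> x = v (Suc i)"
proof -
  obtain j where j: "j < n" "x = v j" using assms set_vs by auto
  show ?thesis
  proof (cases "i = j")
    case False
    have "x \<in> edge vs j" unfolding j edge_def by simp
    then show ?thesis using edge_inter[OF assms(1) j(1) False] assms(2) by blast
  qed (use j in auto)
qed

lemma fibre_vertex:
  assumes "x \<in> R" "y \<in> R" "q x = q y" "x \<in> set vs" shows "y \<in> set vs"
  using assms(1-3)
proof (induction rule: fibre_induct)
  case refl then show ?case using assms by simp
next
  case (step y i)
  then have "y = v i \<or> y = v (Suc i)" using vertex_edge by blast
  moreover have "v (Suc i) + \<tau> i = v (\<sigma> i)" using sigma(4)[OF step(2)] by (simp add: algebra_simps)
  ultimately show ?case using vertex_in by auto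
qed

lemma vertices_region: "set vs \<subseteq> R"
  unfolding set_vs using edge_subset_region by (auto simp: edge_def)

lemma nonvertex_regular:
  assumes "x \<in> R" "x \<notin> set vs" shows "q x \<in> regular_part M"
proof -
  have "q x \<notin> sing M"
  proof
    assume "q x \<in> sing M"
    then obtain w where w: "w \<in> set vs" "q x = q w" using sing_vertices by blast
    then show False using fibre_vertex[of w x] vertices_region assms by auto
  qed
  then show ?thesis using q_topspace[OF assms(1)] by (simp add: regular_part_def)
qed

text \<open>Away from the vertices a point lies on a single edge, and the partner edge glues back by
  the opposite translation, so the gluings alternate between two points.\<close>

lemma fibre_edge:
  assumes "i < n" "x \<in> edge vs i" "x \<notin> set vs" "y \<in> R" "q x = q y"
  shows "y = x \<or> y = x + \<tau> i"
proof -
  have xR: "x \<in> R" using assms edge_subset_region by blast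
  have one: "j = k" if "z \<notin> set vs" "j < n" "k < n" "z \<in> edge vs j" "z \<in> edge vs k" for z j k
  proof (rule ccontr)
    assume "j \<noteq> k"
    then have "z \<in> {v j, v (Suc j)}" using edge_inter[of j k] that by blast
    then show False using that(1) vertex_in by auto
  qed
  have "y = x \<or> y = x + \<tau> i"
    using xR assms(4,5)
  proof (induction rule: fibre_induct)
    case refl then show ?case by simp
  next
    case (step y j)
    have nv: "y \<notin> set vs" using fibre_vertex[of y x] step assms xR edge_subset_region by blast
    from step(1) show ?case
    proof
      assume "y = x" then show ?thesis using one[of y i j] step assms nv by blast
    next
      assume y: "y = x + \<tau> i"
      have "y \<in> edge vs (\<sigma> i)" using edge_translate assms y by simp
      then have "j = \<sigma> i" using one[of y j "\<sigma> i"] step nv sigma(1)[OF assms(1)] by blast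
      then show ?thesis using tau_sigma[OF assms(1)] y by simp
    qed
  qed
  then show ?thesis .
qed

text \<open>By compactness, the sectors of the polygon at the points over \<open>y\<close> fill a neighbourhood of \<open>y\<close>.\<close>

lemma regular_local_lift:
  assumes U: "(U, \<phi>) \<in> atlas M" and y: "y \<in> U"
  obtains W where "openin (surf M) W" "y \<in> W" "W \<subseteq> U"
    "\<And>z. z \<in> W \<Longrightarrow> \<exists>p\<in>R. \<exists>p'\<in>R. q p = y \<and> q p' = z \<and> p' - p = \<phi> z - \<phi> y"
proof -
  define F where "F = {p \<in> R. q p = y}"
  have "\<forall>p\<in>F. \<exists>e>0. \<forall>z \<in> R \<inter> ball p e. q z \<in> U \<and> \<phi> (q z) = \<phi> (q p) + (z - p)"
    using chart_local[OF _ U] y unfolding F_def by blast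
  then obtain e
    where "\<forall>p\<in>F. e p > 0 \<and> (\<forall>z \<in> R \<inter> ball p (e p). q z \<in> U \<and> \<phi> (q z) = \<phi> (q p) + (z - p))"
    using bchoice[of F "\<lambda>p e. e > 0 \<and> (\<forall>z \<in> R \<inter> ball p e. q z \<in> U \<and> \<phi> (q z) = \<phi> (q p) + (z - p))"]
      by auto
  then have e: "\<And>p. p \<in> F \<Longrightarrow> e p > 0"
      "\<And>p z. p \<in> F \<Longrightarrow> z \<in> R \<inter> ball p (e p) \<Longrightarrow> q z \<in> U \<and> \<phi> (q z) = \<phi> (q p) + (z - p)"
    by auto
  define N where "N = (\<Union>p\<in>F. ball p (e p))"
  \<comment> \<open>The part of the region away from the fibre has a compact, hence closed, image. A
    point outside this image has all its preimages near the fibre.\<close>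
  have "compact (R - N)" unfolding N_def by (intro compact_diff compact_region open_UN) auto
  then have "compactin (top_of_set R) (R - N)" by (simp add: compactin_subtopology Diff_subset)
  then have "compactin (surf M) (q ` (R - N))" by (rule image_compactin[OF _ q_continuous])
  then have "closedin (surf M) (q ` (R - N))" using haus compactin_imp_closedin by blast
  then have op: "openin (surf M) (U - q ` (R - N))" using chart_openin[OF U]
    by (simp add: openin_diff)
  show thesis
  proof (rule that[OF op])
    have "p \<in> N" if "p \<in> R" "q p = y" for p
      using e(1)[of p] that unfolding N_def F_def by (intro UN_I[of p]) auto
    then show "y \<in> U - q ` (R - N)" using y by blast
    fix z assume z: "z \<in> U - q ` (R - N)"
    then have "z \<in> q ` R" using q_onto chart_subset[OF U] by auto
    then obtain p' where p': "p' \<in> R" "q p' = z" by auto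
    have "p' \<in> N" using z p' by auto
    then obtain p where p: "p \<in> F" "p' \<in> ball p (e p)" unfolding N_def by auto
    have "\<phi> z = \<phi> y + (p' - p)" using e(2)[of p p'] p p' unfolding F_def by auto
    then show "\<exists>p\<in>R. \<exists>p'\<in>R. q p = y \<and> q p' = z \<and> p' - p = \<phi> z - \<phi> y"
      using p(1) p' unfolding F_def by (intro bexI[of _ p] bexI[of _ p']) auto
  qed auto
qed

text \<open>This stands for the fact that the angles at the points of a regular fibre make up a full
  turn: every short vector issues from one of these points into the region.\<close>

lemma fills_ball:
  assumes "x \<in> R" "q x \<in> regular_part M"
  obtains r where "r > 0" "\<And>w. norm w < r \<Longrightarrow> \<exists>p\<in>R. q p = q x \<and> p + w \<in> R"
proof -
  obtain U \<phi> where U: "(U, \<phi>) \<in> atlas M" "q x \<in> U" using regular_chart assms(2) by metis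
  obtain W where W: "openin (surf M) W" "q x \<in> W" "W \<subseteq> U"
    "\<And>z. z \<in> W \<Longrightarrow> \<exists>p\<in>R. \<exists>p'\<in>R. q p = q x \<and> q p' = z \<and> p' - p = \<phi> z - \<phi> (q x)"
    using regular_local_lift[OF U] by blast
  obtain r where r: "r > 0" "ball (\<phi> (q x)) r \<subseteq> \<phi> ` (W \<inter> U)"
    using chart_nbhd[OF U(1) W(1) U(2) W(2)] by metis
  show thesis
  proof (rule that[OF r(1)])
    fix w :: "real^2" assume "norm w < r"
    then have "\<phi> (q x) + w \<in> ball (\<phi> (q x)) r" by (simp add: dist_norm)
    then obtain z where z: "z \<in> W" "\<phi> z = \<phi> (q x) + w" using r(2) by force
    obtain p p' where "p \<in> R" "p' \<in> R" "q p = q x" "p' - p = \<phi> z - \<phi> (q x)" using W(4)[OF z(1)]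
      by blast
    then show "\<exists>p\<in>R. q p = q x \<and> p + w \<in> R" using z(2)
      by (intro bexI[of _ p]) (auto simp: algebra_simps)
  qed
qed

text \<open>A trajectory is a finite succession of straight segments in the polygon and jumps
  between glued points, so a relation that contains both and composes holds along the whole
  trajectory. It serves to bound the cocycle and to locate the displacement.\<close>

lemma flows_rel_induct:
  assumes fl: "flows M \<theta> T (q a) (q b)" and "0 \<le> T" "a \<in> R" "b \<in> R"
    and tr: "\<And>s t p p' p''. Q s p p' \<Longrightarrow> Q t p' p'' \<Longrightarrow> 0 \<le> s \<Longrightarrow> 0 \<le> t \<Longrightarrow> Q (s + t) p p''"
    and gl: "\<And>p p'. p \<in> R \<Longrightarrow> p' \<in> R \<Longrightarrow> q p = q p' \<Longrightarrow> Q 0 p p'"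
    and st: "\<And>s p. 0 \<le> s \<Longrightarrow> p \<in> R \<Longrightarrow> p + s *\<^sub>R \<theta> \<in> R \<Longrightarrow> Q s p (p + s *\<^sub>R \<theta>)"
  shows "Q T a b"
proof -
  obtain \<gamma> where \<gamma>: "flow_line M \<theta> T \<gamma>" "\<gamma> 0 = q a" "\<gamma> T = q b" using fl unfolding flows_def
    by blast
  define P where "P s t \<longleftrightarrow> (0 \<le> s \<and> s \<le> t \<and> t \<le> T \<longrightarrow>
    (\<forall>p\<in>R. \<forall>p'\<in>R. q p = \<gamma> s \<longrightarrow> q p' = \<gamma> t \<longrightarrow> Q (t - s) p p'))" for s t
  have "P 0 T"
  proof (rule Bolzano[OF \<open>0 \<le> T\<close>])
    fix s t u assume st: "P s t" and tu: "P t u" and le: "s \<le> t" "t \<le> u"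
    show "P s u" unfolding P_def
    proof (intro impI ballI)
      fix p p' assume H: "0 \<le> s \<and> s \<le> u \<and> u \<le> T" "p \<in> R" "p' \<in> R" "q p = \<gamma> s" "q p' = \<gamma> u"
      then have "\<gamma> t \<in> topspace (surf M)"
        using flow_line_regular[OF \<gamma>(1), of t] le by (auto simp: regular_part_def)
      then obtain p1 where p1: "p1 \<in> R" "q p1 = \<gamma> t" using q_onto by (metis imageE)
      have "Q (t - s) p p1" "Q (u - t) p1 p'" using st tu H p1 le unfolding P_def by auto
      then show "Q (u - s) p p'" using tr[of "t - s" p p1 "u - t" p'] le by simp
    qed
  next
    fix t assume "0 \<le> t" "t \<le> T"
    then have t: "t \<in> {0..T}" by auto
    obtain U \<phi> where U: "(U,\<phi>) \<in> atlas M" "\<gamma> t \<in> U" using regular_chart flow_line_regular[OF \<gamma>(1) t]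
      by metis
    obtain e where e: "e > 0" "\<And>s. s \<in> {0..T} \<Longrightarrow> \<bar>s - t\<bar> < e \<Longrightarrow> \<gamma> s \<in> U"
       "\<And>s. s \<in> {0..T} \<Longrightarrow> \<bar>s - t\<bar> < e \<Longrightarrow> \<phi> (\<gamma> s) = \<phi> (\<gamma> t) + (s - t) *\<^sub>R \<theta>"
      using flow_lineD[OF \<gamma>(1) t U] by metis
    obtain W where W: "openin (surf M) W" "\<gamma> t \<in> W" "W \<subseteq> U"
      "\<And>z. z \<in> W \<Longrightarrow> \<exists>p\<in>R. \<exists>p'\<in>R. q p = \<gamma> t \<and> q p' = z \<and> p' - p = \<phi> z - \<phi> (\<gamma> t)"
      using regular_local_lift[OF U] by blast
    obtain e' where e': "e' > 0" "\<And>s. s \<in> {0..T} \<Longrightarrow> \<bar>s - t\<bar> < e' \<Longrightarrow> \<gamma> s \<in> W"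
      using flow_line_cont[OF \<gamma>(1) t W(1,2)] by metis
    have lift: "\<exists>p\<in>R. q p = \<gamma> t \<and> p + (s - t) *\<^sub>R \<theta> \<in> R \<and> q (p + (s - t) *\<^sub>R \<theta>) = \<gamma> s"
      if s: "s \<in> {0..T}" "\<bar>s - t\<bar> < min e e'" for s
    proof -
      obtain p p' where p: "p \<in> R" "p' \<in> R" "q p = \<gamma> t" "q p' = \<gamma> s" "p' - p = \<phi> (\<gamma> s) - \<phi> (\<gamma> t)"
        using W(4)[OF e'(2)[of s]] s by auto
      then have "p' - p = (s - t) *\<^sub>R \<theta>" using e(3)[of s] s by simp
      then have "p' = p + (s - t) *\<^sub>R \<theta>" by (simp only: diff_eq_eq add.commute)
      then show ?thesis using p by auto
    qed
    show "\<exists>d>0. \<forall>a b. a \<le> t \<and> t \<le> b \<and> b - a < d \<longrightarrow> P a b"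
    proof (intro exI[of _ "min e e'"] conjI allI impI)
      show "min e e' > 0" using e e' by simp
      fix s u assume su: "s \<le> t \<and> t \<le> u \<and> u - s < min e e'"
      show "P s u" unfolding P_def
      proof (intro impI ballI)
        fix p p' assume H: "0 \<le> s \<and> s \<le> u \<and> u \<le> T" "p \<in> R" "p' \<in> R" "q p = \<gamma> s" "q p' = \<gamma> u"
        obtain x where x: "x \<in> R" "q x = \<gamma> t" "x + (s - t) *\<^sub>R \<theta> \<in> R" "q (x + (s - t) *\<^sub>R \<theta>) = \<gamma> s"
          using lift[of s] su H(1) t by auto
        obtain y where y: "y \<in> R" "q y = \<gamma> t" "y + (u - t) *\<^sub>R \<theta> \<in> R" "q (y + (u - t) *\<^sub>R \<theta>) = \<gamma> u"
          using lift[of u] su H(1) t by auto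
        have c1: "Q 0 p (x + (s - t) *\<^sub>R \<theta>)" using gl H x by simp
        have c2: "Q (t - s) (x + (s - t) *\<^sub>R \<theta>) x" using st[of "t - s" "x + (s - t) *\<^sub>R \<theta>"] su x
          by (simp add: algebra_simps)
        \<comment> \<open>The segments before and after time t may use different points over
          \<open>\<gamma> t\<close>; a jump joins them.\<close>
        have c3: "Q 0 x y" using gl x y by simp
        have c4: "Q (u - t) y (y + (u - t) *\<^sub>R \<theta>)" using st[of "u - t" y] su y by simp
        have c5: "Q 0 (y + (u - t) *\<^sub>R \<theta>) p'" using gl H y by simp
        have c: "Q (t - s) p x" using tr[OF c1 c2] su by simp
        have c: "Q (t - s) p y" using tr[OF c c3] su by simp
        have c: "Q (u - s) p (y + (u - t) *\<^sub>R \<theta>)" using tr[OF c c4] su by simp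
        show "Q (u - s) p p'" using tr[OF c c5] su by simp
      qed
    qed
  qed
  then show ?thesis unfolding P_def using assms(2-4) \<gamma> by auto
qed

lemma flows_segment_region:
  assumes seg: "\<And>s. s \<in> {0..T} \<Longrightarrow> x + s *\<^sub>R \<theta> \<in> R - set vs" and "0 \<le> T"
  shows "flow_line M \<theta> T (\<lambda>s. q (x + s *\<^sub>R \<theta>))"
proof (rule flow_lineI)
  fix t assume t: "t \<in> {0..T}"
  let ?p = "x + t *\<^sub>R \<theta>"
  have "?p \<in> R" and "q ?p \<in> regular_part M" using seg[OF t] nonvertex_regular by auto
  then obtain U \<phi> where U: "(U,\<phi>) \<in> atlas M" "q ?p \<in> U" using regular_chart by metis
  obtain e where e: "e > 0" "\<And>z. z \<in> R \<inter> ball ?p e \<Longrightarrow> q z \<in> U \<and> \<phi> (q z) = \<phi> (q ?p) + (z - ?p)"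
    using chart_local[OF \<open>?p \<in> R\<close> U] by blast
  have pos: "norm \<theta> + 1 > 0" by (simp add: add_nonneg_pos)
  have "q (x + s *\<^sub>R \<theta>) \<in> U \<and> \<phi> (q (x + s *\<^sub>R \<theta>)) = \<phi> (q ?p) + (s - t) *\<^sub>R \<theta>"
    if s: "s \<in> {0..T}" "\<bar>s - t\<bar> < e / (norm \<theta> + 1)" for s
  proof -
    have *: "x + s *\<^sub>R \<theta> - ?p = (s - t) *\<^sub>R \<theta>" by (simp add: algebra_simps)
    have "norm ((s - t) *\<^sub>R \<theta>) < e" using s(2) pos
      by (intro norm_scaleR_less) (simp add: pos_less_divide_eq)
    then have "dist (x + s *\<^sub>R \<theta>) ?p < e" using * by (simp only: dist_norm)
    then have "x + s *\<^sub>R \<theta> \<in> ball ?p e" by (simp only: mem_ball dist_commute)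
    then have "x + s *\<^sub>R \<theta> \<in> R \<inter> ball ?p e" using seg[OF s(1)] by blast
    from e(2)[OF this] show ?thesis unfolding * .
  qed
  moreover have "e / (norm \<theta> + 1) > 0" using e pos by simp
  ultimately have "\<exists>e>0. \<forall>s\<in>{0..T}. \<bar>s - t\<bar> < e \<longrightarrow>
       q (x + s *\<^sub>R \<theta>) \<in> U \<and> \<phi> (q (x + s *\<^sub>R \<theta>)) = \<phi> (q ?p) + (s - t) *\<^sub>R \<theta>" by metis
  then show "\<exists>(U, \<phi>)\<in>atlas M. q ?p \<in> U \<and> (\<exists>e>0. \<forall>s\<in>{0..T}. \<bar>s - t\<bar> < e \<longrightarrow>
       q (x + s *\<^sub>R \<theta>) \<in> U \<and> \<phi> (q (x + s *\<^sub>R \<theta>)) = \<phi> (q ?p) + (s - t) *\<^sub>R \<theta>)"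
    using U by (intro bexI[OF _ U(1)]) simp
qed

end

section \<open>Periodic orbits in convex patterns\<close>

lemma
  fixes a b :: "real^2"
  assumes np: "\<And>c. b \<noteq> c *\<^sub>R a" and "a \<noteq> 0"
  defines "f \<equiv> \<lambda>y::real^2. (y$1) *\<^sub>R a + (y$2) *\<^sub>R b"
  shows linear_combination_pair: "linear f" and surj_combination_pair: "surj f"
    and inj_combination_pair: "inj f"
proof -
  show lin: "linear f" unfolding f_def by (intro linearI) (auto simp: algebra_simps)
  show "inj f"
  proof (subst linear_injective_0[OF lin], intro allI impI)
    fix y assume "f y = 0"
    then have *: "(y$2) *\<^sub>R b = - (y$1) *\<^sub>R a" unfolding f_def by (simp add: add_eq_0_iff)
    have y2: "y$2 = 0"
    proof (rule ccontr)
      assume ne: "y$2 \<noteq> 0"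
      then have "b = (1 / y$2) *\<^sub>R (y$2) *\<^sub>R b" by simp
      also have "\<dots> = (- (y$1) / y$2) *\<^sub>R a" unfolding * by simp
      finally show False using np by blast
    qed
    then have "y$1 = 0" using * assms(2) by simp
    then show "y = 0" using y2 by (simp add: vec_eq_iff forall_2)
  qed
  then show "surj f" using linear_injective_imp_surjective[OF lin] by blast
qed

lemma open_strip:
  fixes a b :: "real^2"
  assumes "open S" "open T" and np: "\<And>c. b \<noteq> c *\<^sub>R a" and "a \<noteq> 0"
  shows "open {x + s *\<^sub>R a + t *\<^sub>R b | s t. s \<in> S \<and> t \<in> T}"
proof -
  define f :: "real^2 \<Rightarrow> real^2" where "f y = (y$1) *\<^sub>R a + (y$2) *\<^sub>R b" for y
  have lin: "linear f" and "surj f"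
    using linear_combination_pair[OF np assms(4)] surj_combination_pair[OF np assms(4)]
      by (simp_all add: f_def[abs_def])
  have op: "open {y :: real^2. y$1 \<in> S \<and> y$2 \<in> T}"
  proof -
    have "{y :: real^2. y$1 \<in> S \<and> y$2 \<in> T} = (\<lambda>y. y$1) -` S \<inter> (\<lambda>y. y$2) -` T" by auto
    then show ?thesis using assms(1,2) by (auto intro!: open_Int open_vimage continuous_intros)
  qed
  with \<open>surj f\<close> have "open (f ` {y. y$1 \<in> S \<and> y$2 \<in> T})"
    using open_surjective_linear_image[OF _ lin] by blast
  then have "open ((+) x ` f ` {y. y$1 \<in> S \<and> y$2 \<in> T})" by (rule open_translation)
  moreover have "(+) x ` f ` {y. y$1 \<in> S \<and> y$2 \<in> T} = {x + s *\<^sub>R a + t *\<^sub>R b | s t. s \<in> S \<and>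
    t \<in> T}" (is "?l = ?r")
  proof
    show "?l \<subseteq> ?r"
    proof
      fix z assume "z \<in> ?l"
      then obtain y :: "real^2" where "y$1 \<in> S" "y$2 \<in> T" "z = x + (y$1) *\<^sub>R a + (y$2) *\<^sub>R b"
        by (auto simp: f_def add.assoc)
      then show "z \<in> ?r" by blast
    qed
    show "?r \<subseteq> ?l"
    proof
      fix z assume "z \<in> ?r"
      then obtain s t where st: "z = x + s *\<^sub>R a + t *\<^sub>R b" "s \<in> S" "t \<in> T" by blast
      then have "z = x + f (vector [s, t])" "vector [s, t] \<in> {y :: real^2. y$1 \<in> S \<and> y$2 \<in> T}"
        by (auto simp: f_def)
      then show "z \<in> ?l" by blast
    qed
  qed
  ultimately show ?thesis by simp
qed

section \<open>Supporting lines and the translation vectors\<close>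

context convex_pattern
begin

text \<open>From any point of the fibre a step in the direction a would cross the line where the
  inner product with a is c, while \<open>fills_ball\<close> keeps one such step inside the
  region.\<close>

lemma not_supported_at_regular:
  assumes "x \<in> R" "x \<notin> set vs" "a \<noteq> 0"
    and "\<And>p. p \<in> R \<Longrightarrow> q p = q x \<Longrightarrow> a \<bullet> p = c" and "\<And>z. z \<in> R \<Longrightarrow> a \<bullet> z \<le> c"
  shows False
proof -
  obtain r where r: "r > 0" "\<And>w. norm w < r \<Longrightarrow> \<exists>p\<in>R. q p = q x \<and> p + w \<in> R"
    using fills_ball[OF assms(1) nonvertex_regular[OF assms(1,2)]] by metis
  define w where "w = (r / (2 * norm a)) *\<^sub>R a"
  have "norm w < r" using r(1) assms(3) by (simp add: w_def)
  then obtain p where p: "p \<in> R" "q p = q x" "p + w \<in> R" using r(2) by blast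
  have "a \<bullet> (p + w) \<le> c" using assms(5) p by blast
  then have "a \<bullet> w \<le> 0" using assms(4)[OF p(1,2)] by (simp add: inner_add_right)
  moreover have "a \<bullet> w > 0" using r(1) assms(3) by (simp add: w_def)
  ultimately show False by simp
qed

lemma no_two_cycle:
  assumes "i < n" "j < n" "v (Suc j) = v i" "v j = v (Suc i)" shows False
proof -
  have 1: "Suc j mod n = i" "j = Suc i mod n" using assms by (simp_all add: vertex_eq_iff)
  show False
  proof (cases "Suc i < n")
    case True
    then have "j = Suc i" using 1 by simp
    then have *: "Suc (Suc i) mod n = i" using 1 by simp
    show False
    proof (cases "Suc (Suc i) < n")
      case False
      then have "Suc (Suc i) = n" using True by simp
      then show False using * n_ge_3 by simp
    qed (use * in simp)
  next
    case False
    then have "Suc i = n" using assms by simp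
    then have "j = 0" using 1 by simp
    then show False using 1 n_ge_3 \<open>Suc i = n\<close> by simp
  qed
qed

text \<open>A zero translation would make edge \<open>\<sigma> i\<close> the reversal of edge i, and
  the polygon would be a digon.\<close>

lemma tau_nonzero: assumes "i < n" shows "\<tau> i \<noteq> 0"
proof
  assume "\<tau> i = 0"
  then have "v (Suc (\<sigma> i)) = v i" by simp
  moreover from this have "v (\<sigma> i) = v (Suc i)" using sigma(4)[OF assms] by simp
  ultimately show False using no_two_cycle sigma(1) assms by blast
qed

lemma edge_nondegenerate: "i < n \<Longrightarrow> v i \<noteq> v (Suc i)"
  using n_ge_3 by (cases "Suc i < n") (auto simp: vertex_eq_iff mod_if)

lemma edge_point_nonvertex:
  assumes "i < n" "0 < s" "s < 1"
  shows "v i + s *\<^sub>R (v (Suc i) - v i) \<in> edge vs i - set vs"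
proof -
  let ?x = "v i + s *\<^sub>R (v (Suc i) - v i)"
  have ne: "v i \<noteq> v (Suc i)" using edge_nondegenerate assms by blast
  have x: "?x \<in> edge vs i" using assms by (auto simp: edge_eq)
  moreover have "?x \<noteq> v i" using ne assms by simp
  moreover have "?x \<noteq> v (Suc i)"
  proof
    assume "?x = v (Suc i)"
    moreover have "(1 - s) *\<^sub>R (v (Suc i) - v i) = v (Suc i) - ?x" by (simp add: algebra_simps)
    ultimately have "(1 - s) *\<^sub>R (v (Suc i) - v i) = 0" by simp
    then show False using ne assms by simp
  qed
  ultimately show ?thesis using vertex_edge[OF assms(1) x] by blast
qed

text \<open>Suppose every \<open>\<tau> i\<close> is orthogonal to a, and maximise the inner product
  with a over the region. The whole fibre of a maximiser then consists of maximisers, so by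
  \<open>not_supported_at_regular\<close> every maximiser is a vertex. But if p is one, then so is
  every point of the segment from p to \<open>p + \<tau> i\<close>, by convexity, and there are only
  finitely many vertices.\<close>

lemma tau_spanning:
  assumes "a \<noteq> 0" obtains i where "i < n" "a \<bullet> \<tau> i \<noteq> 0"
proof (rule ccontr)
  assume "\<not> thesis"
  then have z: "\<And>i. i < n \<Longrightarrow> a \<bullet> \<tau> i = 0" using that by blast
  have "R \<noteq> {}" using vertices_region vertex_in by blast
  then obtain p where p: "p \<in> R" "\<And>x. x \<in> R \<Longrightarrow> a \<bullet> x \<le> a \<bullet> p"
    using continuous_attains_sup[OF compact_region, of "\<lambda>x. a \<bullet> x"] continuous_on_inner[OF continuous_on_const continuous_on_id] by metis
  have vert: "x \<in> set vs" if x: "x \<in> R" "a \<bullet> x = a \<bullet> p" for x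
  proof (rule ccontr)
    assume "x \<notin> set vs"
    moreover have "a \<bullet> y = a \<bullet> p" if "y \<in> R" "q y = q x" for y
      using x(1) that(1) that(2)[symmetric]
      by (induction rule: fibre_induct) (use x z in \<open>auto simp: inner_add_right\<close>)
    ultimately show False using not_supported_at_regular[OF x(1) _ assms] p(2) by metis
  qed
  obtain i where i: "i < n" "p = v i" using vert[OF p(1) refl] set_vs by auto
  let ?p' = "p + \<tau> i"
  have p': "?p' \<in> R" using i vertex_in vertices_region by auto
  have "p \<noteq> ?p'" using tau_nonzero[OF i(1)] by simp
  then have "infinite (closed_segment p ?p')" by simp
  moreover have "closed_segment p ?p' \<subseteq> set vs"
  proof
    fix x assume x: "x \<in> closed_segment p ?p'"
    then have "x \<in> R" using closed_segment_subset[OF p(1) p' convex_region] by blast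
    moreover obtain u where "x = (1 - u) *\<^sub>R p + u *\<^sub>R ?p'" using x unfolding closed_segment_def
      by blast
    then have "a \<bullet> x = (1 - u) * (a \<bullet> p) + u * (a \<bullet> p + a \<bullet> \<tau> i)"
      by (simp only: inner_add_right inner_scaleR_right)
    then have "a \<bullet> x = a \<bullet> p" using z[OF i(1)] by (simp add: algebra_simps)
    ultimately show "x \<in> set vs" using vert by blast
  qed
  ultimately show False using finite_subset by blast
qed

lemma negligible_boundary: "negligible E"
proof -
  have "negligible (edge vs i)" for i
    unfolding edge_def by (simp add: negligible_convex_interior interior_closed_segment_ge2)
  then show ?thesis unfolding polygon_boundary_def by (intro negligible_Union) auto
qed

text \<open>A convex region without interior lies in a line, which would support it at the whole
  fibre of the midpoint of an edge.\<close>

lemma interior_region_nonempty: "interior R \<noteq> {}"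
proof
  assume "interior R = {}"
  then obtain a b where ab: "a \<noteq> 0" "R \<subseteq> {x. a \<bullet> x = b}"
    using empty_interior_subset_hyperplane[OF convex_region] by metis
  then have "v 0 + (1/2) *\<^sub>R (v (Suc 0) - v 0) \<in> R - set vs"
    using edge_point_nonvertex[OF n_pos, of "1/2"] edge_subset_region[OF n_pos] by auto
  then show False using not_supported_at_regular[OF _ _ ab(1), of _ b] ab(2) by blast
qed

text \<open>Otherwise all points of the region near the partner \<open>x + \<tau> i\<close> would be glued to points near \<open>x\<close> and
  therefore lie on the boundary.\<close>

lemma edge_not_interior:
  assumes "i < n" "x \<in> edge vs i" "x \<notin> set vs" shows "x \<notin> interior R"
proof
  assume "x \<in> interior R"
  then obtain e1 where e1: "e1 > 0" "ball x e1 \<subseteq> R" by (meson mem_interior)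
  have xR: "x \<in> R" using e1 by auto
  let ?y = "x + \<tau> i"
  have y: "?y \<in> R" "q ?y = q x"
    using edge_translate assms sigma(1)[OF assms(1)] edge_subset_region q_glued by auto
  obtain U \<phi> where U: "(U, \<phi>) \<in> atlas M" "q x \<in> U"
    using regular_chart nonvertex_regular[OF xR assms(3)] by metis
  obtain e2 where e2: "e2 > 0" "\<And>z. z \<in> R \<inter> ball x e2 \<Longrightarrow> q z \<in> U \<and> \<phi> (q z) = \<phi> (q x) + (z - x)"
    using chart_local[OF xR U] by blast
  obtain e3 where e3: "e3 > 0" "\<And>z. z \<in> R \<inter> ball ?y e3 \<Longrightarrow> q z \<in> U \<and> \<phi> (q z) = \<phi> (q ?y) + (z - ?y)"
    using chart_local[OF y(1) U(1)] U(2) y(2) by metis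
  define e where "e = min e1 (min e2 e3)"
  have e: "e > 0" using e1 e2 e3 by (simp add: e_def)
  have sub: "R \<inter> ball ?y e \<subseteq> E"
  proof (rule subsetI, rule ccontr)
    fix z assume z: "z \<in> R \<inter> ball ?y e" "z \<notin> E"
    let ?w = "z - \<tau> i"
    have "dist x ?w = dist ?y z" by (simp add: dist_norm algebra_simps)
    then have w: "?w \<in> ball x e1" "?w \<in> ball x e2" "z \<in> ball ?y e3" using z by (auto simp: e_def)
    have "q ?w \<in> U" "\<phi> (q ?w) = \<phi> (q x) + (?w - x)" using e2(2)[of ?w] w e1(2) by auto
    moreover have "q z \<in> U" "\<phi> (q z) = \<phi> (q x) + (z - ?y)" using e3(2)[of z] w z y by auto
    moreover have "?w - x = z - ?y" by simp
    ultimately have "q z = q ?w" using inj_onD[OF chart_inj[OF U(1)], of "q z" "q ?w"] by simp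
    then have "?w = z" using fibre_inside[of z ?w] z w e1(2) by auto
    then show False using tau_nonzero[OF assms(1)] by simp
  qed
  \<comment> \<open>By convexity the points between \<open>?y\<close> and an interior point are
    interior, so near \<open>?y\<close> the region contains an open set, which the null set
    \<open>E\<close> cannot cover.\<close>
  obtain c where c: "c \<in> interior R" using interior_region_nonempty by blast
  define t where "t = min 1 (e / (2 * (norm (?y - c) + 1)))"
  have pos: "norm (?y - c) + 1 > 0" by (simp add: add_nonneg_pos)
  have t: "0 < t" "t \<le> 1" using e pos by (auto simp: t_def)
  let ?m = "?y - t *\<^sub>R (?y - c)"
  have m: "?m \<in> interior R" using mem_interior_convex_shrink[OF convex_region c y(1) t] .
  have "\<bar>t\<bar> * (norm (?y - c) + 1) \<le> e / (2 * (norm (?y - c) + 1)) * (norm (?y - c) + 1)"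
    using t pos unfolding t_def by (intro mult_right_mono) auto
  also have "\<dots> = e / 2" using pos by (simp only: times_divide_eq_left mult_divide_mult_cancel_right)
  finally have "\<bar>t\<bar> * (norm (?y - c) + 1) \<le> e / 2" .
  then have "norm (t *\<^sub>R (?y - c)) < e" using e by (intro norm_scaleR_less) auto
  then have "?m \<in> ball ?y e" by (simp add: dist_norm)
  then have "interior R \<inter> ball ?y e \<noteq> {}" using m by blast
  moreover have "open (interior R \<inter> ball ?y e)" by auto
  moreover have "negligible (interior R \<inter> ball ?y e)"
    by (rule negligible_subset[OF negligible_boundary]) (use sub interior_subset in blast)
  ultimately show False using open_not_negligible by blast
qed

text \<open>If \<open>\<tau> i\<close> were parallel to edge \<open>i\<close>, the two sectors over the midpoint of the edge would lie on the same
  side of a supporting line and could not fill a neighbourhood.\<close>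

lemma tau_not_parallel:
  assumes "i < n" shows "\<tau> i \<noteq> c *\<^sub>R (v (Suc i) - v i)"
proof
  assume *: "\<tau> i = c *\<^sub>R (v (Suc i) - v i)"
  let ?x = "v i + (1/2) *\<^sub>R (v (Suc i) - v i)"
  have x: "?x \<in> edge vs i" "?x \<notin> set vs" using edge_point_nonvertex[OF assms, of "1/2"] by auto
  have xR: "?x \<in> R" using x edge_subset_region assms by blast
  have "?x \<notin> rel_interior R"
    using edge_not_interior[OF assms x] rel_interior_nonempty_interior[OF interior_region_nonempty]
      by simp
  then obtain a where a: "a \<noteq> 0" "\<And>y. y \<in> R \<Longrightarrow> a \<bullet> ?x \<le> a \<bullet> y"
    using supporting_hyperplane_rel_boundary[OF convex_region xR] by metis
  \<comment> \<open>The midpoint of the edge minimises the inner product with a over the region, so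
    this product takes the same value at both ends.\<close>
  have aux: "B = A" if "y \<le> A" "y \<le> B" "y = A + (B - A) / 2" for y A B :: real
    using that by (simp add: field_simps)
  have "a \<bullet> ?x \<le> a \<bullet> v i" "a \<bullet> ?x \<le> a \<bullet> v (Suc i)" using a(2) vertex_in vertices_region by blast+
  moreover have "a \<bullet> ?x = a \<bullet> v i + (a \<bullet> v (Suc i) - a \<bullet> v i) / 2"
    by (simp add: inner_add_right inner_diff_right)
  ultimately have "a \<bullet> v (Suc i) = a \<bullet> v i" by (rule aux)
  then have e0: "a \<bullet> (v (Suc i) - v i) = 0" by (simp add: inner_diff_right)
  have f1: "(-a) \<bullet> p = (-a) \<bullet> ?x" if p: "p \<in> R" "q p = q ?x" for p
  proof -
    have "p = ?x \<or> p = ?x + \<tau> i" using fibre_edge[OF assms x p(1)] p(2) by simp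
    then show ?thesis using e0 * by (auto simp: inner_add_right simp del: scaleR_right_diff_distrib)
  qed
  have f2: "(-a) \<bullet> z \<le> (-a) \<bullet> ?x" if "z \<in> R" for z using a(2)[OF that] by simp
  show False by (rule not_supported_at_regular[OF xR x(2) _ f1 f2]) (use a(1) in simp)
qed

section \<open>Null sets and closed orbits along the translation vectors\<close>

lemma inside_eq: "I = R - E"
  unfolding polygon_region_def using inside_boundary_disjoint by blast

lemma inside_not_negligible: "\<not> negligible I"
proof
  assume "negligible I"
  then have "negligible R" unfolding polygon_region_def using negligible_boundary
    by (simp add: negligible_Un)
  then show False using negligible_convex_interior[OF convex_region] interior_region_nonempty
    by simp
qed

lemma vertices_boundary: "set vs \<subseteq> E"
  unfolding set_vs polygon_boundary_def edge_def by auto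

text \<open>In the coordinates of the polygon a chart is locally a translation, hence preserves null
  sets, and negligibility is a local property.\<close>

lemma AE_surface_inside:
  assumes "AE_surface M P" shows "negligible {x \<in> I. \<not> P (q x)}"
  unfolding locally_negligible_alt[of "{x \<in> I. \<not> P (q x)}"]
proof
  fix x assume x: "x \<in> {x \<in> I. \<not> P (q x)}"
  then have xR: "x \<in> R" "x \<notin> set vs" using vertices_boundary inside_eq by auto
  obtain U \<phi> where U: "(U, \<phi>) \<in> atlas M" "q x \<in> U" using regular_chart nonvertex_regular[OF xR]
    by metis
  obtain e where e: "e > 0" "\<And>z. z \<in> R \<inter> ball x e \<Longrightarrow> q z \<in> U \<and> \<phi> (q z) = \<phi> (q x) + (z - x)"
    using chart_local[OF xR(1) U] by blast
  have neg: "negligible (\<phi> ` {y \<in> U. \<not> P y})" using assms U(1) unfolding AE_surface_def by blast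
  let ?B = "{z \<in> I. \<not> P (q z)} \<inter> ball x e"
  have "?B \<subseteq> (+) (x - \<phi> (q x)) ` (\<phi> ` {y \<in> U. \<not> P y})"
  proof
    fix z assume z: "z \<in> ?B"
    then have "q z \<in> U" "\<phi> (q z) = \<phi> (q x) + (z - x)" using e(2)[of z] inside_subset by auto
    then have "z = (x - \<phi> (q x)) + \<phi> (q z)" by simp
    then show "z \<in> (+) (x - \<phi> (q x)) ` (\<phi> ` {y \<in> U. \<not> P y})" using z \<open>q z \<in> U\<close> by blast
  qed
  then have "negligible ?B" using negligible_subset[OF negligible_translation[OF neg]] by blast
  moreover have "openin (top_of_set {x \<in> I. \<not> P (q x)}) ?B" by (simp add: openin_open_Int)
  ultimately show "\<exists>V. openin (top_of_set {x \<in> I. \<not> P (q x)}) V \<and> x \<in> V \<and> negligible V"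
    using x e(1) by (intro exI[of _ ?B]) auto
qed

lemma periodic_segment:
  assumes "i < n" "x \<in> edge vs i" and seg: "\<And>t. t \<in> {0..1} \<Longrightarrow> x + t *\<^sub>R \<tau> i \<in> R - set vs"
    and st: "0 \<le> s" "s \<le> t" "t \<le> 1"
  shows "flows M (\<tau> i /\<^sub>R norm (\<tau> i)) ((t - s) * norm (\<tau> i)) (q (x + s *\<^sub>R \<tau> i)) (q (x +
    t *\<^sub>R \<tau> i))"
proof -
  let ?L = "norm (\<tau> i)" let ?\<theta> = "\<tau> i /\<^sub>R ?L"
  have L: "?L > 0" using tau_nonzero[OF assms(1)] by simp
  have "flow_line M ?\<theta> ?L (\<lambda>r. q (x + r *\<^sub>R ?\<theta>))"
  proof (rule flows_segment_region)
    fix r assume r: "r \<in> {0..?L}"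
    have "x + (r / ?L) *\<^sub>R \<tau> i \<in> R - set vs" using r L by (intro seg) (auto simp: field_simps)
    then show "x + r *\<^sub>R ?\<theta> \<in> R - set vs" by (simp add: divide_inverse)
  qed (use L in simp)
  moreover have "0 \<le> s * ?L" "s * ?L \<le> t * ?L" "t * ?L \<le> ?L" using st L
    by (auto intro: mult_right_mono)
  ultimately have "flows M ?\<theta> (t * ?L - s * ?L) (q (x + (s * ?L) *\<^sub>R ?\<theta>)) (q (x + (t * ?L) *\<^sub>R ?\<theta>))"
    by (rule flows_segment)
  moreover have "(r * ?L) *\<^sub>R ?\<theta> = r *\<^sub>R \<tau> i" for r using L by simp
  ultimately show ?thesis by (simp only: left_diff_distrib)
qed

lemma flows_multiple: "flows M \<theta> T x x \<Longrightarrow> 0 \<le> T \<Longrightarrow> flow_line M \<theta> S \<gamma> \<Longrightarrow> \<gamma> 0 = x \<Longrightarrow> real m * T \<le> S \<Longrightarrow>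
  \<gamma> (real m * T) = x"
proof (induction m)
  case (Suc m)
  have m: "real m * T \<le> S" using Suc.prems by (simp add: algebra_simps)
  have "flows M \<theta> (real (Suc m) * T - real m * T) (\<gamma> (real m * T)) (\<gamma> (real (Suc m) * T))"
    using Suc.prems m by (intro flows_segment[OF Suc.prems(3)]) (auto simp: algebra_simps)
  then have "flows M \<theta> T x (\<gamma> (real (Suc m) * T))" using Suc m by (simp add: algebra_simps)
  then show ?case using flows_functional[OF Suc.prems(1)] Suc.prems(2) by metis
qed simp

text \<open>As \<open>\<tau> i\<close> is not parallel to edge i, each of the finitely many vertices
  excludes at most one starting point on the edge.\<close>

lemma tau_transversal:
  assumes "i < n" obtains S where "open S" "S \<noteq> {}" "S \<subseteq> {0<..<1}"
    "\<And>s t. s \<in> S \<Longrightarrow> t \<in> {0..1} \<Longrightarrow> v i + s *\<^sub>R (v (Suc i) - v i) + t *\<^sub>R \<tau> i \<in> R - set vs"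
proof -
  let ?e = "v (Suc i) - v i"
  define bad where "bad w = {s. \<exists>t. v i + s *\<^sub>R ?e + t *\<^sub>R \<tau> i = w}" for w
  have same: "s = s'" if bad: "s \<in> bad w" "s' \<in> bad w" for s s' w
  proof (rule ccontr)
    assume ne: "s \<noteq> s'"
    obtain t t' where tt: "v i + s *\<^sub>R ?e + t *\<^sub>R \<tau> i = w" "v i + s' *\<^sub>R ?e + t' *\<^sub>R \<tau> i = w"
      using bad unfolding bad_def by auto
    then have "v i + s *\<^sub>R ?e + t *\<^sub>R \<tau> i = v i + s' *\<^sub>R ?e + t' *\<^sub>R \<tau> i" by simp
    then have *: "(t' - t) *\<^sub>R \<tau> i = (s - s') *\<^sub>R ?e" by (simp add: algebra_simps)
    show False
    proof (cases "t' = t")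
      case True
      then have "?e = 0" using * ne by simp
      moreover have "v i + (1/2) *\<^sub>R ?e \<noteq> v i"
        using edge_point_nonvertex[OF assms, of "1/2"] vertex_in by force
      ultimately show False by simp
    next
      case False
      then have "\<tau> i = (1 / (t' - t)) *\<^sub>R (t' - t) *\<^sub>R \<tau> i" by simp
      also have "\<dots> = ((s - s') / (t' - t)) *\<^sub>R ?e" unfolding * by simp
      finally show False using tau_not_parallel[OF assms] by blast
    qed
  qed
  have "finite (bad w)" for w
  proof (cases "bad w = {}")
    case False
    then obtain s where "s \<in> bad w" by blast
    then have "bad w \<subseteq> {s}" using same by blast
    then show ?thesis using finite_subset by blast
  qed simp
  then have fin: "finite (\<Union>w\<in>set vs. bad w)" by simp
  show thesis
  proof (rule that)
    show "open ({0<..<1} - (\<Union>w\<in>set vs. bad w))" using fin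
      by (intro open_Diff finite_imp_closed) auto
    have "infinite {0<..<1::real}" by simp
    then show "{0<..<1} - (\<Union>w\<in>set vs. bad w) \<noteq> {}" using fin
      by (metis Diff_eq_empty_iff finite_subset)
    fix s t :: real assume st: "s \<in> {0<..<1} - (\<Union>w\<in>set vs. bad w)" "t \<in> {0..1}"
    let ?x = "v i + s *\<^sub>R ?e"
    have x: "?x \<in> edge vs i" using edge_point_nonvertex[OF assms, of s] st by auto
    have "?x \<in> R" "?x + \<tau> i \<in> R"
      using x edge_translate[OF assms x] edge_subset_region[OF assms] edge_subset_region[OF sigma(1)[OF assms]] by auto
    then have "(1 - t) *\<^sub>R ?x + t *\<^sub>R (?x + \<tau> i) \<in> R"
      using convexD[OF convex_region, of ?x "?x + \<tau> i" "1 - t" t] st(2) by simp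
    moreover have "(1 - t) *\<^sub>R ?x + t *\<^sub>R (?x + \<tau> i) = ?x + t *\<^sub>R \<tau> i" by (simp add: algebra_simps)
    ultimately have "?x + t *\<^sub>R \<tau> i \<in> R" by simp
    moreover have "?x + t *\<^sub>R \<tau> i \<notin> set vs" using st(1) unfolding bad_def by blast
    ultimately show "?x + t *\<^sub>R \<tau> i \<in> R - set vs" by blast
  qed auto
qed

text \<open>The segments given by \<open>tau_transversal\<close> close up to an open cylinder of
  circumference \<open>norm (\<tau> i)\<close>. The period T supplied by pure periodicity is valid
  almost everywhere, hence at some z of the cylinder off the boundary. The remainder r of T modulo
  the circumference is then a return time of z; it must vanish, because the orbit of z meets z only
  once per turn.\<close>

lemma tau_periodic:
  assumes pp: "purely_periodic M" and i: "i < n"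
  obtains T m \<theta> where "T > 0" "(m::nat) > 0" "T *\<^sub>R \<theta> = real m *\<^sub>R \<tau> i" "norm \<theta> = 1"
    "negligible {x \<in> I. \<not> flows M \<theta> T (q x) (q x)}"
proof -
  let ?L = "norm (\<tau> i)" and ?\<theta> = "\<tau> i /\<^sub>R norm (\<tau> i)" and ?e = "v (Suc i) - v i"
  have L: "?L > 0" using tau_nonzero[OF i] by simp
  obtain S where S: "open S" "S \<noteq> {}" "S \<subseteq> {0<..<1}"
    "\<And>s t. s \<in> S \<Longrightarrow> t \<in> {0..1} \<Longrightarrow> v i + s *\<^sub>R ?e + t *\<^sub>R \<tau> i \<in> R - set vs"
    using tau_transversal[OF i] by blast
  have edge: "v i + s *\<^sub>R ?e \<in> edge vs i" if "s \<in> S" for s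
    using edge_point_nonvertex[OF i, of s] that S(3) by auto
  note per = periodic_segment[OF i edge S(4)]
  obtain s0 where s0: "s0 \<in> S" using S(2) by blast
  have "flows M ?\<theta> ?L (q (v i + s0 *\<^sub>R ?e)) (q (v i + s0 *\<^sub>R ?e))"
    using per[OF s0 s0, of 0 1] q_glued[OF i edge[OF s0]] by simp
  then have "has_periodic_orbit M ?\<theta>" unfolding has_periodic_orbit_def using L by blast
  moreover have "?\<theta> \<in> sphere 0 1" using L by simp
  ultimately obtain T where T: "T > 0" "AE_surface M (\<lambda>x. flows M ?\<theta> T x x)"
    using pp unfolding purely_periodic_def periodic_flow_def by blast
  have neg: "negligible {x \<in> I. \<not> flows M ?\<theta> T (q x) (q x)}" using AE_surface_inside[OF T(2)] .
  define W where "W = {v i + s *\<^sub>R ?e + t *\<^sub>R \<tau> i | s t. s \<in> S \<and> t \<in> {0<..<1}}"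
  have "?e \<noteq> 0"
  proof
    assume "?e = 0"
    then have "v i + (1/2) *\<^sub>R ?e = v i" by simp
    then show False using edge_point_nonvertex[OF i, of "1/2"] vertex_in by force
  qed
  then have "open W" unfolding W_def by (intro open_strip S(1) tau_not_parallel[OF i]) auto
  moreover have "v i + s0 *\<^sub>R ?e + (1/2) *\<^sub>R \<tau> i \<in> W" unfolding W_def using s0 by force
  ultimately have "\<not> negligible W" using open_not_negligible by blast
  moreover have "negligible (E \<union> {x \<in> I. \<not> flows M ?\<theta> T (q x) (q x)})" using negligible_boundary neg
    by (simp add: negligible_Un)
  ultimately obtain z where z: "z \<in> W" "z \<notin> E" "\<not> (z \<in> I \<and> \<not> flows M ?\<theta> T (q z) (q z))"
    using negligible_subset by blast
  obtain s t where st: "s \<in> S" "0 < t" "t < 1" "z = v i + s *\<^sub>R ?e + t *\<^sub>R \<tau> i" using z(1)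
    unfolding W_def by auto
  let ?x = "v i + s *\<^sub>R ?e"
  have zR: "z \<in> R" using S(4)[OF st(1), of t] st by auto
  then have fT: "flows M ?\<theta> T (q z) (q z)" using z inside_eq by blast
  \<comment> \<open>The orbit of z runs to \<open>?x + \<tau> i\<close>, which is glued to
    \<open>?x\<close>, and from there back to z.\<close>
  have "flows M ?\<theta> ((1 - t) * ?L) (q z) (q (?x + \<tau> i))" using per[OF st(1) st(1), of t 1] st by simp
  moreover have "flows M ?\<theta> (t * ?L) (q (?x + \<tau> i)) (q z)"
    using per[OF st(1) st(1), of 0 t] st q_glued[OF i edge[OF st(1)]] by simp
  ultimately have "flows M ?\<theta> ((1 - t) * ?L + t * ?L) (q z) (q z)"
    by (rule flows_trans) (use st L in auto)
  then have fL: "flows M ?\<theta> ?L (q z) (q z)" by (simp add: algebra_simps)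
  obtain \<gamma> where \<gamma>: "flow_line M ?\<theta> T \<gamma>" "\<gamma> 0 = q z" "\<gamma> T = q z" using fT unfolding flows_def
    by blast
  define m where "m = nat \<lfloor>T / ?L\<rfloor>"
  define r where "r = T - real m * ?L"
  have "real m = of_int \<lfloor>T / ?L\<rfloor>" using T(1) L by (simp add: m_def)
  then have "real m \<le> T / ?L" "T / ?L < real m + 1" by linarith+
  then have r: "0 \<le> r" "r < ?L" using L by (auto simp: r_def field_simps)
  have "\<gamma> (real m * ?L) = q z" using flows_multiple[OF fL _ \<gamma>(1,2)] L r(1) by (simp add: r_def)
  then have fr: "flows M ?\<theta> r (q z) (q z)"
    using flows_segment[OF \<gamma>(1), of "real m * ?L" T] \<gamma>(3) r(1) L by (simp add: r_def)
  have "r = 0"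
  proof (rule ccontr)
    assume "r \<noteq> 0"
    then have rp: "r > 0" using r by simp
    show False
    proof (cases "t + r / ?L \<le> 1")
      case True
      have "flows M ?\<theta> ((t + r / ?L - t) * ?L) (q z) (q (?x + (t + r / ?L) *\<^sub>R \<tau> i))"
        unfolding st(4) by (rule per[OF st(1) st(1)]) (use st rp L True in auto)
      then have "q z = q (?x + (t + r / ?L) *\<^sub>R \<tau> i)"
        using flows_functional[OF fr] L r by simp
      then have "?x + (t + r / ?L) *\<^sub>R \<tau> i = z"
        using S(4)[OF st(1), of "t + r / ?L"] True st rp L zR z(2)
        by (intro fibre_inside) auto
      then have "(r / ?L) *\<^sub>R \<tau> i = 0" unfolding st(4) by (simp add: algebra_simps)
      then show False using rp L by simp
    next
      case False
      \<comment> \<open>After time r the orbit has passed the gluing and sits at parameter u.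
        Instead of following it across, compare backwards: the point at parameter u and z both reach
        z in time \<open>?L - r\<close>.\<close>
      define u where "u = t + r / ?L - 1"
      have u: "0 \<le> u" "u \<le> t" using False r L by (auto simp: u_def)
      have "flows M ?\<theta> ((t - u) * ?L) (q (?x + u *\<^sub>R \<tau> i)) (q z)"
        unfolding st(4) by (rule per[OF st(1) st(1)]) (use st u in auto)
      moreover have tu: "(t - u) * ?L = ?L - r" using L by (simp add: u_def field_simps)
      ultimately have f1: "flows M ?\<theta> (?L - r) (q (?x + u *\<^sub>R \<tau> i)) (q z)" by simp
      obtain \<beta> where \<beta>: "flow_line M ?\<theta> ?L \<beta>" "\<beta> 0 = q z" "\<beta> ?L = q z" using fL unfolding flows_def
        by blast
      have "flows M ?\<theta> r (q z) (\<beta> r)" using flows_segment[OF \<beta>(1), of 0 r] \<beta>(2) r by simp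
      then have "\<beta> r = q z" using flows_functional[OF fr] r by metis
      then have f2: "flows M ?\<theta> (?L - r) (q z) (q z)" using flows_segment[OF \<beta>(1), of r ?L] \<beta>(3) r
        by simp
      have "q (?x + u *\<^sub>R \<tau> i) = q z" using flows_injective[OF f1 f2] r by simp
      then have "?x + u *\<^sub>R \<tau> i = z" using S(4)[OF st(1), of u] u st zR z(2)
        by (intro fibre_inside) auto
      then have "(t - u) *\<^sub>R \<tau> i = 0" unfolding st(4) by (simp add: algebra_simps)
      then show False using tu r L by auto
    qed
  qed
  then have Tm: "T = real m * ?L" by (simp add: r_def)
  show thesis
  proof (rule that[OF T(1) _ _ _ neg])
    show "m > 0" using Tm T(1) by (cases m) auto
    show "T *\<^sub>R ?\<theta> = real m *\<^sub>R \<tau> i" using L by (simp add: Tm)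
    show "norm ?\<theta> = 1" using L by simp
  qed
qed

end

section \<open>Piecewise translations and difference integrals\<close>

lemma emeasure_lebesgue_translation:
  "emeasure lebesgue ((+) a ` S) = emeasure lebesgue (S :: 'a::euclidean_space set)"
  using emeasure_lebesgue_affine[of 1 a S] by (simp add: ac_simps cong: image_cong_simp)

text \<open>\<open>\<Psi>\<close> cuts \<open>G\<close> into countably many measurable pieces and
  translates each of them. Bijectivity makes the translated pieces a partition of \<open>G\<close>,
  so Lebesgue measure is preserved.\<close>

lemma
  fixes \<Psi> :: "'a::euclidean_space \<Rightarrow> 'a" and g :: "'a \<Rightarrow> real"
  assumes G: "G \<in> sets lebesgue" and bij: "bij_betw \<Psi> G G" and C: "countable C"
    and \<Psi>C: "\<And>x. x \<in> G \<Longrightarrow> \<Psi> x - x \<in> C"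
    and meas: "\<And>c. c \<in> C \<Longrightarrow> {x \<in> G. \<Psi> x = x + c} \<in> sets lebesgue"
  shows measurable_piecewise_translation: "\<Psi> \<in> measurable (lebesgue_on G) (lebesgue_on G)"
    and integral_piecewise_translation: "g \<in> borel_measurable (lebesgue_on G) \<Longrightarrow>
        integral\<^sup>L (lebesgue_on G) (\<lambda>x. g (\<Psi> x)) = integral\<^sup>L (lebesgue_on G) g"
proof -
  define P where "P A c = {x \<in> G. \<Psi> x = x + c} \<inter> (+) (- c) ` A" for A c
  have PA: "\<Psi> -` A \<inter> G = (\<Union>c\<in>C. P A c)" for A
  proof
    show "\<Psi> -` A \<inter> G \<subseteq> (\<Union>c\<in>C. P A c)"
    proof
      fix x assume x: "x \<in> \<Psi> -` A \<inter> G"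
      have "x \<in> (+) (- (\<Psi> x - x)) ` A" using x by (intro image_eqI[of _ _ "\<Psi> x"]) auto
      then have "x \<in> P A (\<Psi> x - x)" unfolding P_def using x by simp
      then show "x \<in> (\<Union>c\<in>C. P A c)" using \<Psi>C x by blast
    qed
  qed (auto simp: P_def)
  have Psets: "P A c \<in> sets lebesgue" if "A \<in> sets lebesgue" "c \<in> C" for A c
    unfolding P_def by (intro sets.Int meas that lebesgue_sets_translation)
  show m: "\<Psi> \<in> measurable (lebesgue_on G) (lebesgue_on G)"
  proof (rule measurableI)
    show "\<Psi> x \<in> space (lebesgue_on G)" if "x \<in> space (lebesgue_on G)" for x
      using that bij by (auto dest: bij_betwE)
    fix A assume "A \<in> sets (lebesgue_on G)"
    then have A: "A \<in> sets lebesgue" "A \<subseteq> G" using G by (auto simp: sets_restrict_space_iff)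
    have "(\<Union>c\<in>C. P A c) \<in> sets lebesgue" using Psets[OF A(1)] C by (intro sets.countable_UN') auto
    then show "\<Psi> -` A \<inter> space (lebesgue_on G) \<in> sets (lebesgue_on G)"
      using PA[of A] G by (auto simp: sets_restrict_space_iff)
  qed
  have "distr (lebesgue_on G) (lebesgue_on G) \<Psi> = lebesgue_on G"
  proof (rule measure_eqI)
    fix A assume "A \<in> sets (distr (lebesgue_on G) (lebesgue_on G) \<Psi>)"
    then have A': "A \<in> sets (lebesgue_on G)" by simp
    then have A: "A \<in> sets lebesgue" "A \<subseteq> G" using G by (auto simp: sets_restrict_space_iff)
    have AU: "A = (\<Union>c\<in>C. (+) c ` P A c)"
    proof
      show "A \<subseteq> (\<Union>c\<in>C. (+) c ` P A c)"
      proof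
        fix y assume y: "y \<in> A"
        then obtain x where x: "x \<in> G" "\<Psi> x = y" using bij A(2)
          by (metis bij_betw_imp_surj_on imageE subsetD)
        then obtain c where "c \<in> C" "x \<in> P A c" using PA[of A] y by blast
        then have "y = c + x" using x unfolding P_def by (simp add: add.commute)
        then show "y \<in> (\<Union>c\<in>C. (+) c ` P A c)" using \<open>c \<in> C\<close> \<open>x \<in> P A c\<close> by blast
      qed
    qed (auto simp: P_def)
    have "emeasure (distr (lebesgue_on G) (lebesgue_on G) \<Psi>) A =
      emeasure (lebesgue_on G) (\<Union>c\<in>C. P A c)"
      using PA[of A] A' by (simp add: emeasure_distr[OF m])
    also have "\<dots> = emeasure lebesgue (\<Union>c\<in>C. P A c)"
      using G by (subst emeasure_restrict_space) (auto simp: P_def)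
    also have "\<dots> = (\<integral>\<^sup>+c. emeasure lebesgue (P A c) \<partial>count_space C)"
      using Psets[OF A(1)] C
        by (intro emeasure_UN_countable) (auto simp: disjoint_family_on_def P_def)
    also have "\<dots> = (\<integral>\<^sup>+c. emeasure lebesgue ((+) c ` P A c) \<partial>count_space C)"
      by (simp only: emeasure_lebesgue_translation)
    also have "\<dots> = emeasure lebesgue (\<Union>c\<in>C. (+) c ` P A c)"
    proof (rule emeasure_UN_countable[symmetric])
      show "disjoint_family_on (\<lambda>c. (+) c ` P A c) C"
        unfolding disjoint_family_on_def
      proof (intro ballI impI, rule ccontr)
        fix c d assume "c \<noteq> d" "(+) c ` P A c \<inter> (+) d ` P A d \<noteq> {}"
        then obtain x y where xy: "x \<in> P A c" "y \<in> P A d" "c + x = d + y" by auto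
        then have "\<Psi> x = \<Psi> y" "x \<in> G" "y \<in> G" unfolding P_def by (auto simp: add.commute)
        then have "x = y" using bij by (auto simp: bij_betw_def dest: inj_onD)
        then show False using xy(3) \<open>c \<noteq> d\<close> by simp
      qed
    qed (use C Psets[OF A(1)] in \<open>auto intro: lebesgue_sets_translation\<close>)
    also have "\<dots> = emeasure (lebesgue_on G) A"
      using AU A G by (subst emeasure_restrict_space) auto
    finally show "emeasure (distr (lebesgue_on G) (lebesgue_on G) \<Psi>) A =
      emeasure (lebesgue_on G) A" .
  qed simp
  then show "integral\<^sup>L (lebesgue_on G) (\<lambda>x. g (\<Psi> x)) = integral\<^sup>L (lebesgue_on G) g"
    if "g \<in> borel_measurable (lebesgue_on G)"
    using integral_distr[OF m that] by simp
qed

lemma lebesgue_integral_translation: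
  fixes g :: "'a::euclidean_space \<Rightarrow> real"
  assumes "g \<in> borel_measurable lebesgue"
  shows "(\<integral>x. g (x + c) \<partial>lebesgue) = (\<integral>x. g x \<partial>lebesgue)"
proof -
  have "bij_betw (\<lambda>x. x + c) UNIV UNIV" by (rule bij_betw_byWitness[of _ "\<lambda>x. x - c"]) auto
  then show ?thesis
    using integral_piecewise_translation[of UNIV "\<lambda>x. x + c" "{c}" g] assms
    by (simp add: lebesgue_on_UNIV_eq)
qed

section \<open>First-order behaviour of the difference integral\<close>

locale difference_integral =
  fixes \<Omega> :: "'b::euclidean_space set" and h :: "'b \<Rightarrow> real" and L :: real
  assumes open_\<Omega>: "open \<Omega>" and bounded_\<Omega>: "bounded \<Omega>" and lip: "L-lipschitz_on UNIV h"
begin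

definition layer :: "real \<Rightarrow> 'b set" where
  "layer \<delta> = {x \<in> \<Omega>. \<not> ball x \<delta> \<subseteq> \<Omega>}"

definition D :: "'b \<Rightarrow> real" where
  "D u = (\<integral>x. h (x + u) - h x \<partial>lebesgue_on \<Omega>)"

text \<open>This says that \<open>D\<close> is o(\<epsilon>) on the ray of direction u, which makes
  sense without any differentiability of \<open>D\<close>.\<close>

definition null_direction :: "'b \<Rightarrow> bool" where
  "null_direction u \<longleftrightarrow> (\<forall>\<eta>>0. \<exists>\<delta>>0. \<forall>\<epsilon>. 0 < \<epsilon> \<longrightarrow> \<epsilon> < \<delta> \<longrightarrow> \<bar>D (\<epsilon> *\<^sub>R u)\<bar> \<le> \<eta> * \<epsilon>)"

lemma L_nonneg: "0 \<le> L" using lip by (rule lipschitz_on_nonneg)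

lemma h_lip: "\<bar>h x - h y\<bar> \<le> L * norm (x - y)"
  using lipschitz_onD[OF lip, of x y] by (simp add: dist_norm)

lemma h_cont: "continuous_on S h"
  using lipschitz_on_continuous_on[OF lip] continuous_on_subset by blast

lemma h_measurable: "(\<lambda>x. h (x + u)) \<in> borel_measurable lebesgue"
proof -
  have "continuous_on UNIV (\<lambda>x. h (x + u))"
    by (rule continuous_on_compose2[OF h_cont[of UNIV]]) (auto intro: continuous_intros)
  then have "(\<lambda>x. h (x + u)) \<in> borel_measurable borel" by (rule borel_measurable_continuous_onI)
  then show ?thesis by (intro measurable_completion) simp
qed

lemma h_measurable': "h \<in> borel_measurable lebesgue" using h_measurable[of 0] by simp

lemma \<Omega>_lmeasurable: "\<Omega> \<in> lmeasurable"
  using open_\<Omega> bounded_\<Omega> by (simp add: lmeasurable_open)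

sublocale fin: finite_measure "lebesgue_on \<Omega>"
  by (rule finite_measure_lebesgue_on[OF \<Omega>_lmeasurable])

lemma \<Omega>_sets: "\<Omega> \<in> sets lebesgue" using \<Omega>_lmeasurable by blast

lemma D_integrable: "integrable (lebesgue_on \<Omega>) (\<lambda>x. h (x + u) - h x)"
proof (rule fin.integrable_const_bound[of _ "L * norm u"])
  show "AE x in lebesgue_on \<Omega>. norm (h (x + u) - h x) \<le> L * norm u"
    using h_lip[of "x + u" x for x] by simp
  show "(\<lambda>x. h (x + u) - h x) \<in> borel_measurable (lebesgue_on \<Omega>)"
    using h_measurable h_measurable' by (intro borel_measurable_diff measurable_restrict_space1)
qed

lemma measure_lebesgue_on: "A \<subseteq> \<Omega> \<Longrightarrow> measure (lebesgue_on \<Omega>) A = measure lebesgue A"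
  using \<Omega>_sets by (simp add: measure_restrict_space)

text \<open>Averages are available only at \<epsilon> = 1/N; this bound carries them over to all
  small \<epsilon>.\<close>

lemma D_lipschitz: "\<bar>D u - D w\<bar> \<le> L * measure lebesgue \<Omega> * norm (u - w)"
proof -
  have "D u - D w = (\<integral>x. (h (x + u) - h x) - (h (x + w) - h x) \<partial>lebesgue_on \<Omega>)"
    unfolding D_def by (intro Bochner_Integration.integral_diff[symmetric] D_integrable)
  also have "\<bar>\<dots>\<bar> \<le> (\<integral>x. L * norm (u - w) \<partial>lebesgue_on \<Omega>)"
  proof (rule order_trans[OF integral_abs_bound], rule integral_mono)
    show "integrable (lebesgue_on \<Omega>) (\<lambda>x. \<bar>h (x + u) - h x - (h (x + w) - h x)\<bar>)"
      by (intro integrable_abs Bochner_Integration.integrable_diff D_integrable)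
    show "\<bar>h (x + u) - h x - (h (x + w) - h x)\<bar> \<le> L * norm (u - w)" for x
      using h_lip[of "x + u" "x + w"] by simp
  qed simp
  also have "\<dots> = L * measure lebesgue \<Omega> * norm (u - w)" by (simp add: measure_lebesgue_on)
  finally show ?thesis .
qed

lemma layer_subset: "layer \<delta> \<subseteq> \<Omega>" unfolding layer_def by blast

lemma layer_open: "open (layer \<delta>)"
proof -
  have "layer \<delta> = \<Omega> \<inter> (\<Union>y\<in>-\<Omega>. ball y \<delta>)" unfolding layer_def by (auto simp: dist_commute)
  then show ?thesis using open_\<Omega> by auto
qed

lemma layer_lmeasurable: "layer \<delta> \<in> lmeasurable"
  using layer_open bounded_subset[OF bounded_\<Omega> layer_subset] by (simp add: lmeasurable_open)

lemma layer_mono: "\<delta> \<le> \<epsilon> \<Longrightarrow> layer \<delta> \<subseteq> layer \<epsilon>"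
  unfolding layer_def using subset_ball by blast

text \<open>The layers decrease to the empty set because \<open>\<Omega>\<close> is open, and their
  measures are finite.\<close>

lemma layer_small:
  assumes "\<eta> > 0" obtains \<delta> where "\<delta> > 0" "measure lebesgue (layer \<delta>) < \<eta>"
proof -
  let ?A = "\<lambda>k::nat. layer (inverse (real (Suc k)))"
  have "(\<lambda>k. measure lebesgue (?A k)) \<longlonglongrightarrow> measure lebesgue (\<Inter>k. ?A k)"
  proof (rule Lim_measure_decseq)
    show "range ?A \<subseteq> sets lebesgue" using layer_lmeasurable by auto
    show "decseq ?A" by (intro decseq_SucI layer_mono) (simp add: le_imp_inverse_le)
    show "emeasure lebesgue (?A k) \<noteq> \<infinity>" for k using fmeasurableD2[OF layer_lmeasurable]
      by (simp add: infinity_ennreal_def)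
  qed
  moreover have "(\<Inter>k. ?A k) = {}"
  proof (rule ccontr)
    assume "(\<Inter>k. ?A k) \<noteq> {}"
    then obtain x where x: "\<And>k. x \<in> ?A k" by blast
    then have "x \<in> \<Omega>" using layer_subset by blast
    then obtain e where e: "e > 0" "ball x e \<subseteq> \<Omega>" using open_\<Omega> by (meson open_contains_ball)
    obtain k where "inverse (real (Suc k)) < e" using reals_Archimedean[OF e(1)] by auto
    then have "ball x (inverse (real (Suc k))) \<subseteq> \<Omega>" using e(2) subset_ball
      by (meson less_imp_le order_trans)
    then show False using x[of k] unfolding layer_def by blast
  qed
  ultimately have "(\<lambda>k. measure lebesgue (?A k)) \<longlonglongrightarrow> 0" by simp
  then have "\<forall>\<^sub>F k in sequentially. measure lebesgue (?A k) < \<eta>" using assms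
    by (rule order_tendstoD)
  then obtain k where "measure lebesgue (?A k) < \<eta>" using eventually_happens'[OF sequentially_bot]
    by metis
  then show thesis by (intro that[of "inverse (real (Suc k))"]) auto
qed

text \<open>The defect is the integral over \<open>\<Omega>\<close> of k(x + u) - k(x), where k is
  the increment of \<open>h\<close> by w, of size at most L times the norm of w. After a change of
  variable it compares the integrals of k over \<open>\<Omega>\<close> and over its translate by u.
  These sets differ only within the layer and its translate. Only u has to be small.\<close>

lemma D_additive:
  assumes "norm u < \<delta>"
  shows "\<bar>D (u + w) - D u - D w\<bar> \<le> 2 * L * norm w * measure lebesgue (layer \<delta>)"
proof -
  define k where "k x = h (x + w) - h x" for x
  define i where "i = (indicator \<Omega> :: 'b \<Rightarrow> real)"
  have k: "\<bar>k x\<bar> \<le> L * norm w" for x unfolding k_def using h_lip[of "x + w" x] by simp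
  have km: "(\<lambda>x. k (x + c)) \<in> borel_measurable lebesgue" for c
    unfolding k_def using h_measurable[of "c + w"] h_measurable[of c]
      by (intro borel_measurable_diff) (auto simp: add.assoc)
  have im': "(\<lambda>x. i (x - c)) \<in> borel_measurable lebesgue" for c
  proof -
    have "(\<lambda>x. i (x - c)) = indicator ((+) c ` \<Omega>)"
      by (auto simp: i_def indicator_def fun_eq_iff image_iff algebra_simps intro: exI[of _ "_ -
        c"])
    then show ?thesis using lebesgue_sets_translation[OF \<Omega>_sets] by simp
  qed
  have ki: "integrable (lebesgue_on \<Omega>) (\<lambda>x. k (x + c))" for c
    by (rule fin.integrable_const_bound[of _ "L * norm w"]) (use k km in \<open>auto intro: measurable_restrict_space1\<close>)
  have ii: "integrable lebesgue (\<lambda>x. i x * k (x + c))" for c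
    using integrable_restrict_space[of \<Omega> lebesgue "\<lambda>x. k (x + c)"] ki[of c] \<Omega>_sets
      by (simp add: i_def)
  have ie: "(\<integral>x. k (x + c) \<partial>lebesgue_on \<Omega>) = (\<integral>x. i x * k (x + c) \<partial>lebesgue)" for c
    using integral_restrict_space[of \<Omega> lebesgue "\<lambda>x. k (x + c)"] \<Omega>_sets by (simp add: i_def)
  have tr: "(\<integral>x. i x * k (x + u) \<partial>lebesgue) = (\<integral>x. i (x - u) * k x \<partial>lebesgue)"
    using lebesgue_integral_translation[of "\<lambda>x. i (x - u) * k x" u] im' km[of 0] by simp
  have "D (u + w) - D u - D w = (\<integral>x. (h (x + (u + w)) - h x) - (h (x + u) - h x) - (h (x + w) -
    h x) \<partial>lebesgue_on \<Omega>)"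
  proof -
    have "(\<integral>x. a x \<partial>m) - (\<integral>x. b x \<partial>m) - (\<integral>x. c x \<partial>m) = (\<integral>x. a x - b x - c x \<partial>m)"
      if "integrable m a" "integrable m b" "integrable m c" for m and a b c :: "'b \<Rightarrow> real"
      using that by simp
    from this[OF D_integrable D_integrable D_integrable] show ?thesis unfolding D_def .
  qed
  also have "\<dots> = (\<integral>x. k (x + u) - k (x + 0) \<partial>lebesgue_on \<Omega>)"
    unfolding k_def by (intro Bochner_Integration.integral_cong) (auto simp: add.assoc)
  also have "\<dots> = (\<integral>x. k (x + u) \<partial>lebesgue_on \<Omega>) - (\<integral>x. k (x + 0) \<partial>lebesgue_on \<Omega>)"
    by (intro Bochner_Integration.integral_diff ki)
  also have "\<dots> = (\<integral>x. i (x - u) * k x \<partial>lebesgue) - (\<integral>x. i x * k x \<partial>lebesgue)"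
    unfolding ie tr by simp
  finally have eq: "D (u + w) - D u - D w = (\<integral>x. i (x - u) * k x \<partial>lebesgue) -
    (\<integral>x. i x * k x \<partial>lebesgue)" .
  define A where "A = layer \<delta> \<union> (+) u ` layer \<delta>"
  have A: "A \<in> lmeasurable" unfolding A_def
    by (intro fmeasurable.Un layer_lmeasurable measurable_translation)
  have mA: "measure lebesgue A \<le> 2 * measure lebesgue (layer \<delta>)"
    using measure_Un_le[of "layer \<delta>" lebesgue "(+) u ` layer \<delta>"] layer_lmeasurable measurable_translation[OF layer_lmeasurable]
    by (auto simp: A_def measure_translation fmeasurableD)
  have pt: "\<bar>i (x - u) * k x - i x * k x\<bar> \<le> indicator A x * (L * norm w)" for x
  proof (cases "x \<in> A")
    case True
    then show ?thesis using k[of x] by (auto simp: i_def indicator_def)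
  next
    case False
    have "x \<in> \<Omega> \<longleftrightarrow> x - u \<in> \<Omega>"
    proof
      assume x: "x \<in> \<Omega>"
      have "x - u \<in> ball x \<delta>" using assms by (simp add: dist_norm)
      then show "x - u \<in> \<Omega>" using x False unfolding A_def layer_def by blast
    next
      assume xu: "x - u \<in> \<Omega>"
      have "x \<in> ball (x - u) \<delta>" using assms by (simp add: dist_norm)
      moreover have "x - u \<notin> layer \<delta>"
      proof
        assume "x - u \<in> layer \<delta>"
        moreover have "x = u + (x - u)" by simp
        ultimately show False using False unfolding A_def by blast
      qed
      ultimately show "x \<in> \<Omega>" using xu unfolding layer_def by blast
    qed
    then show ?thesis using False by (simp add: i_def indicator_def)
  qed
  have ind: "integrable lebesgue (\<lambda>x. indicator A x * (L * norm w))"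
    using A by (intro integrable_mult_left) (simp add: lmeasurable_iff_integrable)
  have j: "integrable lebesgue (\<lambda>x. i (x - u) * k x)"
  proof -
    have "integrable lebesgue (\<lambda>x. (indicator A x + i x) * (L * norm w))"
      using A \<Omega>_lmeasurable
        by (intro integrable_mult_left Bochner_Integration.integrable_add) (auto simp: lmeasurable_iff_integrable i_def)
    then show ?thesis
    proof (rule Bochner_Integration.integrable_bound)
      show "(\<lambda>x. i (x - u) * k x) \<in> borel_measurable lebesgue" using im' km[of 0] by simp
      show "AE x in lebesgue. norm (i (x - u) * k x) \<le> norm ((indicator A x + i x) * (L * norm w))"
      proof (rule AE_I2)
        fix x
        have "\<bar>i x * k x\<bar> \<le> i x * (L * norm w)" using k[of x] by (auto simp: i_def indicator_def)
        then have "\<bar>i (x - u) * k x\<bar> \<le> (indicator A x + i x) * (L * norm w)" using pt[of x]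
          by (simp add: distrib_right)
        also have "\<dots> \<le> norm ((indicator A x + i x) * (L * norm w))" by simp
        finally show "norm (i (x - u) * k x) \<le> norm ((indicator A x + i x) * (L * norm w))" by simp
      qed
    qed
  qed
  have ii0: "integrable lebesgue (\<lambda>x. i x * k x)" using ii[of 0] by simp
  have "\<bar>D (u + w) - D u - D w\<bar> = \<bar>\<integral>x. i (x - u) * k x - i x * k x \<partial>lebesgue\<bar>"
    unfolding eq using j ii0 by simp
  also have "\<dots> \<le> (\<integral>x. \<bar>i (x - u) * k x - i x * k x\<bar> \<partial>lebesgue)" by (rule integral_abs_bound)
  also have "\<dots> \<le> (\<integral>x. indicator A x * (L * norm w) \<partial>lebesgue)"
    by (rule integral_mono[OF _ ind pt]) (intro integrable_abs Bochner_Integration.integrable_diff j ii0)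
  also have "\<dots> = L * norm w * measure lebesgue A" using A by simp
  also have "\<dots> \<le> L * norm w * (2 * measure lebesgue (layer \<delta>))"
    using mA L_nonneg by (intro mult_left_mono) auto
  finally show ?thesis by simp
qed

lemma D_zero: "D 0 = 0" unfolding D_def by simp

lemma D_additive_small:
  assumes "\<eta> > 0"
  obtains \<delta>
    where "\<delta> > 0" "\<And>\<epsilon>. 0 < \<epsilon> \<Longrightarrow> \<epsilon> < \<delta> \<Longrightarrow> \<bar>D (\<epsilon> *\<^sub>R (u + w)) - D (\<epsilon> *\<^sub>R u) - D (\<epsilon> *\<^sub>R w)\<bar> \<le> \<eta> * \<epsilon>"
proof -
  let ?K = "2 * L * norm w + 1"
  have K: "?K > 0" using L_nonneg by (simp add: add_nonneg_pos)
  obtain d where d: "d > 0" "measure lebesgue (layer d) < \<eta> / ?K"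
    using layer_small[of "\<eta> / ?K"] assms K by auto
  have u: "norm u + 1 > 0" by (simp add: add_nonneg_pos)
  show thesis
  proof (rule that)
    show "d / (norm u + 1) > 0" using d u by simp
    fix \<epsilon> assume e: "0 < \<epsilon>" "\<epsilon> < d / (norm u + 1)"
    have "norm (\<epsilon> *\<^sub>R u) < d" using e u by (intro norm_scaleR_less) (simp add: pos_less_divide_eq)
    then have "\<bar>D (\<epsilon> *\<^sub>R u + \<epsilon> *\<^sub>R w) - D (\<epsilon> *\<^sub>R u) - D (\<epsilon> *\<^sub>R w)\<bar> \<le>
      2 * L * norm (\<epsilon> *\<^sub>R w) * measure lebesgue (layer d)"
      by (rule D_additive)
    also have "\<dots> = \<epsilon> * (2 * L * norm w * measure lebesgue (layer d))" using e by simp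
    also have "\<dots> \<le> \<epsilon> * (?K * (\<eta> / ?K))" using e d(2) L_nonneg
      by (intro mult_left_mono mult_mono) auto
    also have "\<dots> = \<eta> * \<epsilon>" using K by simp
    finally show "\<bar>D (\<epsilon> *\<^sub>R (u + w)) - D (\<epsilon> *\<^sub>R u) - D (\<epsilon> *\<^sub>R w)\<bar> \<le> \<eta> * \<epsilon>"
      by (simp add: scaleR_add_right)
  qed
qed

lemma null_direction_add:
  assumes "null_direction u" "null_direction w" shows "null_direction (u + w)"
  unfolding null_direction_def
proof (intro allI impI)
  fix \<eta> :: real assume "\<eta> > 0"
  then have \<eta>: "\<eta> / 3 > 0" by simp
  obtain d1 where d1: "d1 > 0" "\<And>\<epsilon>. 0 < \<epsilon> \<Longrightarrow> \<epsilon> < d1 \<Longrightarrow> \<bar>D (\<epsilon> *\<^sub>R u)\<bar> \<le> \<eta> / 3 * \<epsilon>"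
    using assms(1) \<eta> unfolding null_direction_def by blast
  obtain d2 where d2: "d2 > 0" "\<And>\<epsilon>. 0 < \<epsilon> \<Longrightarrow> \<epsilon> < d2 \<Longrightarrow> \<bar>D (\<epsilon> *\<^sub>R w)\<bar> \<le> \<eta> / 3 * \<epsilon>"
    using assms(2) \<eta> unfolding null_direction_def by blast
  obtain d3
    where d3: "d3 > 0"
    "\<And>\<epsilon>. 0 < \<epsilon> \<Longrightarrow> \<epsilon> < d3 \<Longrightarrow> \<bar>D (\<epsilon> *\<^sub>R (u + w)) - D (\<epsilon> *\<^sub>R u) - D (\<epsilon> *\<^sub>R w)\<bar> \<le> \<eta> / 3 * \<epsilon>"
    using D_additive_small[OF \<eta>] by blast
  have "\<bar>D (\<epsilon> *\<^sub>R (u + w))\<bar> \<le> \<eta> * \<epsilon>" if "0 < \<epsilon>" "\<epsilon> < min d1 (min d2 d3)" for \<epsilon>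
  proof -
    have "\<bar>d\<bar> \<le> 3 * x" if "\<bar>a\<bar> \<le> x" "\<bar>b\<bar> \<le> x" "\<bar>d - a - b\<bar> \<le> x" for a b d x :: real
      using that by linarith
    from this[of "D (\<epsilon> *\<^sub>R u)" "\<eta> / 3 * \<epsilon>" "D (\<epsilon> *\<^sub>R w)"] show ?thesis
      using d1(2)[of \<epsilon>] d2(2)[of \<epsilon>] d3(2)[of \<epsilon>] that by simp
  qed
  then show "\<exists>\<delta>>0. \<forall>\<epsilon>. 0 < \<epsilon> \<longrightarrow> \<epsilon> < \<delta> \<longrightarrow> \<bar>D (\<epsilon> *\<^sub>R (u + w))\<bar> \<le> \<eta> * \<epsilon>"
    using d1 d2 d3 by (intro exI[of _ "min d1 (min d2 d3)"]) auto
qed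

text \<open>Additivity applied to u and -u, whose sum contributes \<open>D 0 = 0\<close>.\<close>

lemma null_direction_minus:
  assumes "null_direction u" shows "null_direction (- u)"
  unfolding null_direction_def
proof (intro allI impI)
  fix \<eta> :: real assume "\<eta> > 0"
  then have \<eta>: "\<eta> / 2 > 0" by simp
  obtain d1 where d1: "d1 > 0" "\<And>\<epsilon>. 0 < \<epsilon> \<Longrightarrow> \<epsilon> < d1 \<Longrightarrow> \<bar>D (\<epsilon> *\<^sub>R u)\<bar> \<le> \<eta> / 2 * \<epsilon>"
    using assms(1) \<eta> unfolding null_direction_def by blast
  obtain d3
    where d3: "d3 > 0"
    "\<And>\<epsilon>. 0 < \<epsilon> \<Longrightarrow> \<epsilon> < d3 \<Longrightarrow> \<bar>D (\<epsilon> *\<^sub>R (u + - u)) - D (\<epsilon> *\<^sub>R u) - D (\<epsilon> *\<^sub>R - u)\<bar> \<le> \<eta> / 2 * \<epsilon>"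
    using D_additive_small[OF \<eta>] by blast
  have "\<bar>D (\<epsilon> *\<^sub>R - u)\<bar> \<le> \<eta> * \<epsilon>" if "0 < \<epsilon>" "\<epsilon> < min d1 d3" for \<epsilon>
  proof -
    have "\<bar>b\<bar> \<le> 2 * x" if "\<bar>a\<bar> \<le> x" "\<bar>0 - a - b\<bar> \<le> x" for a b x :: real
      using that by linarith
    from this[of "D (\<epsilon> *\<^sub>R u)" "\<eta> / 2 * \<epsilon>"] show ?thesis using d1(2)[of \<epsilon>] d3(2)[of \<epsilon>] that
      by (simp add: D_zero)
  qed
  then show "\<exists>\<delta>>0. \<forall>\<epsilon>. 0 < \<epsilon> \<longrightarrow> \<epsilon> < \<delta> \<longrightarrow> \<bar>D (\<epsilon> *\<^sub>R - u)\<bar> \<le> \<eta> * \<epsilon>"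
    using d1 d3 by (intro exI[of _ "min d1 d3"]) auto
qed

text \<open>A positive factor is absorbed by rescaling \<epsilon>. As \<epsilon> is restricted to
  positive values, a negative factor needs \<open>null_direction_minus\<close>.\<close>

lemma null_direction_scaleR:
  assumes "null_direction u" shows "null_direction (c *\<^sub>R u)"
proof -
  have pos: "null_direction (c *\<^sub>R u)" if c: "c > 0" "null_direction u" for c u
    unfolding null_direction_def
  proof (intro allI impI)
    fix \<eta> :: real assume "\<eta> > 0"
    then have "\<eta> / c > 0" using c by simp
    then obtain d where d: "d > 0" "\<And>\<epsilon>. 0 < \<epsilon> \<Longrightarrow> \<epsilon> < d \<Longrightarrow> \<bar>D (\<epsilon> *\<^sub>R u)\<bar> \<le> \<eta> / c * \<epsilon>"
      using c(2) unfolding null_direction_def by blast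
    have "\<bar>D (\<epsilon> *\<^sub>R c *\<^sub>R u)\<bar> \<le> \<eta> * \<epsilon>" if "0 < \<epsilon>" "\<epsilon> < d / c" for \<epsilon>
      using d(2)[of "\<epsilon> * c"] that \<open>c > 0\<close> by (simp add: field_simps)
    then show "\<exists>\<delta>>0. \<forall>\<epsilon>. 0 < \<epsilon> \<longrightarrow> \<epsilon> < \<delta> \<longrightarrow> \<bar>D (\<epsilon> *\<^sub>R c *\<^sub>R u)\<bar> \<le> \<eta> * \<epsilon>"
      using d(1) c(1) by (intro exI[of _ "d / c"]) auto
  qed
  consider "c > 0" | "c = 0" | "c < 0" by linarith
  then show ?thesis
  proof cases
    case 2
    have "\<forall>\<eta>>0. \<exists>\<delta>>0. \<forall>\<epsilon>. 0 < \<epsilon> \<longrightarrow> \<epsilon> < \<delta> \<longrightarrow> 0 \<le> \<eta> * (\<epsilon>::real)" by (auto intro!: exI[of _ "1::real"])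
    then show ?thesis using 2 by (simp add: null_direction_def D_zero)
  next
    case 3
    then show ?thesis using null_direction_minus[OF pos[of "-c" u]] assms by simp
  qed (use pos assms in blast)
qed

end

section \<open>Lipschitz interpolation along the boundary\<close>

text \<open>Sets of pairs (position, value) stand for pieces of the graph of the interpolating
  function, so the pieces can be compared before it is known that they form one function.\<close>

definition graph_lipschitz :: "('b::metric_space \<times> real) set \<Rightarrow> ('b \<times> real) set \<Rightarrow> bool" where
  "graph_lipschitz A B \<longleftrightarrow> (\<exists>L\<ge>0. \<forall>a\<in>A. \<forall>b\<in>B. \<bar>snd a - snd b\<bar> \<le> L * dist (fst a) (fst b))"

lemma graph_lipschitz_sym: "graph_lipschitz A B \<Longrightarrow> graph_lipschitz B A"
  unfolding graph_lipschitz_def by (metis abs_minus_commute dist_commute)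

lemma segment_Pair_eq:
  "closed_segment (w, p) (w', p') = (\<lambda>s. (w + s *\<^sub>R (w' - w), p + s * (p' - p))) ` {0..1}"
  unfolding closed_segment_def by (auto simp: algebra_simps image_iff)

text \<open>The difference quotient is continuous on the compact product, because its denominator
  never vanishes.\<close>

lemma graph_lipschitz_disjoint:
  fixes A B :: "('b::metric_space \<times> real) set"
  assumes "compact A" "compact B" "fst ` A \<inter> fst ` B = {}"
  shows "graph_lipschitz A B"
proof -
  let ?r = "\<lambda>x::('b \<times> real) \<times> ('b \<times> real). \<bar>snd (fst x) -
    snd (snd x)\<bar> / dist (fst (fst x)) (fst (snd x))"
  have ne: "fst a \<noteq> fst b" if "a \<in> A" "b \<in> B" for a b using assms(3) that by blast
  have "compact (?r ` (A \<times> B))"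
    using assms(1,2) ne by (intro compact_continuous_image compact_Times continuous_intros) auto
  then have "bounded (?r ` (A \<times> B))" by (rule compact_imp_bounded)
  then have "\<exists>L. \<forall>y \<in> ?r ` (A \<times> B). norm y \<le> L" by (simp only: bounded_iff)
  then obtain L where "\<forall>y \<in> ?r ` (A \<times> B). norm y \<le> L" ..
  then have L: "norm (?r x) \<le> L" if "x \<in> A \<times> B" for x using that by (rule_tac bspec) auto
  have "\<bar>snd a - snd b\<bar> \<le> max L 0 * dist (fst a) (fst b)" if "a \<in> A" "b \<in> B" for a b
  proof -
    have "\<bar>snd a - snd b\<bar> / dist (fst a) (fst b) \<le> L" using L[of "(a, b)"] that by simp
    then have "\<bar>snd a - snd b\<bar> \<le> L * dist (fst a) (fst b)" using ne[OF that]
      by (simp add: field_simps)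
    also have "\<dots> \<le> max L 0 * dist (fst a) (fst b)" by (intro mult_right_mono) auto
    finally show ?thesis .
  qed
  then show ?thesis unfolding graph_lipschitz_def by (intro exI[of _ "max L 0"]) auto
qed

lemma graph_lipschitz_segment:
  fixes w w' :: "'b::real_normed_vector"
  assumes "w \<noteq> w'" shows "graph_lipschitz (closed_segment (w, p) (w', p')) (closed_segment (w, p) (w', p'))"
  unfolding graph_lipschitz_def
proof (intro exI[of _ "\<bar>p' - p\<bar> / norm (w' - w)"] conjI ballI)
  fix a b assume "a \<in> closed_segment (w, p) (w', p')" "b \<in> closed_segment (w, p) (w', p')"
  then obtain s t
    where "a = (w + s *\<^sub>R (w' - w), p + s * (p' - p))" "b = (w + t *\<^sub>R (w' - w), p + t * (p' - p))"
    unfolding segment_Pair_eq by blast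
  then have "\<bar>snd a - snd b\<bar> = \<bar>s - t\<bar> * \<bar>p' - p\<bar>" "dist (fst a) (fst b) = \<bar>s - t\<bar> * norm (w' - w)"
    by (auto simp: dist_norm left_diff_distrib[symmetric] scaleR_left_diff_distrib[symmetric] abs_mult)
  then show "\<bar>snd a - snd b\<bar> \<le> \<bar>p' - p\<bar> / norm (w' - w) * dist (fst a) (fst b)" using assms by simp
qed auto

text \<open>At a corner the distance between points at parameters s and t on the two sides is at
  least c (s + t). By homogeneity it suffices to minimise over s + t = 1, and the minimum c is
  positive because the sides meet only at w.\<close>

lemma graph_lipschitz_corner:
  fixes w :: "'b::real_normed_vector"
  assumes ne: "w \<noteq> w1" "w \<noteq> w2" and int: "closed_segment w w1 \<inter> closed_segment w w2 = {w}"
  shows "graph_lipschitz (closed_segment (w, p) (w1, p1)) (closed_segment (w, p) (w2, p2))"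
proof -
  let ?a = "w1 - w" and ?b = "w2 - w"
  let ?N = "\<lambda>s. norm (s *\<^sub>R ?a - (1 - s) *\<^sub>R ?b)"
  obtain s0 where s0: "s0 \<in> {0..1}" "\<And>s. s \<in> {0..1::real} \<Longrightarrow> ?N s0 \<le> ?N s"
  proof -
    have "continuous_on {0..1} ?N" by (intro continuous_intros)
    then have "\<exists>s0\<in>{0..1}. \<forall>s\<in>{0..1}. ?N s0 \<le> ?N s" by (intro continuous_attains_inf) auto
    then show thesis using that by blast
  qed
  define c where "c = ?N s0"
  have "c > 0"
  proof (rule ccontr)
    assume "\<not> c > 0"
    then have eq: "s0 *\<^sub>R ?a = (1 - s0) *\<^sub>R ?b" by (simp add: c_def)
    have "w + s0 *\<^sub>R ?a \<in> closed_segment w w1" using s0(1) unfolding closed_segment_def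
      by (auto simp: algebra_simps intro!: exI[of _ s0])
    moreover have "w + (1 - s0) *\<^sub>R ?b \<in> closed_segment w w2" using s0(1)
      unfolding closed_segment_def
      by (auto simp: algebra_simps intro!: exI[of _ "1 - s0"])
    ultimately have "w + s0 *\<^sub>R ?a \<in> closed_segment w w1 \<inter> closed_segment w w2" unfolding eq
      by (rule IntI)
    then have "s0 *\<^sub>R ?a = 0" unfolding int by simp
    then have "s0 = 0" using ne by simp
    then show False using eq ne by simp
  qed
  show ?thesis unfolding graph_lipschitz_def
  proof (intro exI[of _ "(\<bar>p1 - p\<bar> + \<bar>p2 - p\<bar>) / c"] conjI ballI)
    fix x y assume "x \<in> closed_segment (w, p) (w1, p1)" "y \<in> closed_segment (w, p) (w2, p2)"
    then obtain s t where st: "s \<in> {0..1}" "t \<in> {0..1}"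
      and xy: "x = (w + s *\<^sub>R ?a, p + s * (p1 - p))" "y = (w + t *\<^sub>R ?b, p + t * (p2 - p))"
      unfolding segment_Pair_eq by blast
    have "c * (s + t) \<le> norm (s *\<^sub>R ?a - t *\<^sub>R ?b)"
    proof (cases "s + t = 0")
      case False
      then have pos: "s + t > 0" using st by auto
      have "s / (s + t) \<in> {0..1}" using st pos by (auto simp: field_simps)
      then have "c \<le> ?N (s / (s + t))" unfolding c_def by (rule s0(2))
      then have "c * (s + t) \<le> (s + t) * ?N (s / (s + t))" using pos by (simp add: mult.commute)
      also have "\<dots> = norm ((s + t) *\<^sub>R ((s / (s + t)) *\<^sub>R ?a - (1 - s / (s + t)) *\<^sub>R ?b))" using pos
        by simp
      also have "(s + t) *\<^sub>R ((s / (s + t)) *\<^sub>R ?a - (1 - s / (s + t)) *\<^sub>R ?b) = s *\<^sub>R ?a -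
        t *\<^sub>R ?b"
      proof -
        have "(s + t) * (s / (s + t)) = s" "(s + t) * (1 - s / (s + t)) = t" using pos
          by (auto simp: field_simps)
        then show ?thesis by (simp only: scaleR_right_diff_distrib scaleR_scaleR)
      qed
      finally show ?thesis .
    qed simp
    then have le: "s + t \<le> norm (s *\<^sub>R ?a - t *\<^sub>R ?b) / c" using \<open>c > 0\<close> by (simp add: field_simps)
    have "\<bar>snd x - snd y\<bar> = \<bar>s * (p1 - p) - t * (p2 - p)\<bar>" by (simp add: xy)
    also have "\<dots> \<le> s * \<bar>p1 - p\<bar> + t * \<bar>p2 - p\<bar>"
      using st abs_triangle_ineq4[of "s * (p1 - p)" "t * (p2 - p)"] by (simp add: abs_mult)
    also have "\<dots> \<le> (\<bar>p1 - p\<bar> + \<bar>p2 - p\<bar>) * (s + t)" using st by (simp add: algebra_simps)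
    also have "\<dots> \<le> (\<bar>p1 - p\<bar> + \<bar>p2 - p\<bar>) * (norm (s *\<^sub>R ?a - t *\<^sub>R ?b) / c)" using le
      by (intro mult_left_mono) auto
    also have "norm (s *\<^sub>R ?a - t *\<^sub>R ?b) = dist (fst x) (fst y)" by (simp add: xy dist_norm)
    finally show "\<bar>snd x - snd y\<bar> \<le> (\<bar>p1 - p\<bar> + \<bar>p2 - p\<bar>) / c * dist (fst x) (fst y)" by simp
  qed (use \<open>c > 0\<close> in auto)
qed

context convex_pattern
begin

text \<open>Two edges coincide, share exactly one vertex, or are disjoint; with at least three
  vertices they cannot share both ends.\<close>

lemma edge_graphs_lipschitz:
  assumes "i < n" "j < n"
  shows "graph_lipschitz (closed_segment (v i, f (v i)) (v (Suc i), f (v (Suc i))))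
     (closed_segment (v j, f (v j)) (v (Suc j), f (v (Suc j))))" (is "graph_lipschitz (?S i) (?S j)")
proof -
  have consecutive: "graph_lipschitz (?S i) (?S j)" if ij: "i < n" "j < n" "i \<noteq> j" "v (Suc i) = v j"
    for i j
  proof -
    have "v i \<noteq> v j" using ij by (simp add: vertex_eq_iff)
    moreover have "v i \<noteq> v (Suc j)" using no_two_cycle[OF ij(1,2)] ij(4) by metis
    ultimately have "edge vs i \<inter> edge vs j = {v j}" using edge_inter[OF ij(1-3)] ij(4) by auto
    then have "closed_segment (v j) (v i) \<inter> closed_segment (v j) (v (Suc j)) = {v j}"
      unfolding edge_def ij(4) by (simp add: closed_segment_commute)
    then have "graph_lipschitz (closed_segment (v j, f (v j)) (v i, f (v i))) (?S j)"
      using \<open>v i \<noteq> v j\<close> edge_nondegenerate[OF ij(2)] by (intro graph_lipschitz_corner) auto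
    then show ?thesis unfolding ij(4) by (simp add: closed_segment_commute)
  qed
  consider "i = j" | "i \<noteq> j" "v (Suc i) = v j" | "i \<noteq> j" "v (Suc j) = v i" | "i \<noteq> j"
    "v (Suc i) \<noteq> v j" "v (Suc j) \<noteq> v i" by blast
  then show ?thesis
  proof cases
    case 1 then show ?thesis using edge_nondegenerate assms by (simp add: graph_lipschitz_segment)
  next
    case 2 then show ?thesis using consecutive assms by blast
  next
    case 3 then show ?thesis using consecutive[of j i] graph_lipschitz_sym assms by metis
  next
    case 4
    have "v i \<noteq> v j" using 4(1) assms by (simp add: vertex_eq_iff)
    moreover have "v (Suc i) \<noteq> v (Suc j)"
    proof
      assume "v (Suc i) = v (Suc j)"
      then have "Suc i mod n = Suc j mod n" by (simp add: vertex_eq_iff)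
      then show False using 4(1) assms by (cases "Suc i = n"; cases "Suc j = n") auto
    qed
    ultimately have "edge vs i \<inter> edge vs j = {}" using edge_inter[OF assms 4(1)] 4 by auto
    moreover have "fst ` ?S k = edge vs k" for k unfolding edge_eq segment_Pair_eq
      by (simp add: image_image)
    ultimately show ?thesis by (intro graph_lipschitz_disjoint) auto
  qed
qed

text \<open>By additivity the values of \<open>f\<close> at glued ends of edge i and of its partner
  differ by \<open>f (\<tau> i)\<close> at both ends. Hence so do the affine interpolations in
  between, although \<open>f\<close> itself need not be affine along an edge.\<close>

lemma equivariant_lipschitz:
  assumes add: "\<And>x y. f (x + y) = f x + (f y :: real)"
  obtains h L
    where "L-lipschitz_on UNIV h" "\<And>i x. i < n \<Longrightarrow> x \<in> edge vs i \<Longrightarrow> h (x + \<tau> i) = h x + f (\<tau> i)"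
proof -
  let ?S = "\<lambda>i. closed_segment (v i, f (v i)) (v (Suc i), f (v (Suc i)))"
  let ?P = "\<lambda>i j L. L \<ge> 0 \<and> (\<forall>a\<in>?S i. \<forall>b\<in>?S j. \<bar>snd a - snd b\<bar> \<le> L * dist (fst a) (fst b))"
  define K where "K i j = (SOME L. ?P i j L)" for i j
  have PK: "?P i j (K i j)" if "i < n" "j < n" for i j
    unfolding K_def
      by (rule someI_ex) (use edge_graphs_lipschitz[OF that, where f = f] in \<open>simp add: graph_lipschitz_def\<close>)
  have K: "\<And>i j. i < n \<Longrightarrow> j < n \<Longrightarrow> K i j \<ge> 0"
    "\<And>i j a b. i < n \<Longrightarrow> j < n \<Longrightarrow> a \<in> ?S i \<Longrightarrow> b \<in> ?S j \<Longrightarrow> \<bar>snd a - snd b\<bar> \<le> K i j * dist (fst a) (fst b)"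
    using PK by simp_all
  \<comment> \<open>The constants are nonnegative, so their sum bounds each of them.\<close>
  define L where "L = (\<Sum>i<n. \<Sum>j<n. K i j)"
  have KL: "K i j \<le> L" if "i < n" "j < n" for i j
  proof -
    have "K i j \<le> (\<Sum>j<n. K i j)" using that K(1) by (intro member_le_sum) auto
    also have "\<dots> \<le> L" unfolding L_def using that K(1)
      by (intro member_le_sum[of i _ "\<lambda>i. \<Sum>j<n. K i j"]) (auto intro: sum_nonneg)
    finally show ?thesis .
  qed
  have L0: "L \<ge> 0" using KL[OF n_pos n_pos] K(1)[OF n_pos n_pos] by simp
  obtain h where h: "L-lipschitz_on UNIV h" "\<And>a. a \<in> (\<Union>i<n. ?S i) \<Longrightarrow> h (fst a) = snd a"
  proof (rule lipschitz_extension_indexed[of "\<Union>i<n. ?S i" snd L fst])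
    fix a b assume "a \<in> (\<Union>i<n. ?S i)" "b \<in> (\<Union>i<n. ?S i)"
    then obtain i j where ij: "i < n" "j < n" "a \<in> ?S i" "b \<in> ?S j" by blast
    have "\<bar>snd a - snd b\<bar> \<le> K i j * dist (fst a) (fst b)" using K(2) ij by blast
    also have "\<dots> \<le> L * dist (fst a) (fst b)" using KL ij by (intro mult_right_mono) auto
    finally show "\<bar>snd a - snd b\<bar> \<le> L * dist (fst a) (fst b)" .
  next
    show "(\<Union>i<n. ?S i) \<noteq> {}" using n_pos by auto
  qed (use L0 in auto)
  have hs: "h (v i + s *\<^sub>R (v (Suc i) - v i)) = f (v i) + s * (f (v (Suc i)) - f (v i))"
    if "i < n" "s \<in> {0..1}" for i s
  proof -
    have "(v i + s *\<^sub>R (v (Suc i) - v i), f (v i) + s * (f (v (Suc i)) - f (v i))) \<in> ?S i"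
      unfolding segment_Pair_eq using that by blast
    then show ?thesis
      using h(2)[of "(v i + s *\<^sub>R (v (Suc i) - v i), f (v i) + s * (f (v (Suc i)) - f (v i)))"] that
      by auto
  qed
  have diff: "f (x - y) = f x - f y" for x y using add[of "x - y" y] by simp
  show thesis
  proof (rule that[OF h(1)])
    fix i x assume i: "i < n" and "x \<in> edge vs i"
    then obtain s where s: "s \<in> {0..1}" "x = v i + s *\<^sub>R (v (Suc i) - v i)" using edge_eq by auto
    have e: "v (Suc i) = v i + v (\<sigma> i) - v (Suc (\<sigma> i))" using sigma(4)[OF i]
      by (simp add: algebra_simps)
    then have "f (v (Suc i)) = f (v i + v (\<sigma> i) - v (Suc (\<sigma> i)))" by simp
    then have fe: "f (v (Suc i)) = f (v i) + f (v (\<sigma> i)) - f (v (Suc (\<sigma> i)))"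
      by (simp add: diff add)
    have "x + \<tau> i = v (\<sigma> i) + (1 - s) *\<^sub>R (v (Suc (\<sigma> i)) - v (\<sigma> i))"
      unfolding s(2) e by (simp add: algebra_simps)
    then have "h (x + \<tau> i) = f (v (\<sigma> i)) + (1 - s) * (f (v (Suc (\<sigma> i))) - f (v (\<sigma> i)))"
      using hs[OF sigma(1)[OF i], of "1 - s"] s(1) by simp
    moreover have "h x = f (v i) + s * (f (v (Suc i)) - f (v i))" using hs[OF i s(1)] s(2) by simp
    ultimately show "h (x + \<tau> i) = h x + f (\<tau> i)" unfolding fe diff by (simp add: algebra_simps)
  qed
qed

text \<open>No continuity of \<open>f\<close> is available: the estimate holds because \<open>h - f\<close> descends to the surface.\<close>

lemma cocycle_bound:
  assumes add: "\<And>x y. f (x + y) = f x + (f y :: real)" and lip: "L-lipschitz_on UNIV h"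
    and equi: "\<And>i x. i < n \<Longrightarrow> x \<in> edge vs i \<Longrightarrow> h (x + \<tau> i) = h x + f (\<tau> i)"
    and fl: "flows M \<theta> t (q a) (q b)" "0 \<le> t" "a \<in> R" "b \<in> R"
  shows "\<bar>h b - h a - f (b - a - t *\<^sub>R \<theta>)\<bar> \<le> L * t * norm \<theta>"
  using fl
proof (rule flows_rel_induct[where Q = "\<lambda>t a b. \<bar>h b - h a - f (b - a - t *\<^sub>R \<theta>)\<bar> \<le>
  L * t * norm \<theta>"])
  fix s t p p' p''
  assume H: "\<bar>h p' - h p - f (p' - p - s *\<^sub>R \<theta>)\<bar> \<le> L * s * norm \<theta>"
    "\<bar>h p'' - h p' - f (p'' - p' - t *\<^sub>R \<theta>)\<bar> \<le> L * t * norm \<theta>"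
  have "p'' - p - (s + t) *\<^sub>R \<theta> = (p' - p - s *\<^sub>R \<theta>) + (p'' - p' - t *\<^sub>R \<theta>)"
    by (simp add: algebra_simps)
  then have "f (p'' - p - (s + t) *\<^sub>R \<theta>) = f (p' - p - s *\<^sub>R \<theta>) + f (p'' - p' - t *\<^sub>R \<theta>)"
    by (simp only: add)
  then show "\<bar>h p'' - h p - f (p'' - p - (s + t) *\<^sub>R \<theta>)\<bar> \<le> L * (s + t) * norm \<theta>"
    using H by (simp add: distrib_left distrib_right)
next
  have f0: "f 0 = 0" using add[of 0 0] by simp
  fix p p' assume "p \<in> R" "p' \<in> R" "q p = q p'"
  then have "h p' - h p = f (p' - p)"
  proof (induction rule: fibre_induct)
    case refl then show ?case by (simp add: f0)
  next
    case (step y i)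
    have "f (y + \<tau> i - p) = f (y - p) + f (\<tau> i)" using add[of "y - p" "\<tau> i"]
      by (simp add: algebra_simps)
    then show ?case using step equi[of i y] by simp
  qed
  then show "\<bar>h p' - h p - f (p' - p - 0 *\<^sub>R \<theta>)\<bar> \<le> L * 0 * norm \<theta>" by simp
next
  have f0: "f 0 = 0" using add[of 0 0] by simp
  fix s p assume "0 \<le> (s::real)"
  then show "\<bar>h (p + s *\<^sub>R \<theta>) - h p - f (p + s *\<^sub>R \<theta> - p - s *\<^sub>R \<theta>)\<bar> \<le> L * s * norm \<theta>"
    using lipschitz_onD[OF lip, of "p + s *\<^sub>R \<theta>" p] by (simp add: f0 dist_norm mult.assoc)
qed

text \<open>Sums of lists make countability immediate. As
  \<open>\<tau> (\<sigma> i) = - \<tau> i\<close>, this monoid is the group generated by the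
  translation vectors.\<close>

definition holonomy :: "(real^2) set" where
  "holonomy = sum_list ` lists (\<tau> ` {..<n})"

lemma countable_holonomy: "countable holonomy"
  unfolding holonomy_def by (intro countable_image countable_lists) simp

lemma holonomyI: "set xs \<subseteq> \<tau> ` {..<n} \<Longrightarrow> sum_list xs \<in> holonomy"
  unfolding holonomy_def by (intro imageI) (simp add: in_lists_conv_set subset_iff)

lemma holonomy_add:
  assumes "a \<in> holonomy" "b \<in> holonomy" shows "a + b \<in> holonomy"
proof -
  obtain xs ys where "a = sum_list xs" "set xs \<subseteq> \<tau> ` {..<n}" "b = sum_list ys" "set ys \<subseteq> \<tau> ` {..<n}"
    using assms unfolding holonomy_def by (auto simp: lists_eq_set)
  then show ?thesis using holonomyI[of "xs @ ys"] by simp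
qed

lemma holonomy_zero: "0 \<in> holonomy"
  using holonomyI[of "[]"] by simp

lemma holonomy_tau: "i < n \<Longrightarrow> \<tau> i \<in> holonomy"
  using holonomyI[of "[\<tau> i]"] by simp

text \<open>Straight segments are compensated by the time term and every jump adds translation
  vectors. So the displacement over a fixed time takes countably many values.\<close>

lemma flows_holonomy:
  assumes fl: "flows M \<theta> t (q a) (q b)" "0 \<le> t" "a \<in> R" "b \<in> R"
  shows "b - a - t *\<^sub>R \<theta> \<in> holonomy"
  using fl
proof (rule flows_rel_induct[where Q = "\<lambda>t a b. b - a - t *\<^sub>R \<theta> \<in> holonomy"])
  fix s t p p' p'' assume "p' - p - s *\<^sub>R \<theta> \<in> holonomy" "p'' - p' - t *\<^sub>R \<theta> \<in> holonomy"
  then have "(p' - p - s *\<^sub>R \<theta>) + (p'' - p' - t *\<^sub>R \<theta>) \<in> holonomy" by (rule holonomy_add)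
  then show "p'' - p - (s + t) *\<^sub>R \<theta> \<in> holonomy" by (simp add: algebra_simps)
next
  fix p p' assume "p \<in> R" "p' \<in> R" "q p = q p'"
  then have "p' - p \<in> holonomy"
  proof (induction rule: fibre_induct)
    case refl then show ?case by (simp add: holonomy_zero)
  next
    case (step y i)
    then have "(y - p) + \<tau> i \<in> holonomy" by (intro holonomy_add holonomy_tau) auto
    then show ?case by (simp add: algebra_simps)
  qed
  then show "p' - p - 0 *\<^sub>R \<theta> \<in> holonomy" by simp
qed (simp add: holonomy_zero)

section \<open>Averaging over a periodic flow\<close>

lemma bounded_inside_boundary: "bounded I"
  using closed_boundary compact_imp_bounded bounded_inside by blast

lemma inside_regular: "x \<in> I \<Longrightarrow> x \<in> R" "x \<in> I \<Longrightarrow> x \<notin> E" "x \<in> I \<Longrightarrow> x \<notin> set vs"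
  using inside_eq vertices_boundary by auto

lemma q_inside_inj: "x \<in> I \<Longrightarrow> y \<in> I \<Longrightarrow> q x = q y \<Longrightarrow> x = y"
  using fibre_inside[of x y] inside_regular by metis

text \<open>By \<open>flow_box\<close> a displacement c that occurs at x occurs at all nearby
  points. This makes the pieces of the sampled flow measurable.\<close>

lemma open_flow_step:
  assumes "0 \<le> T" shows "open {x \<in> I. x + c \<in> I \<and> flows M \<theta> T (q x) (q (x + c))}" (is "open ?A")
proof (subst open_contains_ball, intro ballI)
  fix x assume x: "x \<in> ?A"
  let ?y = "x + c"
  obtain \<gamma> where \<gamma>: "flow_line M \<theta> T \<gamma>" "\<gamma> 0 = q x" "\<gamma> T = q ?y" using x unfolding flows_def
    by blast
  have I: "x \<in> I" "?y \<in> I" using x by auto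
  obtain U \<phi> where U: "(U, \<phi>) \<in> atlas M" "q x \<in> U"
    using regular_chart nonvertex_regular[of x] inside_regular I by metis
  obtain V \<psi> where V: "(V, \<psi>) \<in> atlas M" "q ?y \<in> V"
    using regular_chart nonvertex_regular[of ?y] inside_regular I by metis
  obtain d where d: "d > 0" "\<And>z. z \<in> U \<Longrightarrow> dist (\<phi> z) (\<phi> (q x)) < d \<Longrightarrow>
     \<exists>z'\<in>V. flows M \<theta> T z z' \<and> \<psi> z' - \<psi> (q ?y) = \<phi> z - \<phi> (q x)"
    using flow_box[OF \<gamma>(1) assms, of U \<phi> V \<psi>] U V \<gamma>(2,3) by auto
  obtain e1 where e1: "e1 > 0" "\<And>z. z \<in> R \<inter> ball x e1 \<Longrightarrow> q z \<in> U \<and> \<phi> (q z) = \<phi> (q x) + (z - x)"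
    using chart_local[OF inside_regular(1)[OF I(1)] U] by blast
  obtain e2 where e2: "e2 > 0" "\<And>z. z \<in> R \<inter> ball ?y e2 \<Longrightarrow> q z \<in> V \<and> \<psi> (q z) = \<psi> (q ?y) + (z - ?y)"
    using chart_local[OF inside_regular(1)[OF I(2)] V] by blast
  obtain r1 where r1: "r1 > 0" "ball x r1 \<subseteq> I" using open_inside_boundary I(1)
    unfolding open_contains_ball by blast
  obtain r2 where r2: "r2 > 0" "ball ?y r2 \<subseteq> I" using open_inside_boundary I(2)
    unfolding open_contains_ball by blast
  define e where "e = min d (min (min e1 e2) (min r1 r2))"
  have "ball x e \<subseteq> ?A"
  proof
    fix z assume z: "z \<in> ball x e"
    have dz: "dist x z < e" "dist ?y (z + c) < e" using z by (auto simp: dist_norm)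
    have zI: "z \<in> I" "z + c \<in> I" using dz r1(2) r2(2) by (auto simp: e_def)
    have qz: "q z \<in> U" "\<phi> (q z) = \<phi> (q x) + (z - x)" using e1(2)[of z] dz zI inside_regular
      by (auto simp: e_def)
    have qz': "q (z + c) \<in> V" "\<psi> (q (z + c)) = \<psi> (q ?y) + (z + c - ?y)"
      using e2(2)[of "z + c"] dz zI inside_regular by (auto simp: e_def)
    have "dist (\<phi> (q z)) (\<phi> (q x)) < d" using dz(1)
      by (simp add: qz dist_norm norm_minus_commute e_def)
    then obtain z' where z': "z' \<in> V" "flows M \<theta> T (q z) z'" "\<psi> z' - \<psi> (q ?y) = \<phi> (q z) - \<phi> (q x)"
      using d(2)[OF qz(1)] by blast
    have "\<psi> z' - \<psi> (q ?y) = z - x" using z'(3) qz(2) by simp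
    moreover have "\<psi> (q (z + c)) - \<psi> (q ?y) = z - x" using qz'(2) by simp
    ultimately have "\<psi> z' = \<psi> (q (z + c))" by (metis diff_add_cancel)
    then have "z' = q (z + c)" using inj_onD[OF chart_inj[OF V(1)]] z'(1) qz'(1) by blast
    then show "z \<in> ?A" using zI z'(2) by simp
  qed
  moreover have "e > 0" using d e1 e2 r1 r2 by (simp add: e_def)
  ultimately show "\<exists>e>0. ball x e \<subseteq> ?A" by blast
qed

end

text \<open>Sampled at the multiples of \<open>T/N\<close>, a flow of period \<open>T\<close> becomes a measure-preserving piecewise
  translation of a conull subset \<open>G\<close> of the open polygon.\<close>

locale periodic_flow_step = convex_pattern M vs \<sigma> q for M :: "'a tsurf" and vs \<sigma> q +
  fixes \<theta> :: "real^2" and T :: real and N :: nat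
  assumes unit: "norm \<theta> = 1" and T_pos: "T > 0" and N_pos: "N > 0"
    and periodic: "negligible {x \<in> I. \<not> flows M \<theta> T (q x) (q x)}"
begin

definition \<epsilon> where "\<epsilon> = T / real N"

text \<open>All samples are required to lie over the open polygon, where \<open>q\<close> is
  injective, so that a closed orbit may be restarted at any of them.\<close>

definition closed_orbit where
  "closed_orbit x \<gamma> \<longleftrightarrow> flow_line M \<theta> T \<gamma> \<and> \<gamma> 0 = q x \<and> \<gamma> T = q x \<and> (\<forall>k\<le>N. \<gamma> (real k * \<epsilon>) \<in> q ` I)"

definition G where "G = {x \<in> I. \<exists>\<gamma>. closed_orbit x \<gamma>}"

text \<open>On \<open>G\<close> the choice is forced, because the flow is deterministic and
  \<open>q\<close> is injective on \<open>I\<close>.\<close>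

definition step where "step x = (SOME p. p \<in> I \<and> flows M \<theta> \<epsilon> (q x) (q p))"

lemma eps_pos: "\<epsilon> > 0" using T_pos N_pos by (simp add: \<epsilon>_def)

lemma N_eps: "real N * \<epsilon> = T" using N_pos by (simp add: \<epsilon>_def)

lemma k_eps: "k \<le> N \<Longrightarrow> real k * \<epsilon> \<le> T"
  using mult_right_mono[of "real k" "real N" \<epsilon>] eps_pos N_eps by simp

lemma G_subset: "G \<subseteq> I" unfolding G_def by blast

text \<open>If the k-th sample of the orbit of x lies over the boundary, then by
  \<open>flows_holonomy\<close> x lies in a translate of \<open>E\<close> by one of countably many
  vectors.\<close>

lemma negligible_G: "negligible (I - G)"
proof -
  let ?B = "\<Union>k\<in>{..N}. \<Union>g\<in>holonomy. (+) (- (g + (real k * \<epsilon>) *\<^sub>R \<theta>)) ` E"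
  have "negligible (\<Union>g\<in>holonomy. (+) (- (g + c)) ` E)" for c
    using countable_holonomy negligible_translation[OF negligible_boundary]
    by (intro negligible_countable_Union) auto
  then have "negligible ?B" by (intro negligible_Union) auto
  then have "negligible ({x \<in> I. \<not> flows M \<theta> T (q x) (q x)} \<union> ?B)" using periodic
    by (simp add: negligible_Un)
  moreover have "I - G \<subseteq> {x \<in> I. \<not> flows M \<theta> T (q x) (q x)} \<union> ?B"
  proof
    fix x assume x: "x \<in> I - G"
    show "x \<in> {x \<in> I. \<not> flows M \<theta> T (q x) (q x)} \<union> ?B"
    proof (cases "flows M \<theta> T (q x) (q x)")
      case True
      then obtain \<gamma> where \<gamma>: "flow_line M \<theta> T \<gamma>" "\<gamma> 0 = q x" "\<gamma> T = q x" unfolding flows_def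
        by blast
      then have "\<not> (\<forall>k\<le>N. \<gamma> (real k * \<epsilon>) \<in> q ` I)" using x unfolding G_def closed_orbit_def by blast
      then obtain k where k: "k \<le> N" "\<gamma> (real k * \<epsilon>) \<notin> q ` I" by blast
      have kT: "0 \<le> real k * \<epsilon>" "real k * \<epsilon> \<le> T" using k_eps[OF k(1)] eps_pos by auto
      then have "\<gamma> (real k * \<epsilon>) \<in> topspace (surf M)"
        using flow_line_regular[OF \<gamma>(1), of "real k * \<epsilon>"] by (simp add: regular_part_def)
      then obtain p where p: "p \<in> R" "q p = \<gamma> (real k * \<epsilon>)" using q_onto by (metis imageE)
      then have "p \<notin> I" using k(2) by (metis imageI)
      then have pE: "p \<in> E" using p inside_eq by blast
      have "flows M \<theta> (real k * \<epsilon>) (q x) (q p)"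
        using flows_segment[OF \<gamma>(1), of 0 "real k * \<epsilon>"] kT p \<gamma>(2) by simp
      then have "p - x - (real k * \<epsilon>) *\<^sub>R \<theta> \<in> holonomy"
        using flows_holonomy kT p(1) inside_regular(1) x by blast
      moreover have "x = - ((p - x - (real k * \<epsilon>) *\<^sub>R \<theta>) + (real k * \<epsilon>) *\<^sub>R \<theta>) + p" by simp
      ultimately have "x \<in> (\<Union>g\<in>holonomy. (+) (- (g + (real k * \<epsilon>) *\<^sub>R \<theta>)) ` E)" using pE
        by (intro UN_I[of "p - x - (real k * \<epsilon>) *\<^sub>R \<theta>"] image_eqI[of _ _ p])
      then show ?thesis using k(1) by blast
    qed (use x in blast)
  qed
  ultimately show ?thesis using negligible_subset by blast
qed

text \<open>Restarting a closed orbit at its k-th sample permutes the samples cyclically: sample j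
  becomes the old sample k + j, reduced by N when it passes the end.\<close>

lemma closed_orbit_rotate:
  assumes \<gamma>: "closed_orbit x \<gamma>" and k: "k \<le> N" and p: "p \<in> I" "\<gamma> (real k * \<epsilon>) = q p"
  shows "p \<in> G"
proof -
  have fl: "flow_line M \<theta> T \<gamma>" "\<gamma> 0 = q x" "\<gamma> T = q x" "\<And>k. k \<le> N \<Longrightarrow> \<gamma> (real k * \<epsilon>) \<in> q ` I"
    using \<gamma> unfolding closed_orbit_def by auto
  let ?a = "real k * \<epsilon>"
  let ?\<beta> = "\<lambda>t. if t \<le> T - ?a then \<gamma> (?a + t) else \<gamma> (0 + (t - (T - ?a)))"
  have a: "0 \<le> ?a" "?a \<le> T" using k_eps[OF k] eps_pos by auto
  have "flow_line M \<theta> ((T - ?a) + (?a - 0)) ?\<beta>"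
    by (rule flow_line_concat[OF flow_line_shift[OF fl(1)] flow_line_shift[OF fl(1)]]) (use a fl in auto)
  then have f: "flow_line M \<theta> T ?\<beta>" by simp
  have "closed_orbit p ?\<beta>" unfolding closed_orbit_def
  proof (intro conjI f allI impI)
    show "?\<beta> 0 = q p" using a p by simp
    show "?\<beta> T = q p" using a p fl(2,3) by (cases "?a = 0") auto
    fix j assume j: "j \<le> N"
    show "?\<beta> (real j * \<epsilon>) \<in> q ` I"
    proof (cases "k + j \<le> N")
      case True
      have "real j * \<epsilon> \<le> T - ?a" using k_eps[OF True] by (simp add: distrib_right)
      then have "?\<beta> (real j * \<epsilon>) = \<gamma> (real (k + j) * \<epsilon>)" by (simp add: algebra_simps)
      then show ?thesis using fl(4)[OF True] by simp
    next
      case False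
      then have "real N < real (k + j)" by simp
      then have "real N * \<epsilon> < real (k + j) * \<epsilon>" using eps_pos by simp
      moreover have kj: "real (k + j) * \<epsilon> = ?a + real j * \<epsilon>" by (simp add: distrib_right)
      ultimately have "\<not> real j * \<epsilon> \<le> T - ?a" using N_eps by linarith
      moreover have "real (k + j - N) * \<epsilon> = real (k + j) * \<epsilon> - real N * \<epsilon>" using False
        by (simp add: of_nat_diff left_diff_distrib)
      then have "real j * \<epsilon> - (T - ?a) = real (k + j - N) * \<epsilon>" using kj N_eps by linarith
      ultimately have "?\<beta> (real j * \<epsilon>) = \<gamma> (real (k + j - N) * \<epsilon>)" by simp
      then show ?thesis using fl(4)[of "k + j - N"] j k by simp
    qed
  qed
  then show ?thesis using p unfolding G_def by blast
qed

lemma step_eqI: "p \<in> I \<Longrightarrow> flows M \<theta> \<epsilon> (q x) (q p) \<Longrightarrow> step x = p"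
  unfolding step_def
proof (rule some_equality)
  fix p' assume "p \<in> I" "flows M \<theta> \<epsilon> (q x) (q p)" "p' \<in> I \<and> flows M \<theta> \<epsilon> (q x) (q p')"
  then show "p' = p" using flows_functional[of \<theta> \<epsilon> "q x" "q p" "q p'"] q_inside_inj eps_pos by auto
qed auto

lemma closed_orbit_step:
  assumes \<gamma>: "closed_orbit x \<gamma>" and k: "Suc k \<le> N" and p: "p \<in> I" "\<gamma> (real k * \<epsilon>) = q p"
  shows "\<gamma> (real (Suc k) * \<epsilon>) = q (step p)" "step p \<in> I" "flows M \<theta> \<epsilon> (q p) (q (step p))"
proof -
  obtain p' where p': "p' \<in> I" "\<gamma> (real (Suc k) * \<epsilon>) = q p'" using \<gamma> k unfolding closed_orbit_def
    by blast
  have "flows M \<theta> (real (Suc k) * \<epsilon> - real k * \<epsilon>) (\<gamma> (real k * \<epsilon>)) (\<gamma> (real (Suc k) * \<epsilon>))"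
    using \<gamma> k_eps[OF k] eps_pos unfolding closed_orbit_def by (intro flows_segment[of _ T]) auto
  then have f: "flows M \<theta> \<epsilon> (q p) (q p')" using p p' by (simp add: algebra_simps)
  then have "step p = p'" using step_eqI p' by blast
  then show "\<gamma> (real (Suc k) * \<epsilon>) = q (step p)" "step p \<in> I" "flows M \<theta> \<epsilon> (q p) (q (step p))"
    using p' f by auto
qed

lemma step_G:
  assumes "x \<in> G" shows "step x \<in> G" "flows M \<theta> \<epsilon> (q x) (q (step x))"
proof -
  obtain \<gamma> where \<gamma>: "closed_orbit x \<gamma>" and xI: "x \<in> I" using assms unfolding G_def by blast
  have 0: "\<gamma> (real 0 * \<epsilon>) = q x" using \<gamma> unfolding closed_orbit_def by simp
  have "Suc 0 \<le> N" using N_pos by simp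
  note s = closed_orbit_step[OF \<gamma> this xI 0]
  show "flows M \<theta> \<epsilon> (q x) (q (step x))" using s by simp
  show "step x \<in> G" using closed_orbit_rotate[OF \<gamma> _ s(2,1)] N_pos by simp
qed

lemma funpow_step_G: "x \<in> G \<Longrightarrow> (step ^^ k) x \<in> G"
  by (induction k) (auto simp: step_G)

lemma step_period:
  assumes "x \<in> G" shows "(step ^^ N) x = x"
proof -
  obtain \<gamma> where \<gamma>: "closed_orbit x \<gamma>" and xI: "x \<in> I" using assms unfolding G_def by blast
  have "\<gamma> (real k * \<epsilon>) = q ((step ^^ k) x)" if "k \<le> N" for k
    using that
  proof (induction k)
    case 0 then show ?case using \<gamma> unfolding closed_orbit_def by simp
  next
    case (Suc k)
    then have "\<gamma> (real k * \<epsilon>) = q ((step ^^ k) x)" by simp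
    from closed_orbit_step(1)[OF \<gamma> Suc.prems _ this] show ?case
      using funpow_step_G[OF assms, of k] G_subset by auto
  qed
  from this[of N] have "q ((step ^^ N) x) = q x" using \<gamma> unfolding closed_orbit_def
    by (simp add: N_eps)
  then show ?thesis using q_inside_inj funpow_step_G[OF assms, of N] G_subset xI by blast
qed

text \<open>Injectivity is that of the flow. Surjectivity comes from the period: x is the image of
  its iterate number N - 1.\<close>

lemma bij_step: "bij_betw step G G"
  unfolding bij_betw_def
proof
  show "inj_on step G"
  proof (rule inj_onI)
    fix x y assume xy: "x \<in> G" "y \<in> G" "step x = step y"
    then have "q x = q y"
      using flows_injective[of \<theta> \<epsilon> "q x" "q (step x)" "q y"] step_G(2)[of x] step_G(2)[of y] eps_pos
      by simp
    then show "x = y" using q_inside_inj xy G_subset by blast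
  qed
  show "step ` G = G"
  proof
    show "G \<subseteq> step ` G"
    proof
      fix x assume x: "x \<in> G"
      obtain m where m: "N = Suc m" using N_pos by (cases N) auto
      have "x = step ((step ^^ m) x)" using step_period[OF x] by (simp add: m)
      then show "x \<in> step ` G" using funpow_step_G[OF x] by blast
    qed
  qed (use step_G in blast)
qed

lemma G_sets: "G \<in> sets lebesgue"
proof -
  have "I \<in> sets lebesgue" using borel_open[OF open_inside_boundary] by simp
  then have "I - (I - G) \<in> sets lebesgue" using negligible_imp_sets[OF negligible_G]
    by (rule sets.Diff)
  moreover have "I - (I - G) = G" using G_subset by blast
  ultimately show ?thesis by simp
qed

lemma G_lmeasurable: "G \<in> lmeasurable"
  using G_sets bounded_subset[OF bounded_inside_boundary G_subset]
    by (simp add: bounded_set_imp_lmeasurable)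

lemma step_holonomy: "x \<in> G \<Longrightarrow> step x - x - \<epsilon> *\<^sub>R \<theta> \<in> holonomy"
proof -
  assume x: "x \<in> G"
  then have "x \<in> R" "step x \<in> R" using step_G(1) G_subset inside_regular(1) by auto
  then show ?thesis using flows_holonomy[OF step_G(2)[OF x]] eps_pos by simp
qed

lemma step_piece_sets: "{x \<in> G. step x = x + c} \<in> sets lebesgue"
proof -
  let ?A = "{x \<in> I. x + c \<in> I \<and> flows M \<theta> \<epsilon> (q x) (q (x + c))}"
  have "{x \<in> G. step x = x + c} = G \<inter> ?A"
  proof
    show "{x \<in> G. step x = x + c} \<subseteq> G \<inter> ?A"
    proof
      fix x assume "x \<in> {x \<in> G. step x = x + c}"
      then have x: "x \<in> G" "step x = x + c" by auto
      then show "x \<in> G \<inter> ?A" using step_G[OF x(1)] G_subset by auto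
    qed
  qed (use step_eqI in auto)
  moreover have "?A \<in> sets lebesgue" using borel_open[OF open_flow_step[of \<epsilon> c \<theta>]] eps_pos by auto
  ultimately show ?thesis using G_sets by (simp add: sets.Int)
qed

lemma step_displacement:
  "countable ((\<lambda>g. g + \<epsilon> *\<^sub>R \<theta>) ` holonomy)" "x \<in> G \<Longrightarrow> step x - x \<in> (\<lambda>g. g + \<epsilon> *\<^sub>R \<theta>) ` holonomy"
proof -
  show "countable ((\<lambda>g. g + \<epsilon> *\<^sub>R \<theta>) ` holonomy)" using countable_holonomy by (rule countable_image)
  assume "x \<in> G"
  then have "step x - x - \<epsilon> *\<^sub>R \<theta> \<in> holonomy" by (rule step_holonomy)
  then show "step x - x \<in> (\<lambda>g. g + \<epsilon> *\<^sub>R \<theta>) ` holonomy" by (rule rev_image_eqI) simp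
qed

lemmas step_measurable = measurable_piecewise_translation[OF G_sets bij_step step_displacement step_piece_sets]
lemmas integral_step = integral_piecewise_translation[OF G_sets bij_step step_displacement step_piece_sets]

text \<open>The cocycle \<Delta> of one step telescopes over N steps to
  \<open>f (T *\<^sub>R \<theta>)\<close>, and since \<open>step\<close> preserves measure each of
  its N terms has the same integral. Away from the layer \<Delta> is the increment of
  \<open>h\<close> by \<open>\<epsilon> *\<^sub>R \<theta>\<close>, the integrand of
  \<open>D\<close>. In the layer the two differ by at most 2 L \<epsilon>, and N \<epsilon> = T
  makes the total error independent of N for fixed \<delta>.\<close>

lemma average_cocycle:
  assumes add: "\<And>x y. f (x + y) = f x + (f y :: real)" and lip: "L-lipschitz_on UNIV h"
    and equi: "\<And>i x. i < n \<Longrightarrow> x \<in> edge vs i \<Longrightarrow> h (x + \<tau> i) = h x + f (\<tau> i)"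
    and \<delta>: "\<epsilon> < \<delta>"
  shows "\<bar>measure lebesgue I * f (T *\<^sub>R \<theta>) - real N * difference_integral.D I h (\<epsilon> *\<^sub>R \<theta>)\<bar>
     \<le> 2 * L * T * measure lebesgue (difference_integral.layer I \<delta>)"
proof -
  interpret difference_integral I h L
    by unfold_locales (rule open_inside_boundary bounded_inside_boundary lip)+
  interpret finG: finite_measure "lebesgue_on G"
    by (rule finite_measure_lebesgue_on[OF G_lmeasurable])
  have f0: "f 0 = 0" using add[of 0 0] by simp
  have fm: "f (- x) = - f x" for x using add[of x "- x"] f0 by simp
  define \<Delta> where "\<Delta> x = h (step x) - h x - f (step x - x - \<epsilon> *\<^sub>R \<theta>)" for x
  define F where "F x = h (x + \<epsilon> *\<^sub>R \<theta>) - h x" for x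
  have space: "space (lebesgue_on G) = G" by simp
  have step_m: "step \<in> measurable (lebesgue_on G) (lebesgue_on G)" by (rule step_measurable)
  \<comment> \<open>\<open>f\<close> may fail to be measurable, but its argument takes values in the
    countable set \<open>holonomy\<close>, on which every function is.\<close>
  have "(\<lambda>x. step x - x - \<epsilon> *\<^sub>R \<theta>) \<in> measurable (lebesgue_on G) (count_space holonomy)"
  proof (subst measurable_count_space_eq_countable[OF countable_holonomy], intro conjI ballI)
    show "(\<lambda>x. step x - x - \<epsilon> *\<^sub>R \<theta>) \<in> space (lebesgue_on G) \<rightarrow> holonomy" using step_holonomy by simp
    fix g
    have "(\<lambda>x. step x - x - \<epsilon> *\<^sub>R \<theta>) -` {g} \<inter> space (lebesgue_on G)
      = {x \<in> G. step x = x + (g + \<epsilon> *\<^sub>R \<theta>)}"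
      by (auto simp: algebra_simps)
    then show "(\<lambda>x. step x - x - \<epsilon> *\<^sub>R \<theta>) -` {g} \<inter> space (lebesgue_on G) \<in> sets (lebesgue_on G)"
      using step_piece_sets G_sets by (simp add: sets_restrict_space_iff)
  qed
  then have fm1: "(\<lambda>x. f (step x - x - \<epsilon> *\<^sub>R \<theta>)) \<in> borel_measurable (lebesgue_on G)"
    by (rule measurable_compose) simp
  have hm: "h \<in> borel_measurable (lebesgue_on G)"
    by (rule measurable_restrict_space1[OF h_measurable'])
  have \<Delta>m: "\<Delta> \<in> borel_measurable (lebesgue_on G)"
    unfolding \<Delta>_def using hm fm1 measurable_compose[OF step_m hm] by simp
  have \<Delta>b: "\<bar>\<Delta> x\<bar> \<le> L * \<epsilon>" if "x \<in> G" for x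
    using cocycle_bound[OF add lip equi step_G(2)[OF that]] that step_G(1)[OF that] G_subset inside_regular(1) eps_pos unit
    by (auto simp: \<Delta>_def)
  have iter: "(\<lambda>x. \<Delta> ((step ^^ k) x)) \<in> borel_measurable (lebesgue_on G) \<and>
     (\<integral>x. \<Delta> ((step ^^ k) x) \<partial>lebesgue_on G) = (\<integral>x. \<Delta> x \<partial>lebesgue_on G)" for k
  proof (induction k)
    case (Suc k)
    then show ?case using measurable_compose[OF step_m, of "\<lambda>x. \<Delta> ((step ^^ k) x)"]
        integral_step[of "\<lambda>x. \<Delta> ((step ^^ k) x)"]
      by (simp add: funpow_Suc_right del: funpow.simps)
  qed (use \<Delta>m in simp)
  have int: "integrable (lebesgue_on G) (\<lambda>x. \<Delta> ((step ^^ k) x))" for k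
    by (rule finG.integrable_const_bound[of _ "L * \<epsilon>"]) (use iter \<Delta>b funpow_step_G in \<open>auto intro!: AE_I2\<close>)
  have tele: "(\<Sum>k<m. \<Delta> ((step ^^ k) x)) = h ((step ^^ m) x) - h x - f ((step ^^ m) x - x -
    (real m * \<epsilon>) *\<^sub>R \<theta>)" for m x
  proof (induction m)
    case (Suc m)
    let ?X = "(step ^^ m) x"
    have "step ?X - x - (real (Suc m) * \<epsilon>) *\<^sub>R \<theta> = (step ?X - ?X - \<epsilon> *\<^sub>R \<theta>) + (?X - x -
      (real m * \<epsilon>) *\<^sub>R \<theta>)"
      by (simp add: algebra_simps)
    then have "f (step ?X - x - (real (Suc m) * \<epsilon>) *\<^sub>R \<theta>) = f (step ?X - ?X - \<epsilon> *\<^sub>R \<theta>) + f (?X - x -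
      (real m * \<epsilon>) *\<^sub>R \<theta>)"
      by (simp only: add)
    then show ?case using Suc by (simp add: \<Delta>_def)
  qed (simp add: f0)
  \<comment> \<open>The point has returned, so all that remains of the telescoped sum is
    \<open>- f (- (T *\<^sub>R \<theta>))\<close>.\<close>
  have "(\<Sum>k<N. \<Delta> ((step ^^ k) x)) = f (T *\<^sub>R \<theta>)" if "x \<in> G" for x
    unfolding tele step_period[OF that] N_eps using fm by simp
  then have "(\<integral>x. (\<Sum>k<N. \<Delta> ((step ^^ k) x)) \<partial>lebesgue_on G) = (\<integral>x. f (T *\<^sub>R \<theta>) \<partial>lebesgue_on G)"
    by (intro Bochner_Integration.integral_cong) auto
  moreover have "(\<integral>x. (\<Sum>k<N. \<Delta> ((step ^^ k) x)) \<partial>lebesgue_on G) = real N * (\<integral>x. \<Delta> x \<partial>lebesgue_on G)"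
    using int iter by (simp add: Bochner_Integration.integral_sum)
  moreover have GI: "measure lebesgue G = measure lebesgue I"
  proof -
    have "measure lebesgue (I - (I - G)) = measure lebesgue I"
      using negligible_G
        by (intro measure_Diff_null_set) (auto simp: negligible_iff_null_sets \<Omega>_sets)
    moreover have "I - (I - G) = G" using G_subset by blast
    ultimately show ?thesis by simp
  qed
  moreover have "measure (lebesgue_on G) G = measure lebesgue G"
    using G_sets by (simp add: measure_restrict_space)
  ultimately have sum: "real N * (\<integral>x. \<Delta> x \<partial>lebesgue_on G) = measure lebesgue I * f (T *\<^sub>R \<theta>)"
    by simp
  have Fm: "F \<in> borel_measurable lebesgue" unfolding F_def using h_measurable h_measurable'
    by (rule borel_measurable_diff)
  have "AE x in lebesgue. x \<notin> I - G" using negligible_G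
    by (intro AE_not_in) (simp add: negligible_iff_null_sets)
  then have "(\<integral>x. indicator I x *\<^sub>R F x \<partial>lebesgue) = (\<integral>x. indicator G x *\<^sub>R F x \<partial>lebesgue)"
  proof (intro integral_cong_AE)
    show "(\<lambda>x. indicator I x *\<^sub>R F x) \<in> borel_measurable lebesgue"
      "(\<lambda>x. indicator G x *\<^sub>R F x) \<in> borel_measurable lebesgue"
      using Fm \<Omega>_sets G_sets by auto
    show "AE x in lebesgue. indicator I x *\<^sub>R F x = indicator G x *\<^sub>R F x"
      using \<open>AE x in lebesgue. x \<notin> I - G\<close>
        by eventually_elim (use G_subset in \<open>auto simp: indicator_def\<close>)
  qed
  then have DF: "D (\<epsilon> *\<^sub>R \<theta>) = (\<integral>x. F x \<partial>lebesgue_on G)"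
    unfolding D_def F_def[symmetric] using \<Omega>_sets G_sets by (simp add: integral_restrict_space)
  have Fb: "\<bar>F x\<bar> \<le> L * \<epsilon>" for x
    unfolding F_def using h_lip[of "x + \<epsilon> *\<^sub>R \<theta>" x] unit eps_pos by simp
  have Fi: "integrable (lebesgue_on G) F"
    by (rule finG.integrable_const_bound[of _ "L * \<epsilon>"]) (use Fb measurable_restrict_space1[OF Fm] in auto)
  \<comment> \<open>Outside the layer the whole step stays in the open polygon, so it is the plain
    translation and \<open>f\<close> contributes \<open>f 0 = 0\<close>. Inside the layer the two
    bounds L \<epsilon> are added.\<close>
  have pt: "\<bar>\<Delta> x - F x\<bar> \<le> indicator (layer \<delta>) x * (2 * L * \<epsilon>)" if x: "x \<in> G" for x
  proof (cases "x \<in> layer \<delta>")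
    case True
    then show ?thesis using \<Delta>b[OF x] Fb[of x] abs_triangle_ineq4[of "\<Delta> x" "F x"] by simp
  next
    case False
    then have b: "ball x \<delta> \<subseteq> I" using x G_subset unfolding layer_def by blast
    have pI: "x + s *\<^sub>R \<theta> \<in> I" if "s \<in> {0..\<epsilon>}" for s
    proof -
      have "x + s *\<^sub>R \<theta> \<in> ball x \<delta>" using that \<delta> unit by (simp add: dist_norm)
      then show ?thesis using b by blast
    qed
    have "flow_line M \<theta> \<epsilon> (\<lambda>s. q (x + s *\<^sub>R \<theta>))"
      by (rule flows_segment_region) (use pI inside_regular eps_pos in auto)
    then have "flows M \<theta> \<epsilon> (q x) (q (x + \<epsilon> *\<^sub>R \<theta>))" unfolding flows_def by (intro exI conjI) auto
    then have "step x = x + \<epsilon> *\<^sub>R \<theta>" using step_eqI pI[of \<epsilon>] eps_pos by simp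
    then show ?thesis using False by (simp add: \<Delta>_def F_def f0)
  qed
  have \<Delta>i: "integrable (lebesgue_on G) \<Delta>" using int[of 0] by simp
  have "\<bar>(\<integral>x. \<Delta> x \<partial>lebesgue_on G) - D (\<epsilon> *\<^sub>R \<theta>)\<bar> = \<bar>\<integral>x. \<Delta> x - F x \<partial>lebesgue_on G\<bar>"
    unfolding DF using \<Delta>i Fi by simp
  also have "\<dots> \<le> (\<integral>x. indicator (layer \<delta>) x * (2 * L * \<epsilon>) \<partial>lebesgue_on G)"
  proof (rule order_trans[OF integral_abs_bound], rule integral_mono)
    show "integrable (lebesgue_on G) (\<lambda>x. \<bar>\<Delta> x - F x\<bar>)" using \<Delta>i Fi by simp
    show "integrable (lebesgue_on G) (\<lambda>x. indicator (layer \<delta>) x * (2 * L * \<epsilon>))"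
    proof (rule finG.integrable_const_bound[of _ "2 * L * \<epsilon>"])
      show "(\<lambda>x. indicator (layer \<delta>) x * (2 * L * \<epsilon>)) \<in> borel_measurable (lebesgue_on G)"
        using layer_lmeasurable[of \<delta>]
          by (intro measurable_restrict_space1 borel_measurable_times borel_measurable_indicator) auto
    qed (use L_nonneg eps_pos in \<open>auto simp: indicator_def\<close>)
  qed (use pt in simp)
  also have "\<dots> = (\<integral>x. indicator G x *\<^sub>R (indicator (layer \<delta>) x * (2 * L * \<epsilon>)) \<partial>lebesgue)"
    by (rule integral_restrict_space) (use G_sets in simp)
  also have "\<dots> = (\<integral>x. indicator (G \<inter> layer \<delta>) x * (2 * L * \<epsilon>) \<partial>lebesgue)"
    by (intro Bochner_Integration.integral_cong) (auto simp: indicator_def)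
  also have "\<dots> = measure lebesgue (G \<inter> layer \<delta>) * (2 * L * \<epsilon>)"
    using fmeasurable.Int[OF G_lmeasurable layer_lmeasurable] by simp
  also have "\<dots> \<le> measure lebesgue (layer \<delta>) * (2 * L * \<epsilon>)"
    using L_nonneg eps_pos layer_lmeasurable[of \<delta>] G_sets
    by (intro mult_right_mono measure_mono_fmeasurable) auto
  finally have "real N * \<bar>(\<integral>x. \<Delta> x \<partial>lebesgue_on G) - D (\<epsilon> *\<^sub>R \<theta>)\<bar> \<le>
    real N * (measure lebesgue (layer \<delta>) * (2 * L * \<epsilon>))"
    by (intro mult_left_mono) auto
  also have "\<dots> = 2 * L * (real N * \<epsilon>) * measure lebesgue (layer \<delta>)" by simp
  also have "real N * \<bar>(\<integral>x. \<Delta> x \<partial>lebesgue_on G) - D (\<epsilon> *\<^sub>R \<theta>)\<bar> = \<bar>real N * (\<integral>x. \<Delta> x \<partial>lebesgue_on G) -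
    real N * D (\<epsilon> *\<^sub>R \<theta>)\<bar>"
    by (simp add: right_diff_distrib[symmetric] abs_mult)
  finally show ?thesis unfolding sum N_eps .
qed

end

section \<open>Rational dependence of the translation vectors\<close>

text \<open>The space is regarded as a vector space over the rationals. As x is outside the rational
  span of u and w, the value 1 at x and 0 on that span can be extended along a Hamel basis. Since u
  and w may be dependent, an independent subset B of them is taken first.\<close>

lemma additive_functional:
  fixes u w x :: "'b::real_vector"
  assumes "\<And>(a::rat) (b::rat). x \<noteq> of_rat a *\<^sub>R u + of_rat b *\<^sub>R w"
  obtains f :: "'b \<Rightarrow> real" where "\<And>x y. f (x + y) = f x + f y" "f u = 0" "f w = 0" "f x = 1"
proof -
  let ?s = "\<lambda>(q::rat) (x::'b). of_rat q *\<^sub>R x" and ?t = "\<lambda>(q::rat) (x::real). of_rat q * x"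
  interpret Q: vector_space ?s by unfold_locales (auto simp: algebra_simps of_rat_add of_rat_mult)
  interpret P: vector_space_pair ?s ?t
    by unfold_locales (auto simp: algebra_simps of_rat_add of_rat_mult)
  have x: "x \<notin> Q.span {u, w}"
  proof
    assume "x \<in> Q.span {u, w}"
    then obtain a b where "x - ?s a u = ?s b w"
      by (auto simp: Q.span_insert[of u] Q.span_singleton)
    then have "x = ?s a u + ?s b w" by (simp add: algebra_simps)
    then show False using assms by blast
  qed
  obtain B where B: "B \<subseteq> {u, w}" "Q.independent B" "{u, w} \<subseteq> Q.span B"
    using Q.maximal_independent_subset[of "{u, w}"] by blast
  have "Q.span B = Q.span {u, w}" using B Q.span_mono Q.span_minimal[OF B(3) Q.subspace_span]
    by blast
  then have "x \<notin> Q.span B" using x by simp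
  then have "Q.independent (insert x B)" using B(2) by (simp add: Q.independent_insertI)
  then obtain f
    where f: "Vector_Spaces.linear ?s ?t f" "\<And>y. y \<in> insert x B \<Longrightarrow> f y = (if y = x then 1 else 0)"
    using P.linear_independent_extend[of "insert x B" "\<lambda>y. if y = x then 1 else 0"] by blast
  have xB: "x \<notin> B" using \<open>x \<notin> Q.span B\<close> Q.span_base by blast
  have zero: "f y = 0" if "y \<in> Q.span B" for y
    by (rule P.linear_eq_0_on_span[OF f(1) _ that]) (use f(2) xB in auto)
  show thesis
  proof (rule that[of f])
    show "f (y + z) = f y + f z" for y z using P.linear_add[OF f(1)] .
    show "f u = 0" "f w = 0" using zero B(3) by auto
    show "f x = 1" using f(2)[of x] by simp
  qed
qed

lemma rat_common_denominator:
  assumes "finite (S :: rat set)" obtains d :: nat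
    where "d > 0" "\<And>r. r \<in> S \<Longrightarrow> \<exists>m::int. of_nat d * r = of_int m"
proof -
  have "\<exists>d::nat. d > 0 \<and> (\<forall>r\<in>S. \<exists>m::int. of_nat d * r = of_int m)"
    using assms
  proof induction
    case empty show ?case by (intro exI[of _ 1]) simp
  next
    case (insert r S)
    then obtain d where d: "d > 0" "\<And>r. r \<in> S \<Longrightarrow> \<exists>m::int. of_nat d * r = of_int m" by blast
    obtain a b where ab: "quotient_of r = (a, b)" by fastforce
    have b: "b > 0" "r = of_int a / of_int b"
      using quotient_of_denom_pos[OF ab] quotient_of_div[OF ab] by auto
    have "\<exists>m::int. of_nat (nat b * d) * s = of_int m" if "s \<in> insert r S" for s
    proof (cases "s = r")
      case True
      have "of_nat (nat b * d) * s = (of_int (int d * a) :: rat)" using b True by simp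
      then show ?thesis by blast
    next
      case False
      then obtain m :: int where "of_nat d * s = of_int m" using d(2) \<open>s \<in> insert r S\<close> by blast
      then have "of_nat (nat b * d) * s = (of_int (b * m) :: rat)" using b by (simp add: mult.assoc)
      then show ?thesis by blast
    qed
    then show ?case using d(1) b(1) by (intro exI[of _ "nat b * d"]) auto
  qed
  then show thesis using that by blast
qed

context convex_pattern
begin

lemma additive_of_nat:
  fixes f :: "'b::real_vector \<Rightarrow> real"
  assumes add: "\<And>x y. f (x + y) = f x + f y" shows "f (real m *\<^sub>R x) = real m * f x"
proof (induction m)
  case 0 show ?case using add[of 0 0] by simp
next
  case (Suc m)
  have "real (Suc m) *\<^sub>R x = real m *\<^sub>R x + x" by (simp add: algebra_simps)
  then have "f (real (Suc m) *\<^sub>R x) = f (real m *\<^sub>R x) + f x" by (simp only: add)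
  then show ?case using Suc by (simp add: algebra_simps)
qed

lemma measure_inside_pos: "measure lebesgue I > 0"
proof (rule ccontr)
  assume "\<not> measure lebesgue I > 0"
  then have "measure lebesgue I = 0" using measure_nonneg[of lebesgue I] by linarith
  moreover have "I \<in> lmeasurable"
    using open_inside_boundary bounded_inside_boundary by (simp add: lmeasurable_open)
  ultimately have "negligible I" by (simp add: negligible_iff_measure)
  then show False using inside_not_negligible by simp
qed

text \<open>The number N of samples is a locale parameter in \<open>average_cocycle\<close>. Here m
  and T are fixed before N and \<delta>, as the limit in N requires.\<close>

lemma tau_average:
  assumes pp: "purely_periodic M" and i: "i < n"
    and add: "\<And>x y. f (x + y) = f x + (f y :: real)" and lip: "L-lipschitz_on UNIV h"
    and equi: "\<And>i x. i < n \<Longrightarrow> x \<in> edge vs i \<Longrightarrow> h (x + \<tau> i) = h x + f (\<tau> i)"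
  shows "\<exists>m::nat. \<exists>T::real. m > 0 \<and> T > 0 \<and> (\<forall>N \<delta>. N > 0 \<longrightarrow> T / real N < \<delta> \<longrightarrow>
      \<bar>measure lebesgue I * (real m * f (\<tau> i)) - real N * difference_integral.D I h ((1 / real N) *\<^sub>R real m *\<^sub>R \<tau> i)\<bar>
     \<le> 2 * L * T * measure lebesgue (difference_integral.layer I \<delta>))"
proof -
  obtain T m \<theta> where T: "T > 0" "(m::nat) > 0" "T *\<^sub>R \<theta> = real m *\<^sub>R \<tau> i" "norm \<theta> = 1"
    "negligible {x \<in> I. \<not> flows M \<theta> T (q x) (q x)}"
    by (rule tau_periodic[OF pp i])
  show ?thesis
  proof (intro exI[of _ m] exI[of _ T] conjI T(1,2) allI impI)
    fix N :: nat and \<delta> :: real assume N: "N > 0" "T / real N < \<delta>"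
    interpret periodic_flow_step M vs \<sigma> q \<theta> T N by unfold_locales (use T N in auto)
    have "f (T *\<^sub>R \<theta>) = real m * f (\<tau> i)" unfolding T(3) by (rule additive_of_nat[OF add])
    moreover have "\<epsilon> *\<^sub>R \<theta> = (1 / real N) *\<^sub>R (T *\<^sub>R \<theta>)" by (simp add: \<epsilon>_def)
    then have "\<epsilon> *\<^sub>R \<theta> = (1 / real N) *\<^sub>R real m *\<^sub>R \<tau> i" unfolding T(3) .
    ultimately show "\<bar>measure lebesgue I * (real m * f (\<tau> i)) -
      real N * difference_integral.D I h ((1 / real N) *\<^sub>R real m *\<^sub>R \<tau> i)\<bar>
       \<le> 2 * L * T * measure lebesgue (difference_integral.layer I \<delta>)"
      using average_cocycle[OF add lip equi, of \<delta>] N(2) by (simp add: \<epsilon>_def)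
  qed
qed

text \<open>Along each translation vector the difference integral of the interpolating function has
  derivative proportional to the value of the additive function, and that derivative is
  \<open>\<real>\<close>-linear in the direction.\<close>

lemma additive_vanishes:
  assumes pp: "purely_periodic M" and i: "i0 < n" "i1 < n" "j < n"
    and np: "\<And>c. \<tau> i1 \<noteq> c *\<^sub>R \<tau> i0"
    and add: "\<And>x y. f (x + y) = f x + (f y :: real)" and f0: "f (\<tau> i0) = 0" "f (\<tau> i1) = 0"
  shows "f (\<tau> j) = 0"
proof -
  obtain L h
    where h: "L-lipschitz_on UNIV h" "\<And>i x. i < n \<Longrightarrow> x \<in> edge vs i \<Longrightarrow> h (x + \<tau> i) = h x + f (\<tau> i)"
    by (rule equivariant_lipschitz[of f, OF add], rule that)
  interpret difference_integral I h L
    by unfold_locales (rule open_inside_boundary bounded_inside_boundary h)+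
  have null: "null_direction (\<tau> i)" if i: "i < n" "f (\<tau> i) = 0" for i
  proof -
    obtain m :: nat and T where m: "m > 0" "T > 0" and avg: "\<And>N \<delta>. N > 0 \<Longrightarrow> T / real N < \<delta> \<Longrightarrow>
      \<bar>measure lebesgue I * (real m * f (\<tau> i)) - real N * D ((1 / real N) *\<^sub>R real m *\<^sub>R \<tau> i)\<bar>
      \<le> 2 * L * T * measure lebesgue (layer \<delta>)"
      using tau_average[OF pp i(1) add h] by blast
    let ?u = "real m *\<^sub>R \<tau> i"
    have "null_direction ?u" unfolding null_direction_def
    proof (intro allI impI)
      fix \<eta> :: real assume \<eta>: "\<eta> > 0"
      \<comment> \<open>The factor 8 turns the error 2 L T into at most \<eta>/4. The later estimate
        1/N \<le> 2 \<epsilon> doubles this, and the Lipschitz correction uses up the other half of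
        \<eta>.\<close>
      let ?K = "8 * L * T + 1"
      have K: "?K > 0" using L_nonneg m(2) by (simp add: add_nonneg_pos)
      obtain d where d: "d > 0" "measure lebesgue (layer d) < \<eta> / ?K"
        using layer_small[of "\<eta> / ?K"] \<eta> K by auto
      define S where "S = L * measure lebesgue I * norm ?u"
      have S: "S \<ge> 0" unfolding S_def using L_nonneg by simp
      \<comment> \<open>For \<epsilon> < 1/Z the integer N below exceeds T/d, so that the average
        applies, exceeds 2 S/\<eta>, so that the Lipschitz correction is small, and exceeds
        1.\<close>
      define Z where "Z = T / d + 2 * S / \<eta> + 2"
      have Td: "T / d > 0" and S\<eta>: "2 * S / \<eta> \<ge> 0" using m(2) d(1) S \<eta> by auto
      have Z: "Z > 0" using Td S\<eta> by (simp add: Z_def)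
      have "\<bar>D (\<epsilon> *\<^sub>R ?u)\<bar> \<le> \<eta> * \<epsilon>" if \<epsilon>: "0 < \<epsilon>" "\<epsilon> < 1 / Z" for \<epsilon>
      proof -
        \<comment> \<open>The closest sampled value from above: 1/N and \<epsilon> differ by at most
          \<epsilon>/N.\<close>
        define N where "N = nat \<lfloor>1 / \<epsilon>\<rfloor>"
        have Ze: "Z < 1 / \<epsilon>" using \<epsilon> Z by (simp add: field_simps)
        have "1 / \<epsilon> > 0" using \<epsilon> by simp
        then have "real N = of_int \<lfloor>1 / \<epsilon>\<rfloor>" unfolding N_def by simp
        then have N1: "real N \<le> 1 / \<epsilon>" "1 / \<epsilon> < real N + 1" by linarith+
        then have N2: "real N > T / d + 2 * S / \<eta> + 1" using Ze by (simp add: Z_def)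
        have Npos: "real N > 1" using N2 Td S\<eta> by linarith
        have "real N > T / d" using N2 S\<eta> by linarith
        then have "T / real N < d" using Npos d(1) by (simp add: field_simps)
        then have "real N * \<bar>D ((1 / real N) *\<^sub>R ?u)\<bar> \<le> 2 * L * T * measure lebesgue (layer d)"
          using avg[of N d] Npos i(2) by (simp add: abs_mult)
        also have "\<dots> \<le> 2 * L * T * (\<eta> / ?K)" using d(2) L_nonneg m(2) by (intro mult_left_mono) auto
        also have "\<dots> \<le> \<eta> / 4" using K \<eta> L_nonneg m(2) by (simp add: field_simps)
        finally have "\<bar>D ((1 / real N) *\<^sub>R ?u)\<bar> \<le> \<eta> / 4 * (1 / real N)" using Npos
          by (simp add: field_simps)
        also have "1 / real N \<le> 2 * \<epsilon>"
        proof -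
          have "1 < \<epsilon> * (real N + 1)" using N1(2) \<epsilon>(1) by (simp add: field_simps)
          also have "\<dots> \<le> \<epsilon> * (2 * real N)" using \<epsilon>(1) Npos by (intro mult_left_mono) auto
          finally show ?thesis using Npos by (simp add: field_simps)
        qed
        finally have a: "\<bar>D ((1 / real N) *\<^sub>R ?u)\<bar> \<le> \<eta> / 2 * \<epsilon>" using \<eta>
          by (simp add: mult_left_mono mult.commute)
        have "\<bar>D (\<epsilon> *\<^sub>R ?u) - D ((1 / real N) *\<^sub>R ?u)\<bar> \<le> L * measure lebesgue I * norm (\<epsilon> *\<^sub>R ?u -
          (1 / real N) *\<^sub>R ?u)"
          by (rule D_lipschitz)
        also have "norm (\<epsilon> *\<^sub>R ?u - (1 / real N) *\<^sub>R ?u) = \<bar>\<epsilon> - 1 / real N\<bar> * norm ?u"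
          by (simp only: scaleR_left_diff_distrib[symmetric] norm_scaleR)
        also have "L * measure lebesgue I * (\<bar>\<epsilon> - 1 / real N\<bar> * norm ?u) = S * \<bar>\<epsilon> - 1 / real N\<bar>"
          by (simp add: S_def)
        also have "\<dots> \<le> S * (\<epsilon> / real N)"
        proof (intro mult_left_mono S)
          have "\<epsilon> * real N \<le> 1" "1 < \<epsilon> * (real N + 1)" using N1 \<epsilon>(1) by (simp_all add: field_simps)
          then have "\<epsilon> \<le> 1 / real N" "1 / real N \<le> (\<epsilon> * real N + \<epsilon>) / real N"
            using Npos by (auto simp: pos_le_divide_eq algebra_simps intro!: divide_right_mono)
          moreover have "(\<epsilon> * real N + \<epsilon>) / real N = \<epsilon> + \<epsilon> / real N" using Npos
            by (simp add: add_divide_distrib)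
          ultimately show "\<bar>\<epsilon> - 1 / real N\<bar> \<le> \<epsilon> / real N" by linarith
        qed
        also have "\<dots> \<le> \<eta> / 2 * \<epsilon>"
        proof -
          have "2 * S / \<eta> \<le> real N" using N2 Td by linarith
          then have "2 * S \<le> \<eta> * real N" using \<eta> by (simp add: field_simps)
          then have "S / real N \<le> \<eta> / 2" using Npos by (simp add: field_simps)
          then have "S / real N * \<epsilon> \<le> \<eta> / 2 * \<epsilon>" using \<epsilon>(1) by (intro mult_right_mono) auto
          then show ?thesis by simp
        qed
        finally have b: "\<bar>D (\<epsilon> *\<^sub>R ?u) - D ((1 / real N) *\<^sub>R ?u)\<bar> \<le> \<eta> / 2 * \<epsilon>" .
        have "\<bar>x\<bar> \<le> 2 * z" if "\<bar>y\<bar> \<le> z" "\<bar>x - y\<bar> \<le> z" for x y z :: real using that by linarith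
        from this[OF a b] show ?thesis by simp
      qed
      then show "\<exists>\<delta>>0. \<forall>\<epsilon>. 0 < \<epsilon> \<longrightarrow> \<epsilon> < \<delta> \<longrightarrow> \<bar>D (\<epsilon> *\<^sub>R ?u)\<bar> \<le> \<eta> * \<epsilon>" using Z
        by (intro exI[of _ "1 / Z"]) auto
    qed
    then have "null_direction ((1 / real m) *\<^sub>R ?u)" by (rule null_direction_scaleR)
    then show ?thesis using m(1) by simp
  qed
  have all: "null_direction u" for u
  proof -
    obtain y :: "real^2" where "u = (y$1) *\<^sub>R \<tau> i0 + (y$2) *\<^sub>R \<tau> i1"
      using surj_combination_pair[OF np tau_nonzero[OF i(1)]] unfolding surj_def by blast
    then show ?thesis using null_direction_add null_direction_scaleR null i f0 by simp
  qed
  obtain m :: nat and T where m: "m > 0" "T > 0" and avg: "\<And>N \<delta>. N > 0 \<Longrightarrow> T / real N < \<delta> \<Longrightarrow>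
    \<bar>measure lebesgue I * (real m * f (\<tau> j)) - real N * D ((1 / real N) *\<^sub>R real m *\<^sub>R \<tau> j)\<bar>
    \<le> 2 * L * T * measure lebesgue (layer \<delta>)"
    using tau_average[OF pp i(3) add h] by blast
  let ?c = "measure lebesgue I * (real m * f (\<tau> j))"
  \<comment> \<open>Now the average is read the other way: with every direction null, both the term
    in \<open>D\<close> and the layer term are small, so the constant \<open>?c\<close> must
    vanish.\<close>
  have "\<bar>?c\<bar> \<le> 0 + e" if e: "e > 0" for e
  proof -
    let ?K = "2 * L * T + 1"
    have K: "?K > 0" using L_nonneg m(2) by (simp add: add_nonneg_pos)
    define \<eta> where "\<eta> = e / (2 * ?K)"
    have \<eta>: "\<eta> > 0" using e K by (simp add: \<eta>_def)
    obtain d where d: "d > 0" "measure lebesgue (layer d) < \<eta>" using layer_small[OF \<eta>] by blast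
    obtain d' where d': "d' > 0" "\<And>\<epsilon>. 0 < \<epsilon> \<Longrightarrow> \<epsilon> < d' \<Longrightarrow> \<bar>D (\<epsilon> *\<^sub>R real m *\<^sub>R \<tau> j)\<bar> \<le> \<eta> * \<epsilon>"
      using all[of "real m *\<^sub>R \<tau> j"] \<eta> unfolding null_direction_def by blast
    obtain N :: nat where N: "real N > T / d + 1 / d'" using reals_Archimedean2 by blast
    have pos: "T / d > 0" "1 / d' > 0" using m(2) d(1) d'(1) by auto
    then have N0: "real N > 0" using N by linarith
    have "real N > T / d" "real N > 1 / d'" using N pos by linarith+
    then have N': "T / real N < d" "1 / real N < d'" using N0 d(1) d'(1)
      by (simp_all add: field_simps)
    have "\<bar>D ((1 / real N) *\<^sub>R real m *\<^sub>R \<tau> j)\<bar> \<le> \<eta> * (1 / real N)"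
      using d'(2)[of "1 / real N"] N'(2) N0 by simp
    then have "real N * \<bar>D ((1 / real N) *\<^sub>R real m *\<^sub>R \<tau> j)\<bar> \<le> real N * (\<eta> * (1 / real N))"
      by (rule mult_left_mono) simp
    then have 1: "\<bar>real N * D ((1 / real N) *\<^sub>R real m *\<^sub>R \<tau> j)\<bar> \<le> \<eta>" using N0
      by (simp add: abs_mult)
    have "2 * L * T * measure lebesgue (layer d) \<le> 2 * L * T * \<eta>" using d(2) L_nonneg m(2)
      by (intro mult_left_mono) auto
    then have 2: "\<bar>?c - real N * D ((1 / real N) *\<^sub>R real m *\<^sub>R \<tau> j)\<bar> \<le> 2 * L * T * \<eta>"
      using avg[of N d] N'(1) N0 by simp
    have "\<bar>x\<bar> \<le> z + w" if "\<bar>y\<bar> \<le> z" "\<bar>x - y\<bar> \<le> w" for x y z w :: real using that by linarith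
    from this[OF 1 2] have "\<bar>?c\<bar> \<le> ?K * \<eta>" by (simp add: algebra_simps)
    also have "\<dots> = e / 2"
    proof -
      have "k * (e / (2 * k)) = e / 2" if "k > 0" for k :: real using that by simp
      from this[OF K] show ?thesis unfolding \<eta>_def .
    qed
    finally show ?thesis using e by simp
  qed
  then have "\<bar>?c\<bar> \<le> 0" by (rule field_le_epsilon)
  then show ?thesis using m(1) measure_inside_pos by simp
qed

lemma tau_lattice:
  assumes "purely_periodic M"
  obtains a b
    where "a \<noteq> 0" "\<And>c. b \<noteq> c *\<^sub>R a" "\<And>i. i < n \<Longrightarrow> \<exists>k l::int. \<tau> i = of_int k *\<^sub>R a + of_int l *\<^sub>R b"
proof -
  let ?u = "\<tau> 0"
  have u: "?u \<noteq> 0" by (rule tau_nonzero[OF n_pos])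
  \<comment> \<open>A vector orthogonal to \<open>?u\<close>: a translation vector with nonzero
    product with p cannot be parallel to \<open>?u\<close>.\<close>
  define p :: "real^2" where "p = vector [- (?u$2), ?u$1]"
  have "p \<noteq> 0" using u by (auto simp: p_def vec_eq_iff forall_2)
  moreover have pu: "p \<bullet> ?u = 0" by (simp add: p_def inner_vec_def sum_2 algebra_simps)
  ultimately obtain i1 where i1: "i1 < n" "p \<bullet> \<tau> i1 \<noteq> 0" using tau_spanning by blast
  let ?w = "\<tau> i1"
  have np: "?w \<noteq> c *\<^sub>R ?u" for c
  proof
    assume "?w = c *\<^sub>R ?u"
    then have "p \<bullet> ?w = c * (p \<bullet> ?u)" by (simp only: inner_scaleR_right)
    then show False using i1(2) pu by simp
  qed
  have "\<exists>a b::rat. \<tau> j = of_rat a *\<^sub>R ?u + of_rat b *\<^sub>R ?w" if j: "j < n" for j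
  proof (rule ccontr)
    assume *: "\<not> (\<exists>a b::rat. \<tau> j = of_rat a *\<^sub>R ?u + of_rat b *\<^sub>R ?w)"
    obtain f :: "real^2 \<Rightarrow> real"
      where f: "\<And>x y. f (x + y) = f x + f y" "f ?u = 0" "f ?w = 0" "f (\<tau> j) = 1"
      by (rule additive_functional[of "\<tau> j" ?u ?w]) (use * in blast)+
    then show False using additive_vanishes[OF assms n_pos i1(1) j np f(1-3)] by simp
  qed
  then obtain ra rb :: "nat \<Rightarrow> rat"
    where r: "\<And>j. j < n \<Longrightarrow> \<tau> j = of_rat (ra j) *\<^sub>R ?u + of_rat (rb j) *\<^sub>R ?w" by metis
  \<comment> \<open>Dividing \<open>?u\<close> and \<open>?w\<close> by a common denominator of all
    coefficients turns the rational combinations into integral ones.\<close>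
  obtain d :: nat
    where d: "d > 0" "\<And>r. r \<in> ra ` {..<n} \<union> rb ` {..<n} \<Longrightarrow> \<exists>m::int. of_nat d * r = of_int m"
    using rat_common_denominator[of "ra ` {..<n} \<union> rb ` {..<n}"] by auto
  have scale: "\<exists>k::int. of_rat r *\<^sub>R x = of_int k *\<^sub>R ((1 / real d) *\<^sub>R x)"
    if "r \<in> ra ` {..<n} \<union> rb ` {..<n}" for r and x :: "real^2"
  proof -
    obtain k :: int where "of_nat d * r = of_int k" using d(2) \<open>r \<in> _\<close> by blast
    then have "(of_rat (of_nat d * r) :: real) = of_rat (of_int k)" by simp
    then have "real d * of_rat r = of_int k" by (simp add: of_rat_mult)
    then have "of_rat r = of_int k * (1 / real d)" using d(1) by (simp add: field_simps)
    then show ?thesis by (intro exI[of _ k]) simp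
  qed
  show thesis
  proof (rule that[of "(1 / real d) *\<^sub>R ?u" "(1 / real d) *\<^sub>R ?w"])
    show "(1 / real d) *\<^sub>R ?u \<noteq> 0" using u d(1) by simp
    show "(1 / real d) *\<^sub>R ?w \<noteq> c *\<^sub>R (1 / real d) *\<^sub>R ?u" for c
    proof
      assume "(1 / real d) *\<^sub>R ?w = c *\<^sub>R (1 / real d) *\<^sub>R ?u"
      then have "real d *\<^sub>R (1 / real d) *\<^sub>R ?w = real d *\<^sub>R c *\<^sub>R (1 / real d) *\<^sub>R ?u"
        by (simp only:)
      then show False using np[of c] d(1) by simp
    qed
    fix i assume i: "i < n"
    obtain k where k: "of_rat (ra i) *\<^sub>R ?u = of_int k *\<^sub>R ((1 / real d) *\<^sub>R ?u)"
      using scale[of "ra i" ?u] i by blast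
    obtain l where l: "of_rat (rb i) *\<^sub>R ?w = of_int l *\<^sub>R ((1 / real d) *\<^sub>R ?w)"
      using scale[of "rb i" ?w] i by blast
    have "\<tau> i = of_int k *\<^sub>R (1 / real d) *\<^sub>R ?u + of_int l *\<^sub>R (1 / real d) *\<^sub>R ?w"
      using r[OF i] unfolding k l .
    then show "\<exists>k l::int. \<tau> i = of_int k *\<^sub>R (1 / real d) *\<^sub>R ?u + of_int l *\<^sub>R (1 / real d) *\<^sub>R ?w"
      by blast
  qed
qed

end

section \<open>Plane lattices and tori\<close>

locale plane_lattice =
  fixes a b :: "real^2"
  assumes a_nonzero: "a \<noteq> 0" and not_parallel: "\<And>c. b \<noteq> c *\<^sub>R a"
begin

definition \<Lambda> :: "(real^2) set" where
  "\<Lambda> = {of_int k *\<^sub>R a + of_int l *\<^sub>R b | k l. True}"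

lemma latticeI: "of_int k *\<^sub>R a + of_int l *\<^sub>R b \<in> \<Lambda>" unfolding \<Lambda>_def by blast

lemma is_lattice: "is_lattice \<Lambda>"
proof -
  have "b \<notin> span {a}" using not_parallel by (auto simp: span_singleton)
  moreover have "a \<noteq> b" using not_parallel[of 1] by simp
  ultimately have "independent {a, b}" using a_nonzero
    by (simp add: insert_commute[of a b] independent_insert)
  then show ?thesis using \<open>a \<noteq> b\<close> unfolding is_lattice_def \<Lambda>_def by blast
qed

lemma zero_mem: "0 \<in> \<Lambda>" using latticeI[of 0 0] by simp

lemma add_mem: assumes "x \<in> \<Lambda>" "y \<in> \<Lambda>" shows "x + y \<in> \<Lambda>"
proof -
  obtain k l k' l'
    where "x = of_int k *\<^sub>R a + of_int l *\<^sub>R b" "y = of_int k' *\<^sub>R a + of_int l' *\<^sub>R b"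
    using assms unfolding \<Lambda>_def by blast
  then have "x + y = of_int (k + k') *\<^sub>R a + of_int (l + l') *\<^sub>R b" by (simp add: algebra_simps)
  then show ?thesis using latticeI by metis
qed

lemma minus_mem: assumes "x \<in> \<Lambda>" shows "- x \<in> \<Lambda>"
proof -
  obtain k l where "x = of_int k *\<^sub>R a + of_int l *\<^sub>R b" using assms unfolding \<Lambda>_def by blast
  then have "- x = of_int (- k) *\<^sub>R a + of_int (- l) *\<^sub>R b" by simp
  then show ?thesis using latticeI by metis
qed

text \<open>An injective linear map is bounded below, so the integer coefficients of the lattice
  points in a bounded set are bounded.\<close>

lemma finite_bounded:
  assumes "bounded S" shows "finite (S \<inter> \<Lambda>)"
proof -
  define f :: "real^2 \<Rightarrow> real^2" where "f y = (y$1) *\<^sub>R a + (y$2) *\<^sub>R b" for y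
  have "linear f" "inj f"
    using linear_combination_pair[OF not_parallel a_nonzero] inj_combination_pair[OF not_parallel a_nonzero] by (simp_all add: f_def[abs_def])
  then obtain B where B: "B > 0" "\<And>x. B * norm x \<le> norm (f x)" using linear_inj_bounded_below_pos
    by blast
  obtain K where K: "\<And>x. x \<in> S \<Longrightarrow> norm x \<le> K" using assms bounded_iff by blast
  define m where "m = \<lceil>K / B\<rceil>"
  have "S \<inter> \<Lambda> \<subseteq> (\<lambda>(k, l). of_int k *\<^sub>R a + of_int l *\<^sub>R b) ` ({- m..m} \<times> {- m..m})"
  proof
    fix x assume x: "x \<in> S \<inter> \<Lambda>"
    then obtain k l where kl: "x = of_int k *\<^sub>R a + of_int l *\<^sub>R b" unfolding \<Lambda>_def by blast
    define y :: "real^2" where "y = vector [of_int k, of_int l]"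
    have "x = f y" by (simp add: f_def y_def kl)
    then have "B * norm y \<le> K" using B(2)[of y] K[of x] x by simp
    then have ny: "norm y \<le> K / B" using B(1) by (simp add: field_simps)
    have "\<bar>real_of_int k\<bar> \<le> norm y" "\<bar>real_of_int l\<bar> \<le> norm y"
      using component_le_norm_cart[of y 1] component_le_norm_cart[of y 2] by (simp_all add: y_def)
    then have "\<bar>real_of_int k\<bar> \<le> of_int m" "\<bar>real_of_int l\<bar> \<le> of_int m" using ny unfolding m_def
      by linarith+
    then have "(k, l) \<in> {- m..m} \<times> {- m..m}" by auto
    then show "x \<in> (\<lambda>(k, l). of_int k *\<^sub>R a + of_int l *\<^sub>R b) ` ({- m..m} \<times> {- m..m})" using kl
      by force
  qed
  then show ?thesis using finite_subset by blast
qed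

lemma not_islimpt: "\<not> x islimpt \<Lambda>"
  using finite_bounded[OF bounded_ball, of x 1] zero_less_one unfolding islimpt_eq_infinite_ball
    by (metis Int_commute)

lemma lattice_closed: "closed \<Lambda>"
  using not_islimpt by (simp add: closed_limpt)

lemma lattice_countable: "countable \<Lambda>"
proof -
  have "\<Lambda> = (\<lambda>(k, l). of_int k *\<^sub>R a + of_int l *\<^sub>R b) ` UNIV" unfolding \<Lambda>_def by auto
  then show ?thesis by simp
qed

lemma separation:
  obtains \<delta> where "\<delta> > 0" "\<And>l. l \<in> \<Lambda> \<Longrightarrow> norm l < \<delta> \<Longrightarrow> l = 0"
proof -
  obtain \<delta> where "\<delta> > 0" "\<forall>x\<in>\<Lambda>. x \<noteq> 0 \<longrightarrow> \<delta> \<le> dist x 0"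
    using not_islimpt[of 0] unfolding islimpt_approachable by (meson not_le)
  then show thesis by (intro that[of \<delta>]) (auto simp: not_less)
qed

abbreviation "\<pi> \<equiv> coset \<Lambda>"
abbreviation "\<T> \<equiv> torus_topology \<Lambda>"

lemma coset_eq_iff: "\<pi> x = \<pi> y \<longleftrightarrow> y - x \<in> \<Lambda>"
proof
  assume "\<pi> x = \<pi> y"
  moreover have "y \<in> \<pi> y" unfolding coset_def using zero_mem by force
  ultimately have "y \<in> \<pi> x" by simp
  then show "y - x \<in> \<Lambda>" unfolding coset_def by auto
next
  assume *: "y - x \<in> \<Lambda>"
  have "u + l \<in> \<pi> w" if "u - w \<in> \<Lambda>" "l \<in> \<Lambda>" for u w l
  proof -
    have "u + l = w + ((u - w) + l)" by simp
    then show ?thesis unfolding coset_def using add_mem[OF that] by (rule image_eqI)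
  qed
  from this[OF *] this[of x y] minus_mem[OF *] show "\<pi> x = \<pi> y" unfolding coset_def by auto
qed

lemma coset_vimage_image: "\<pi> -` \<pi> ` S = (\<Union>l\<in>\<Lambda>. (+) l ` S)"
proof
  show "\<pi> -` \<pi> ` S \<subseteq> (\<Union>l\<in>\<Lambda>. (+) l ` S)"
  proof
    fix x assume "x \<in> \<pi> -` \<pi> ` S"
    then obtain s where s: "s \<in> S" "\<pi> s = \<pi> x" by auto
    then have "x - s \<in> \<Lambda>" "x = (x - s) + s" by (auto simp: coset_eq_iff)
    then show "x \<in> (\<Union>l\<in>\<Lambda>. (+) l ` S)" using s(1) by blast
  qed
  show "(\<Union>l\<in>\<Lambda>. (+) l ` S) \<subseteq> \<pi> -` \<pi> ` S"
  proof
    fix x assume "x \<in> (\<Union>l\<in>\<Lambda>. (+) l ` S)"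
    then obtain l s where ls: "l \<in> \<Lambda>" "s \<in> S" "x = l + s" by blast
    then have "\<pi> s = \<pi> x" by (simp add: coset_eq_iff)
    then show "x \<in> \<pi> -` \<pi> ` S" using ls(2) by (metis imageI vimageI)
  qed
qed

lemma coset_open_image: "open U \<Longrightarrow> openin \<T> (\<pi> ` U)"
  unfolding openin_torus_topology coset_vimage_image by (auto intro!: open_UN open_translation)

text \<open>As \<Lambda> is closed, \<open>y - x\<close> keeps a distance e from it, and balls of
  radius e/2 have disjoint projections.\<close>

lemma Hausdorff_torus: "Hausdorff_space \<T>"
  unfolding Hausdorff_space_def
proof (intro allI impI)
  fix X Y assume "X \<in> topspace \<T> \<and> Y \<in> topspace \<T> \<and> X \<noteq> Y"
  then obtain x y where xy: "X = \<pi> x" "Y = \<pi> y" "X \<noteq> Y" by auto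
  then have xy': "y - x \<notin> \<Lambda>" using coset_eq_iff by simp
  have "open (- \<Lambda>)" using lattice_closed by (simp add: open_Compl)
  then obtain e where e: "e > 0" "ball (y - x) e \<subseteq> - \<Lambda>" using xy' unfolding open_contains_ball
    by blast
  have "disjnt (\<pi> ` ball x (e/2)) (\<pi> ` ball y (e/2))"
    unfolding disjnt_def
  proof (rule ccontr)
    assume "\<pi> ` ball x (e/2) \<inter> \<pi> ` ball y (e/2) \<noteq> {}"
    then obtain u w where uw: "u \<in> ball x (e/2)" "w \<in> ball y (e/2)" "\<pi> u = \<pi> w" by auto
    then have wu: "w - u \<in> \<Lambda>" using coset_eq_iff by simp
    have "(y - x) - (w - u) = (y - w) - (x - u)" by simp
    also have "norm \<dots> \<le> norm (y - w) + norm (x - u)" by (rule norm_triangle_ineq4)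
    also have "\<dots> < e" using uw(1,2) by (simp add: dist_norm)
    finally have "w - u \<in> ball (y - x) e" by (simp add: dist_norm)
    then show False using e(2) wu by blast
  qed
  then show "\<exists>U V. openin \<T> U \<and> openin \<T> V \<and> X \<in> U \<and> Y \<in> V \<and> disjnt U V"
    using e(1) xy(1,2)
      by (intro exI[of _ "\<pi> ` ball x (e/2)"] exI[of _ "\<pi> ` ball y (e/2)"]) (auto intro: coset_open_image)
qed

lemma coset_continuous: "continuous_map (top_of_set S) \<T> \<pi>"
  using quotient_imp_continuous_map[OF quotient_map_coset] continuous_map_from_subtopology by blast

end

section \<open>Proper local homeomorphisms are coverings\<close>

lemma Hausdorff_finite_separation:
  assumes "Hausdorff_space X" "finite D" "D \<subseteq> topspace X"
  obtains A
    where "\<And>x. x \<in> D \<Longrightarrow> openin X (A x) \<and> x \<in> A x" "\<And>x y. x \<in> D \<Longrightarrow> y \<in> D \<Longrightarrow> x \<noteq> y \<Longrightarrow> disjnt (A x) (A y)"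
proof -
  let ?S = "\<lambda>x y P. openin X (fst P) \<and> openin X (snd P) \<and> x \<in> fst P \<and> y \<in> snd P \<and>
    disjnt (fst P) (snd P)"
  define P where "P x y = (SOME P. ?S x y P)" for x y
  have P: "?S x y (P x y)" if xy: "x \<in> D" "y \<in> D" "x \<noteq> y" for x y
  proof -
    have "x \<in> topspace X" "y \<in> topspace X" using xy assms(3) by auto
    then obtain U V where "openin X U \<and> openin X V \<and> x \<in> U \<and> y \<in> V \<and> disjnt U V"
      using assms(1) xy(3) unfolding Hausdorff_space_def by metis
    then have "?S x y (U, V)" by simp
    then show ?thesis unfolding P_def by (rule someI)
  qed
  \<comment> \<open>The chosen pair for (x, y) need not be the swap of the one for (y, x), so each
    neighbourhood is cut by its component of both.\<close>
  define A where "A x = topspace X \<inter> (\<Inter>y\<in>D - {x}. fst (P x y) \<inter> snd (P y x))" for x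
  show thesis
  proof (rule that)
    fix x assume x: "x \<in> D"
    have "openin X (A x)"
    proof (cases "D - {x} = {}")
      case True then show ?thesis by (simp only: A_def) simp
    next
      case False
      then show ?thesis unfolding A_def
        using assms(2) P x by (intro openin_Int openin_topspace openin_Inter) auto
    qed
    moreover have "x \<in> A x" unfolding A_def using P x assms(3) by auto
    ultimately show "openin X (A x) \<and> x \<in> A x" ..
  next
    fix x y assume xy: "x \<in> D" "y \<in> D" "x \<noteq> y"
    have "A x \<subseteq> fst (P x y)" "A y \<subseteq> snd (P x y)" unfolding A_def using xy by auto
    then show "disjnt (A x) (A y)" using P[OF xy] disjnt_subset1 disjnt_subset2 by metis
  qed
qed

text \<open>Disjoint neighbourhoods of the finitely many points over y are mapped homeomorphically.
  Compactness keeps the rest of the space from accumulating over y, so near y the whole preimage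
  lies in these sheets.\<close>

lemma proper_local_homeo_covering:
  assumes X: "compact_space X" "Hausdorff_space X" and Y: "Hausdorff_space Y"
    and cont: "continuous_map X Y p" and onto: "p ` topspace X = topspace Y"
    and B: "openin Y (topspace Y - B)"
    and fin: "\<And>y. y \<in> topspace Y - B \<Longrightarrow> finite {x \<in> topspace X. p x = y}"
    and loc: "\<And>x. x \<in> topspace X \<Longrightarrow> p x \<notin> B \<Longrightarrow> \<exists>U. openin X U \<and> x \<in> U \<and> openin Y (p ` U) \<and>
       homeomorphic_map (subtopology X U) (subtopology Y (p ` U)) p"
  shows "covering_map (subtopology X {x \<in> topspace X. p x \<notin> B}) (subtopology Y (topspace Y - B)) p"
proof -
  let ?X = "{x \<in> topspace X. p x \<notin> B}" and ?Y = "topspace Y - B"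
  have pX: "p x \<in> topspace Y" if "x \<in> topspace X" for x using onto that by blast
  have openX: "openin X ?X"
  proof -
    have "?X = {x \<in> topspace X. p x \<in> ?Y}" using pX by blast
    then show ?thesis using openin_continuous_map_preimage[OF cont B] by simp
  qed
  have c: "continuous_map (subtopology X ?X) (subtopology Y ?Y) p"
    using cont pX by (auto simp: continuous_map_in_subtopology continuous_map_from_subtopology)
  have o: "p ` topspace (subtopology X ?X) = topspace (subtopology Y ?Y)"
    using onto pX by (auto simp: image_iff)
  show ?thesis unfolding covering_map_def
  proof (intro conjI c o ballI)
    fix y assume "y \<in> topspace (subtopology Y ?Y)"
    then have y: "y \<in> ?Y" by simp
    define D where "D = {x \<in> topspace X. p x = y}"
    have finD: "finite D" and DX: "D \<subseteq> topspace X" using fin[OF y] by (auto simp: D_def)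
    obtain A where A: "\<And>x. x \<in> D \<Longrightarrow> openin X (A x) \<and> x \<in> A x"
      "\<And>x y. x \<in> D \<Longrightarrow> y \<in> D \<Longrightarrow> x \<noteq> y \<Longrightarrow> disjnt (A x) (A y)"
      using Hausdorff_finite_separation[OF X(2) finD DX] by metis
    have "\<forall>x\<in>D. \<exists>U. openin X U \<and> x \<in> U \<and> openin Y (p ` U) \<and>
      homeomorphic_map (subtopology X U) (subtopology Y (p ` U)) p"
      using loc y by (auto simp: D_def)
    then obtain U where U: "\<And>x. x \<in> D \<Longrightarrow> openin X (U x) \<and> x \<in> U x \<and> openin Y (p ` U x) \<and>
        homeomorphic_map (subtopology X (U x)) (subtopology Y (p ` U x)) p" by metis
    define Q where "Q x = A x \<inter> U x" for x
    have Q: "openin X (Q x)" "x \<in> Q x" "Q x \<subseteq> U x" if "x \<in> D" for x using A(1)[OF that] U[OF that]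
      by (auto simp: Q_def)
    have Q_dis: "disjnt (Q x) (Q x')" if "x \<in> D" "x' \<in> D" "x \<noteq> x'" for x x' using A(2)[OF that]
      by (auto simp: Q_def disjnt_iff)
    have Q_img: "openin Y (p ` Q x)" if "x \<in> D" for x
    proof -
      have "openin (subtopology X (U x)) (Q x)" using Q[OF that]
        by (metis openin_subset_topspace_eq openin_subtopology_Int2 inf.absorb_iff2)
      then have "openin (subtopology Y (p ` U x)) (p ` Q x)"
        using homeomorphic_imp_open_map U[OF that] by (metis open_map_def)
      then show ?thesis using U[OF that] openin_trans_full by metis
    qed
    define C where "C = topspace X - (\<Union>x\<in>D. Q x)"
    have "closedin X C" unfolding C_def using Q
      by (intro closedin_diff closedin_topspace openin_Union) auto
    then have "compactin X C" using X(1) closedin_compact_space by blast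
    then have "compactin Y (p ` C)" using image_compactin cont by blast
    then have clC: "closedin Y (p ` C)" using Y compactin_imp_closedin by blast
    \<comment> \<open>Surjectivity makes the fibre nonempty, so the intersection defining
      \<open>V\<close> ranges over a nonempty family.\<close>
    have "y \<in> p ` topspace X" using y onto by simp
    then obtain x0 where x0: "x0 \<in> D" by (auto simp: D_def)
    define V where V: "V = (?Y \<inter> (\<Inter>x\<in>D. p ` Q x)) - p ` C"
    have "openin Y (\<Inter>x\<in>D. p ` Q x)" using finD Q_img x0 by (intro openin_Inter) auto
    then have openV: "openin Y V" unfolding V by (intro openin_diff openin_Int B clC)
    have yV: "y \<in> V" unfolding V using y Q(2) by (auto simp: D_def C_def image_iff intro!: bexI)
    have VY: "V \<subseteq> ?Y" unfolding V by blast
    let ?W = "\<lambda>x. {z \<in> Q x. p z \<in> V}"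
    have OX: "Q x \<subseteq> topspace X" if "x \<in> D" for x using Q(1)[OF that] openin_subset by blast
    have W_X: "?W x \<subseteq> ?X" if "x \<in> D" for x using OX[OF that] VY by auto
    have W_open: "openin X (?W x)" if "x \<in> D" for x
    proof -
      have "?W x = Q x \<inter> {z \<in> topspace X. p z \<in> V}" using OX[OF that] by blast
      then show ?thesis using openin_continuous_map_preimage[OF cont openV] Q(1)[OF that]
        by (simp add: openin_Int)
    qed
    have W_homeo: "homeomorphic_map (subtopology X (?W x)) (subtopology Y V) p" if x: "x \<in> D" for x
    proof -
      have VQ: "V \<subseteq> p ` Q x" using x unfolding V by blast
      have WU: "U x \<inter> ?W x = ?W x" using Q(3)[OF x] by blast
      have VU: "p ` U x \<inter> V = V" using VQ Q(3)[OF x] by blast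
      have "p ` (topspace (subtopology X (U x)) \<inter> ?W x) = topspace (subtopology Y (p ` U x)) \<inter> V"
      proof -
        have "p ` ?W x = V" using VQ by blast
        moreover have "topspace (subtopology X (U x)) \<inter> ?W x = ?W x" using WU OX[OF x] by auto
        moreover have "topspace (subtopology Y (p ` U x)) \<inter> V = V" using VU VY by auto
        ultimately show ?thesis by simp
      qed
      then have "homeomorphic_map (subtopology (subtopology X (U x)) (?W x)) (subtopology (subtopology Y (p ` U x)) V) p"
        using U[OF x] homeomorphic_map_subtopologies by blast
      then show ?thesis by (simp only: subtopology_subtopology WU VU)
    qed
    show "\<exists>V. openin (subtopology Y ?Y) V \<and> y \<in> V \<and>
        (\<exists>\<U>. \<Union>\<U> = {x \<in> topspace (subtopology X ?X). p x \<in> V} \<and> (\<forall>U \<in> \<U>. openin (subtopology X ?X) U) \<and> pairwise disjnt \<U> \<and>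
           (\<forall>U \<in> \<U>. homeomorphic_map (subtopology (subtopology X ?X) U) (subtopology (subtopology Y ?Y) V) p))"
    proof (intro exI[of _ V] conjI exI[of _ "?W ` D"] yV)
      show "openin (subtopology Y ?Y) V" using openV VY
        by (metis inf.absorb_iff2 openin_subtopology_Int2)
      show "\<Union> (?W ` D) = {x \<in> topspace (subtopology X ?X). p x \<in> V}"
      proof
        show "\<Union> (?W ` D) \<subseteq> {x \<in> topspace (subtopology X ?X). p x \<in> V}" using W_X by fastforce
        show "{x \<in> topspace (subtopology X ?X). p x \<in> V} \<subseteq> \<Union> (?W ` D)"
        proof
          fix z assume z: "z \<in> {x \<in> topspace (subtopology X ?X). p x \<in> V}"
          then have "z \<in> topspace X" "p z \<in> V" by auto
          then have "z \<notin> C" unfolding V by blast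
          then obtain x where "x \<in> D" "z \<in> Q x" using \<open>z \<in> topspace X\<close> unfolding C_def by blast
          then show "z \<in> \<Union> (?W ` D)" using \<open>p z \<in> V\<close> by blast
        qed
      qed
      show "\<forall>U \<in> ?W ` D. openin (subtopology X ?X) U"
        using W_open W_X openX by (auto simp: openin_open_subtopology)
      show "pairwise disjnt (?W ` D)"
        unfolding pairwise_def using Q_dis by (fastforce simp: disjnt_iff)
      show "\<forall>U \<in> ?W ` D. homeomorphic_map (subtopology (subtopology X ?X) U) (subtopology (subtopology Y ?Y) V) p"
      proof
        fix U assume "U \<in> ?W ` D"
        then obtain x where x: "x \<in> D" "U = ?W x" by blast
        have "?X \<inter> U = U" "?Y \<inter> V = V" using W_X[OF x(1)] VY x(2) by auto
        then show "homeomorphic_map (subtopology (subtopology X ?X) U) (subtopology (subtopology Y ?Y) V) p"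
          using W_homeo[OF x(1)] x(2) by (simp only: subtopology_subtopology)
      qed
    qed
  qed
qed

section \<open>The covering\<close>

locale lattice_pattern = convex_pattern M vs \<sigma> q + plane_lattice a b
  for M :: "'a tsurf" and vs \<sigma> q a b +
  assumes tau_mem: "\<And>i. i < n \<Longrightarrow> \<tau> i \<in> \<Lambda>"
begin

definition proj :: "'a \<Rightarrow> (real^2) set" where
  "proj y = \<pi> (SOME x. x \<in> R \<and> q x = y)"

text \<open>Points of a fibre differ by sums of translation vectors, which lie in \<Lambda>, so the
  choice of a preimage does not affect its coset.\<close>

lemma proj_q: assumes "x \<in> R" shows "proj (q x) = \<pi> x"
proof -
  let ?x = "SOME x'. x' \<in> R \<and> q x' = q x"
  have x: "?x \<in> R \<and> q ?x = q x" by (rule someI[of _ x]) (use assms in simp)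
  have fib: "y - x \<in> \<Lambda>" if "x \<in> R" "y \<in> R" "q x = q y" for x y
    using that
  proof (induction rule: fibre_induct)
    case refl then show ?case by (simp add: zero_mem)
  next
    case (step y i)
    have "y + \<tau> i - x = (y - x) + \<tau> i" by simp
    then show ?case using add_mem[OF step(1) tau_mem[OF step(2)]] by (simp only:)
  qed
  have "x - ?x \<in> \<Lambda>" using fib[of ?x x] x assms by simp
  then show ?thesis unfolding proj_def coset_eq_iff .
qed

lemma compact_surface: "compact_space (surf M)"
proof -
  have "compactin (top_of_set R) R" using compact_region by (simp add: compactin_subtopology)
  then have "compactin (surf M) (q ` R)" by (rule image_compactin[OF _ q_continuous])
  then show ?thesis by (simp add: q_onto compact_space_def)
qed

lemma proj_continuous: "continuous_map (surf M) \<T> proj"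
proof (rule continuous_compose_quotient_map[OF quot])
  show "continuous_map (top_of_set R) \<T> (proj \<circ> q)"
    by (rule continuous_map_eq[OF coset_continuous]) (simp add: proj_q)
qed

text \<open>This local form of \<open>proj\<close> yields both the local homeomorphisms and the
  compatibility with the charts of the torus.\<close>

lemma proj_chart:
  assumes U: "(U, \<phi>) \<in> atlas M" "y \<in> U" and x: "proj y = \<pi> x"
  obtains W where "openin (surf M) W" "y \<in> W" "W \<subseteq> U" "\<And>z. z \<in> W \<Longrightarrow> proj z = \<pi> (x + (\<phi> z - \<phi> y))"
proof -
  obtain W where W: "openin (surf M) W" "y \<in> W" "W \<subseteq> U"
    "\<And>z. z \<in> W \<Longrightarrow> \<exists>p\<in>R. \<exists>p'\<in>R. q p = y \<and> q p' = z \<and> p' - p = \<phi> z - \<phi> y"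
    using regular_local_lift[OF U] by blast
  show thesis
  proof (rule that[OF W(1-3)])
    fix z assume "z \<in> W"
    then obtain p p' where p: "p \<in> R" "p' \<in> R" "q p = y" "q p' = z" "p' - p = \<phi> z - \<phi> y" using W(4)
      by blast
    have "\<pi> p = \<pi> x" using proj_q[OF p(1)] p(3) x by simp
    then have "x - p \<in> \<Lambda>" by (simp add: coset_eq_iff)
    moreover have "x + (\<phi> z - \<phi> y) - p' = x - p" unfolding p(5)[symmetric] by simp
    ultimately have "\<pi> p' = \<pi> (x + (\<phi> z - \<phi> y))" by (simp only: coset_eq_iff)
    then show "proj z = \<pi> (x + (\<phi> z - \<phi> y))" using proj_q[OF p(2)] p(4) by simp
  qed
qed

lemma proj_local_homeo:
  assumes "y \<in> regular_part M"
  shows "\<exists>U. openin (surf M) U \<and> y \<in> U \<and> openin \<T> (proj ` U) \<and>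
       homeomorphic_map (subtopology (surf M) U) (subtopology \<T> (proj ` U)) proj"
proof -
  obtain U \<phi> where U: "(U, \<phi>) \<in> atlas M" "y \<in> U" using regular_chart assms by metis
  obtain x where x: "proj y = \<pi> x" unfolding proj_def by blast
  obtain W where W: "openin (surf M) W" "y \<in> W" "W \<subseteq> U" "\<And>z. z \<in> W \<Longrightarrow> proj z = \<pi> (x + (\<phi> z - \<phi> y))"
    using proj_chart[OF U x] by blast
  obtain r where r: "r > 0" "\<And>z. z \<in> U \<Longrightarrow> dist (\<phi> z) (\<phi> y) < r \<Longrightarrow> z \<in> W"
    using chart_nbhd[OF U(1) W(1) U(2) W(2)] by metis
  obtain \<delta> where \<delta>: "\<delta> > 0" "\<And>l. l \<in> \<Lambda> \<Longrightarrow> norm l < \<delta> \<Longrightarrow> l = 0" using separation by blast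
  \<comment> \<open>Two points whose coordinates lie within \<delta>/2 of the same centre cannot
    differ by a nonzero lattice vector, so \<open>proj\<close> is injective on this
    neighbourhood.\<close>
  define \<rho> where "\<rho> = min r (\<delta> / 2)"
  have \<rho>: "\<rho> > 0" using r(1) \<delta>(1) by (simp add: \<rho>_def)
  define U' where "U' = {z \<in> U. \<phi> z \<in> ball (\<phi> y) \<rho>}"
  have U'U: "U' \<subseteq> U" and U'W: "U' \<subseteq> W" using r(2) by (auto simp: U'_def \<rho>_def dist_commute)
  have oU': "openin (surf M) U'" unfolding U'_def by (rule chart_vimage_openin[OF U(1) open_ball])
  have yU': "y \<in> U'" using U(2) \<rho> by (simp add: U'_def)
  have ts: "topspace (subtopology (surf M) U') = U'" using openin_subset[OF oU'] by auto
  have op: "openin \<T> (proj ` V)" if V: "openin (surf M) V" "V \<subseteq> U'" for V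
  proof -
    have "proj ` V = \<pi> ` (+) (x - \<phi> y) ` \<phi> ` V"
      unfolding image_image using W(4) V(2) U'W by (intro image_cong) (auto simp: algebra_simps)
    moreover have "open (\<phi> ` V)" using chart_image_open[OF U(1) V(1)] V(2) U'U by blast
    ultimately show ?thesis by (simp add: coset_open_image open_translation)
  qed
  have inj: "inj_on proj U'"
  proof (rule inj_onI)
    fix z w assume zw: "z \<in> U'" "w \<in> U'" "proj z = proj w"
    then have "\<pi> (x + (\<phi> z - \<phi> y)) = \<pi> (x + (\<phi> w - \<phi> y))" using W(4) U'W by auto
    then have l: "\<phi> w - \<phi> z \<in> \<Lambda>" by (simp add: coset_eq_iff)
    have "dist (\<phi> w) (\<phi> z) \<le> dist (\<phi> y) (\<phi> w) + dist (\<phi> y) (\<phi> z)" by (rule dist_triangle3)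
    also have "\<dots> < \<delta>" using zw(1,2) by (auto simp: U'_def \<rho>_def)
    finally have "\<phi> w = \<phi> z" using \<delta>(2)[OF l] by (simp add: dist_norm)
    then show "z = w" using inj_onD[OF chart_inj[OF U(1)]] zw U'U by (metis subsetD)
  qed
  have "homeomorphic_map (subtopology (surf M) U') (subtopology \<T> (proj ` U')) proj"
  proof (rule bijective_open_imp_homeomorphic_map)
    show "continuous_map (subtopology (surf M) U') (subtopology \<T> (proj ` U')) proj"
      using proj_continuous
        by (auto simp: continuous_map_in_subtopology continuous_map_from_subtopology)
    show "open_map (subtopology (surf M) U') (subtopology \<T> (proj ` U')) proj"
      unfolding open_map_def
    proof (intro allI impI)
      fix V assume "openin (subtopology (surf M) U') V"
      then have V: "openin (surf M) V" "V \<subseteq> U'" using openin_open_subtopology[OF oU'] by auto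
      have "proj ` V \<subseteq> proj ` U'" using V(2) by blast
      then show "openin (subtopology \<T> (proj ` U')) (proj ` V)"
        using op[OF V] by (simp add: openin_open_subtopology[OF op[OF oU' order_refl]])
    qed
    show "proj ` topspace (subtopology (surf M) U') = topspace (subtopology \<T> (proj ` U'))"
      unfolding ts topspace_subtopology_subset[OF openin_subset[OF op[OF oU' order_refl]]] ..
    show "inj_on proj (topspace (subtopology (surf M) U'))" using inj ts by simp
  qed
  then show ?thesis using oU' yU' op[OF oU' order_refl] by blast
qed

abbreviation "F \<equiv> \<pi> ` set vs"

lemma proj_regular:
  assumes "y \<in> topspace (surf M)" "proj y \<notin> F" shows "y \<in> regular_part M"
proof -
  obtain x where x: "x \<in> R" "y = q x" using assms(1) unfolding q_onto[symmetric] by auto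
  then have "x \<notin> set vs" using assms(2) proj_q by auto
  then show ?thesis using nonvertex_regular x by simp
qed

text \<open>Preimages of a coset in the polygon correspond to lattice points in a translate of the
  bounded region.\<close>

lemma proj_fibre_finite: "finite {y \<in> topspace (surf M). proj y = \<pi> x}"
proof -
  have "bounded ((\<lambda>z. z - x) ` R)"
    using bounded_translation_minus[OF compact_imp_bounded[OF compact_region]] .
  then have "finite ((\<lambda>z. z - x) ` R \<inter> \<Lambda>)" by (rule finite_bounded)
  then have "finite ((\<lambda>l. q (l + x)) ` ((\<lambda>z. z - x) ` R \<inter> \<Lambda>))" by (rule finite_imageI)
  moreover have "{y \<in> topspace (surf M). proj y = \<pi> x} \<subseteq> (\<lambda>l. q (l + x)) ` ((\<lambda>z. z - x) ` R \<inter> \<Lambda>)"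
  proof
    fix y assume y: "y \<in> {y \<in> topspace (surf M). proj y = \<pi> x}"
    then obtain z where z: "z \<in> R" "y = q z" unfolding q_onto[symmetric] by auto
    then have "\<pi> x = \<pi> z" using y proj_q by simp
    then have "z - x \<in> \<Lambda>" by (simp add: coset_eq_iff)
    then have "z - x \<in> (\<lambda>z. z - x) ` R \<inter> \<Lambda>" using z(1) by blast
    then show "y \<in> (\<lambda>l. q (l + x)) ` ((\<lambda>z. z - x) ` R \<inter> \<Lambda>)" by (rule rev_image_eqI) (simp add: z)
  qed
  ultimately show ?thesis by (rule finite_subset[rotated])
qed

text \<open>The union of the lattice translates of the region is closed, and open away from the countable
  set of translates of vertices, whose complement is connected.\<close>

lemma region_translates: "\<exists>x\<in>R. \<pi> x = \<pi> z"
proof -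
  define K where "K = (\<Union>x\<in>R. \<Union>l\<in>\<Lambda>. {x + l})"
  define V where "V = (\<Union>x\<in>set vs. \<Union>l\<in>\<Lambda>. {x + l})"
  have iff: "x \<in> (\<Union>p\<in>S. \<Union>l\<in>\<Lambda>. {p + l}) \<longleftrightarrow> (\<exists>p\<in>S. x - p \<in> \<Lambda>)" for x S
  proof
    assume "\<exists>p\<in>S. x - p \<in> \<Lambda>"
    then obtain p where "p \<in> S" "x - p \<in> \<Lambda>" "x = p + (x - p)" by auto
    then show "x \<in> (\<Union>p\<in>S. \<Union>l\<in>\<Lambda>. {p + l})" by blast
  next
    assume "x \<in> (\<Union>p\<in>S. \<Union>l\<in>\<Lambda>. {p + l})"
    then obtain p l where "p \<in> S" "l \<in> \<Lambda>" "x = p + l" by blast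
    then show "\<exists>p\<in>S. x - p \<in> \<Lambda>" by (intro bexI[of _ p]) auto
  qed
  have K_iff: "x \<in> K \<longleftrightarrow> (\<exists>p\<in>R. x - p \<in> \<Lambda>)" and V_iff: "x \<in> V \<longleftrightarrow> (\<exists>p\<in>set vs. x - p \<in> \<Lambda>)" for x
    unfolding K_def V_def by (rule iff)+
  have clK: "closed K" unfolding K_def using compact_closed_sums[OF compact_region lattice_closed] .
  have cV: "countable V" unfolding V_def using lattice_countable
    by (intro countable_UN countable_finite[OF finite_set]) auto
  have "compact (set vs)" by (simp add: finite_imp_compact)
  then have clV: "closed V" unfolding V_def using compact_closed_sums[OF _ lattice_closed] by blast
  have open_K: "open (K - V)"
  proof (subst open_contains_ball, intro ballI)
    fix z assume z: "z \<in> K - V"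
    then have zK: "z \<in> K" and zV: "z \<notin> V" by auto
    obtain x where x: "x \<in> R" "z - x \<in> \<Lambda>" using zK unfolding K_iff by auto
    have "x \<notin> set vs" using zV x unfolding V_iff by auto
    then obtain r where r: "r > 0" "\<And>w. norm w < r \<Longrightarrow> \<exists>p\<in>R. q p = q x \<and> p + w \<in> R"
      using fills_ball[OF x(1)] nonvertex_regular[OF x(1)] by metis
    have K: "ball z r \<subseteq> K"
    proof
      fix y assume "y \<in> ball z r"
      then have "norm (y - z) < r" by (simp add: dist_norm norm_minus_commute)
      then obtain p where p: "p \<in> R" "q p = q x" "p + (y - z) \<in> R" using r(2) by blast
      have "\<pi> p = \<pi> x" using proj_q[OF p(1)] proj_q[OF x(1)] p(2) by simp
      then have "(x - p) + (z - x) \<in> \<Lambda>" using x(2) by (intro add_mem) (simp_all add: coset_eq_iff)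
      then have "y - (p + (y - z)) \<in> \<Lambda>" by simp
      then show "y \<in> K" unfolding K_iff using p(3) by blast
    qed
    obtain e where e: "e > 0" "ball z e \<subseteq> - V" using clV zV unfolding closed_def open_contains_ball
      by blast
    have "ball z (min r e) \<subseteq> K - V" using K e(2) by auto
    then show "\<exists>e>0. ball z e \<subseteq> K - V" using r(1) e(1) by (intro exI[of _ "min r e"]) auto
  qed
  have con: "connected (- V)"
    using path_connected_complement_countable[OF _ cV] path_connected_imp_connected by auto
  \<comment> \<open>The connectedness argument needs a point to start from; the open polygon has
    positive measure, so it is not contained in the countable set \<open>V\<close>.\<close>
  have "\<not> countable I"
    using inside_not_negligible null_sets_completionI[OF countable_imp_null_set_lborel]
      by (auto simp: negligible_iff_null_sets)
  then have "\<not> I \<subseteq> V" using cV countable_subset by blast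
  then obtain x0 where x0: "x0 \<in> I" "x0 \<notin> V" by blast
  then have x0K: "x0 \<in> K" unfolding K_iff using inside_subset zero_mem by (intro bexI[of _ x0]) auto
  have sub: "- V \<subseteq> K"
  proof (rule ccontr)
    assume "\<not> - V \<subseteq> K"
    then have "- K \<inter> - V \<noteq> {}" by blast
    moreover have "(K - V) \<inter> - V \<noteq> {}" using x0 x0K by blast
    moreover have "- V \<subseteq> (K - V) \<union> - K" "(K - V) \<inter> - K \<inter> - V = {}" by blast+
    ultimately show False using connectedD[OF con open_K, of "- K"] clK by (simp add: open_Compl)
  qed
  \<comment> \<open>This also covers the points of \<open>V\<close>: a closed set that misses a
    point misses a ball, and a ball is uncountable.\<close>
  have "z \<in> K"
  proof (rule ccontr)
    assume "z \<notin> K"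
    then obtain e where e: "e > 0" "ball z e \<subseteq> - K" using clK
      unfolding closed_def open_contains_ball by blast
    then have "ball z e \<subseteq> V" using sub by blast
    then have "countable (ball z e)" using cV countable_subset by blast
    then show False using e(1) uncountable_ball by blast
  qed
  then show ?thesis unfolding K_iff coset_eq_iff .
qed

lemma proj_onto: "proj ` topspace (surf M) = topspace \<T>"
proof
  show "proj ` topspace (surf M) \<subseteq> topspace \<T>" unfolding proj_def by auto
  show "topspace \<T> \<subseteq> proj ` topspace (surf M)"
  proof
    fix Y assume "Y \<in> topspace \<T>"
    then obtain z where "Y = \<pi> z" by auto
    then obtain x where "x \<in> R" "Y = \<pi> x" using region_translates[of z] by metis
    then have "Y = proj (q x)" "q x \<in> topspace (surf M)" using proj_q q_topspace by auto
    then show "Y \<in> proj ` topspace (surf M)" by (rule image_eqI)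
  qed
qed

lemma branched_covering: "branched_covering_map (surf M) \<T> proj"
  unfolding branched_covering_map_def
proof (intro conjI exI[of _ F] proj_continuous proj_onto)
  show fin: "finite F" by simp
  show sub: "F \<subseteq> topspace \<T>" by auto
  have "{y \<in> topspace (surf M). proj y \<in> F} = (\<Union>w\<in>set vs. {y \<in> topspace (surf M). proj y = \<pi> w})"
    by auto
  then show "finite {y \<in> topspace (surf M). proj y \<in> F}" using proj_fibre_finite by simp
  have "closedin \<T> F"
    by (rule compactin_imp_closedin[OF Hausdorff_torus finite_imp_compactin[OF sub fin]])
  then have F: "openin \<T> (topspace \<T> - F)" by (rule openin_diff[OF openin_topspace])
  show "covering_map (subtopology (surf M) {y \<in> topspace (surf M). proj y \<notin> F}) (subtopology \<T> (topspace \<T> - F)) proj"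
  proof (rule proper_local_homeo_covering[OF compact_surface haus Hausdorff_torus proj_continuous proj_onto F])
    show "finite {y \<in> topspace (surf M). proj y = Y}" if "Y \<in> topspace \<T> - F" for Y
      using that proj_fibre_finite by auto
  qed (rule proj_local_homeo[OF proj_regular])
qed

lemma branched_translation_covering: "branched_translation_covering M (flat_torus \<Lambda> F) proj"
  unfolding branched_translation_covering_def
proof (intro conjI)
  show "branched_covering_map (surf M) (surf (flat_torus \<Lambda> F)) proj"
    using branched_covering by (simp add: flat_torus_def)
  have "proj (q w) \<in> F" if "w \<in> set vs" for w using proj_q[of w] that vertices_region by auto
  then show "proj ` sing M \<subseteq> sing (flat_torus \<Lambda> F)"
    using sing_vertices by (auto simp: flat_torus_def)
  have chart: "\<exists>W w. openin (surf M) W \<and> x \<in> W \<and> W \<subseteq> U \<and> (\<forall>y \<in> W. proj y \<in> V \<and> \<psi> (proj y) = \<phi> y +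
    w)"
    if U: "(U, \<phi>) \<in> atlas M" and V: "(V, \<psi>) \<in> atlas (flat_torus \<Lambda> F)" and x: "x \<in> U" "proj x \<in> V"
      for U \<phi> V \<psi> x
  proof -
    obtain B where B: "V = \<pi> ` B" "\<psi> = inv_into B \<pi>" "open B" "inj_on \<pi> B"
      using V by (auto simp: flat_torus_def)
    obtain p where p: "p \<in> B" "proj x = \<pi> p" using x(2) B(1) by blast
    obtain W where W: "openin (surf M) W" "x \<in> W" "W \<subseteq> U" "\<And>z. z \<in> W \<Longrightarrow> proj z = \<pi> (p + (\<phi> z - \<phi> x))"
      using proj_chart[OF U x(1) p(2)] by blast
    \<comment> \<open>Shrinking \<open>W\<close> keeps the lift
      \<open>p + (\<phi> z - \<phi> x)\<close> inside \<open>B\<close>, the set on which the torus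
      chart inverts the projection.\<close>
    let ?W = "W \<inter> {z \<in> U. \<phi> z \<in> (+) (\<phi> x - p) ` B}"
    have 1: "openin (surf M) ?W"
      by (intro openin_Int W(1) chart_vimage_openin[OF U] open_translation B(3))
    have 2: "x \<in> ?W" using W(2) x(1) p(1) by (auto intro!: image_eqI[of _ _ p])
    have 3: "proj z \<in> V \<and> \<psi> (proj z) = \<phi> z + (p - \<phi> x)" if "z \<in> ?W" for z
    proof -
      have pz: "proj z = \<pi> (p + (\<phi> z - \<phi> x))" using W(4) that by blast
      obtain b' where "b' \<in> B" "\<phi> z = (\<phi> x - p) + b'" using \<open>z \<in> ?W\<close> by blast
      then have "p + (\<phi> z - \<phi> x) \<in> B" by simp
      then show ?thesis unfolding pz B(1,2) using B(4) by simp
    qed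
    show ?thesis using 1 2 3 W(3) by (intro exI[of _ ?W] exI[of _ "p - \<phi> x"]) blast
  qed
  show "\<forall>(U, \<phi>) \<in> atlas M. \<forall>(V, \<psi>) \<in> atlas (flat_torus \<Lambda> F). \<forall>x \<in> U. proj x \<in> V \<longrightarrow>
        (\<exists>W w. openin (surf M) W \<and> x \<in> W \<and> W \<subseteq> U \<and> (\<forall>y \<in> W. proj y \<in> V \<and> \<psi> (proj y) = \<phi> y + w))"
  proof (unfold case_prod_unfold, intro ballI impI)
    fix A B x assume "A \<in> atlas M" "B \<in> atlas (flat_torus \<Lambda> F)" "x \<in> fst A" "proj x \<in> fst B"
    then show "\<exists>W w. openin (surf M) W \<and> x \<in> W \<and> W \<subseteq> fst A \<and> (\<forall>y \<in> W. proj y \<in> fst B \<and>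
      snd B (proj y) = snd A y + w)"
      using chart[of "fst A" "snd A" "fst B" "snd B" x] by simp
  qed
qed

end

theorem corollary2p1:
  fixes M :: "'a tsurf"
  assumes "convex_translation_surface M"
    and "purely_periodic M"
  shows "torus_branched_covering M"
proof -
  have M: "translation_surface M" using assms(1) unfolding convex_translation_surface_def by blast
  obtain vs \<sigma> where pat: "is_pattern M vs \<sigma>" and conv: "convex (polygon_region vs)"
    using assms(1) unfolding convex_translation_surface_def by blast
  obtain q where q: "quotient_map (top_of_set (polygon_region vs)) (surf M) q"
    "\<forall>x \<in> polygon_region vs. \<forall>y \<in> polygon_region vs. q x = q y \<longleftrightarrow> equivclp (glued vs \<sigma>) x y"
    "sing M \<subseteq> q ` set vs"
    "\<forall>p \<in> polygon_region vs. \<forall>(U, \<phi>) \<in> atlas M. q p \<in> U \<longrightarrow>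
           (\<exists>e>0. \<forall>z \<in> polygon_region vs \<inter> ball p e. q z \<in> U \<and> \<phi> (q z) = \<phi> (q p) + (z - p))"
    using pat unfolding is_pattern_def by blast
  have loc: "\<exists>e>0. \<forall>z \<in> polygon_region vs \<inter> ball p e. q z \<in> U \<and> \<phi> (q z) = \<phi> (q p) + (z - p)"
    if "p \<in> polygon_region vs" "(U, \<phi>) \<in> atlas M" "q p \<in> U" for p U \<phi>
    using bspec[OF bspec[OF q(4) that(1)] that(2)] that(3) by simp
  interpret convex_pattern M vs \<sigma> q
  proof
    show "translation_atlas M" "Hausdorff_space (surf M)"
      using M unfolding translation_surface_def topological_surface_def by blast+
    show "is_polygon vs" "edge_pairing vs \<sigma>" using pat unfolding is_pattern_def by blast+
    show "q x = q y \<longleftrightarrow> equivclp (glued vs \<sigma>) x y" if "x \<in> polygon_region vs" "y \<in> polygon_region vs"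
      for x y
      using q(2) that by blast
  qed (rule q conv loc; assumption?)+
  obtain a b
    where ab: "a \<noteq> 0" "\<And>c. b \<noteq> c *\<^sub>R a"
    "\<And>i. i < n \<Longrightarrow> \<exists>k l::int. \<tau> i = of_int k *\<^sub>R a + of_int l *\<^sub>R b"
    by (rule tau_lattice[OF assms(2)], rule that)
  interpret plane_lattice a b using ab(1,2) by unfold_locales
  interpret lattice_pattern M vs \<sigma> q a b
  proof
    show "\<tau> i \<in> \<Lambda>" if "i < n" for i using ab(3)[OF that] latticeI by auto
  qed
  have "finite F" "F \<subseteq> range (coset \<Lambda>)" by auto
  then show ?thesis
    unfolding torus_branched_covering_def using M is_lattice branched_translation_covering by blast
qed

end
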